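(* Fix $T>0$, let $u\in L^\infty_{\mathrm{loc}}([0,T);W^{1,\infty}(\mathbb{T}^d))$ be divergence free, and let $\theta_0\in H^2(\mathbb{T}^d)$ be mean zero. For $\kappa>0$ let $\theta^\kappa$ be the solution of $\partial_t\theta^\kappa+u\cdot\nabla\theta^\kappa=\kappa\Delta\theta^\kappa$, and let $\theta$ be the solution of $\partial_t\theta+u\cdot\nabla\theta=0$, both with initial data $\theta_0$ (independent of $\kappa$). Suppose $$\int_0^T|\nabla\theta(s)|_{L^2}^2\,\mathrm{d}s=+\infty$$ and that there is a constant $C\ge1$, independent of $\kappa$ and $t$, such that $$|\theta(t)|_{H^{-1}}\le C\,\frac{|\theta_0|_{L^2}^2}{|\theta(t)|_{\dot H^1}}\qquad\text{for all } t\in[0,T).$$ Then, for all $\kappa>0$, $$\kappa\int_0^T|\nabla\theta^\kappa|_{L^2}^2\,\mathrm{d}t\ \ge\ \frac{1}{64\,C^2}\,|\theta_0|_{L^2}^2 .$$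
   Context: $d\ge2$ and $\mathbb{T}^d=(\mathbb{R}/2\pi\mathbb{Z})^d$. Norms: $|f|_{L^2}=(\int_{\mathbb{T}^d}|f|^2\,\mathrm{d}x)^{1/2}$, $|f|_{\dot H^1}^2=|\nabla f|_{L^2}^2=\sum_i|\partial_i f|_{L^2}^2$. For mean-zero $f$, $|f|_{H^{-1}}=\sup\{\int_{\mathbb{T}^d} fg\,\mathrm{d}x : \int_{\mathbb{T}^d} g\,\mathrm{d}x=0,\ |\nabla g|_{L^2}\le1\}$ (equivalently, up to the normalization making this consistent with $|\cdot|_{L^2}$, the Fourier norm with weights $|k|^{-2}$ over $k\neq0$). "Mean zero" means $\int_{\mathbb{T}^d}\theta_0\,\mathrm{d}x=0$. *)

theory Defs
  imports "HOL-Analysis.Analysis"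
begin

text \<open>
  Functions on the torus of side \<open>2 * pi\<close> are functions on \<open>real ^ 'n\<close> that are \<open>2 * pi\<close>-periodic
  in every coordinate; they are integrated over one period cell. Elements of Lebesgue and Sobolev
  spaces are represented by functions, identified when equal almost everywhere.
\<close>

definition periodic :: "(real ^ 'n \<Rightarrow> 'b) \<Rightarrow> bool" where
  "periodic f \<longleftrightarrow> (\<forall>x i. f (x + axis i (2 * pi)) = f x)"

definition torus :: "(real ^ 'n) measure" where
  "torus = lebesgue_on (cbox 0 (\<chi> i. 2 * pi))"

definition mean_zero :: "(real ^ 'n \<Rightarrow> real) \<Rightarrow> bool" where
  "mean_zero f \<longleftrightarrow> (LINT x|torus. f x) = 0"

definition partial_deriv :: "'n \<Rightarrow> (real ^ 'n \<Rightarrow> real) \<Rightarrow> real ^ 'n \<Rightarrow> real" where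
  "partial_deriv i f x = frechet_derivative f (at x) (axis i 1)"

definition smooth :: "(real ^ 'n \<Rightarrow> real) \<Rightarrow> bool" where
  "smooth f \<longleftrightarrow> (\<forall>is x. foldr partial_deriv is f differentiable (at x))"

definition L1_torus :: "(real ^ 'n \<Rightarrow> real) set" where
  "L1_torus = {f. periodic f \<and> f \<in> borel_measurable lebesgue \<and> integrable torus f}"

definition has_weak_deriv ::
    "'n \<Rightarrow> (real ^ 'n \<Rightarrow> real) \<Rightarrow> (real ^ 'n \<Rightarrow> real) \<Rightarrow> bool" where
  "has_weak_deriv i f g \<longleftrightarrow> f \<in> L1_torus \<and> g \<in> L1_torus \<and>
    (\<forall>\<phi>. smooth \<phi> \<and> periodic \<phi> \<longrightarrow>
       (LINT x|torus. f x * partial_deriv i \<phi> x) = - (LINT x|torus. g x * \<phi> x))"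

definition weakly_differentiable :: "(real ^ 'n \<Rightarrow> real) \<Rightarrow> bool" where
  "weakly_differentiable f \<longleftrightarrow> (\<forall>i. \<exists>g. has_weak_deriv i f g)"

text \<open>Weak derivatives are unique only up to null sets; one representative is chosen.\<close>

definition weak_deriv :: "'n \<Rightarrow> (real ^ 'n \<Rightarrow> real) \<Rightarrow> real ^ 'n \<Rightarrow> real" where
  "weak_deriv i f = (SOME g. has_weak_deriv i f g)"

definition L2_torus :: "(real ^ 'n \<Rightarrow> real) set" where
  "L2_torus = {f. periodic f \<and> f \<in> borel_measurable lebesgue \<and> integrable torus (\<lambda>x. (f x)\<^sup>2)}"

definition L2_norm :: "(real ^ 'n \<Rightarrow> real) \<Rightarrow> real" where
  "L2_norm f = sqrt (LINT x|torus. (f x)\<^sup>2)"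

definition H1_torus :: "(real ^ 'n \<Rightarrow> real) set" where
  "H1_torus = {f \<in> L2_torus. weakly_differentiable f \<and> (\<forall>i. weak_deriv i f \<in> L2_torus)}"

definition H2_torus :: "(real ^ 'n \<Rightarrow> real) set" where
  "H2_torus = {f \<in> H1_torus. \<forall>i. weak_deriv i f \<in> H1_torus}"

text \<open>The homogeneous norm is extended by \<open>\<infinity>\<close> outside \<open>H1_torus\<close>.\<close>

definition Hdot1_norm :: "(real ^ 'n \<Rightarrow> real) \<Rightarrow> ennreal" where
  "Hdot1_norm f =
    (if f \<in> H1_torus then ennreal (sqrt (\<Sum>i\<in>UNIV. (L2_norm (weak_deriv i f))\<^sup>2)) else \<infinity>)"

text \<open>Negative pairings are cut off at 0 by \<open>ennreal\<close>; since \<open>g = 0\<close> is admissible, this does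
  not change the supremum.\<close>

definition Hminus1_norm :: "(real ^ 'n \<Rightarrow> real) \<Rightarrow> ennreal" where
  "Hminus1_norm f =
    (SUP g \<in> {g \<in> H1_torus. mean_zero g \<and> Hdot1_norm g \<le> 1}. ennreal (LINT x|torus. f x * g x))"

definition W1inf_le :: "real \<Rightarrow> (real ^ 'n \<Rightarrow> real) \<Rightarrow> bool" where
  "W1inf_le M f \<longleftrightarrow> periodic f \<and> f \<in> borel_measurable lebesgue \<and> weakly_differentiable f \<and>
    (AE x in torus. \<bar>f x\<bar> \<le> M) \<and> (\<forall>i. AE x in torus. \<bar>weak_deriv i f x\<bar> \<le> M)"

definition Linf_loc_W1inf :: "real \<Rightarrow> (real \<Rightarrow> real ^ 'n \<Rightarrow> real ^ 'n) set" where
  "Linf_loc_W1inf T = {u.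
     (\<lambda>(t, x). u t x) \<in> borel_measurable (lebesgue_on ({0..<T} \<times> UNIV)) \<and>
     (\<forall>\<tau>\<in>{0..<T}. \<exists>M. AE t in lebesgue_on {0..\<tau>}. \<forall>i. W1inf_le M (\<lambda>x. u t x $ i))}"

definition divergence_free :: "real \<Rightarrow> (real \<Rightarrow> real ^ 'n \<Rightarrow> real ^ 'n) \<Rightarrow> bool" where
  "divergence_free T u \<longleftrightarrow> (AE t in lebesgue_on {0..<T}. AE x in torus.
     (\<Sum>i\<in>UNIV. weak_deriv i (\<lambda>y. u t y $ i) x) = 0)"

definition continuous_in_L2 :: "real \<Rightarrow> (real \<Rightarrow> real ^ 'n \<Rightarrow> real) \<Rightarrow> bool" where
  "continuous_in_L2 T \<theta> \<longleftrightarrow> (\<forall>t\<in>{0..<T}. \<theta> t \<in> L2_torus \<and>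
     ((\<lambda>s. L2_norm (\<lambda>x. \<theta> s x - \<theta> t x)) \<longlongrightarrow> 0) (at t within {0..<T}))"

text \<open>
  Weak solutions of \<open>\<partial>\<^sub>t \<theta> + u \<cdot> \<nabla>\<theta> = \<kappa> \<Delta>\<theta>\<close>, \<open>\<theta>(0) = \<theta>0\<close>, in the energy class
  \<open>C([0,T); L\<^sup>2) \<inter> L\<^sup>2\<^sub>l\<^sub>o\<^sub>c([0,T); H\<^sup>1)\<close>; the case \<open>\<kappa> = 0\<close> is the transport equation. The equation is tested
  with time-independent functions in \<open>H\<^sup>1\<close> and integrated in time.
\<close>

definition weak_form ::
    "real \<Rightarrow> (real ^ 'n \<Rightarrow> real ^ 'n) \<Rightarrow> (real ^ 'n \<Rightarrow> real) \<Rightarrow> (real ^ 'n \<Rightarrow> real) \<Rightarrow> real" where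
  "weak_form \<kappa> w f v =
    (LINT x|torus. (\<Sum>i\<in>UNIV. w x $ i * weak_deriv i f x) * v x
       + \<kappa> * (\<Sum>i\<in>UNIV. weak_deriv i f x * weak_deriv i v x))"

definition advection_diffusion_solution ::
    "real \<Rightarrow> real \<Rightarrow> (real \<Rightarrow> real ^ 'n \<Rightarrow> real ^ 'n) \<Rightarrow> (real ^ 'n \<Rightarrow> real)
      \<Rightarrow> (real \<Rightarrow> real ^ 'n \<Rightarrow> real) \<Rightarrow> bool" where
  "advection_diffusion_solution T \<kappa> u \<theta>0 \<theta> \<longleftrightarrow>
     continuous_in_L2 T \<theta> \<and>
     (\<forall>\<tau>\<in>{0..<T}. (\<integral>\<^sup>+t\<in>{0..\<tau>}. (Hdot1_norm (\<theta> t))\<^sup>2 \<partial>lebesgue) < \<infinity>) \<and>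
     (AE x in torus. \<theta> 0 x = \<theta>0 x) \<and>
     (\<forall>v\<in>H1_torus. \<forall>t\<in>{0..<T}.
        set_integrable lebesgue {0..t} (\<lambda>s. weak_form \<kappa> (u s) (\<theta> s) v) \<and>
        (LINT x|torus. \<theta> t x * v x) + (LINT s:{0..t}|lebesgue. weak_form \<kappa> (u s) (\<theta> s) v)
          = (LINT x|torus. \<theta>0 x * v x))"

definition transport_solution ::
    "real \<Rightarrow> (real \<Rightarrow> real ^ 'n \<Rightarrow> real ^ 'n) \<Rightarrow> (real ^ 'n \<Rightarrow> real)
      \<Rightarrow> (real \<Rightarrow> real ^ 'n \<Rightarrow> real) \<Rightarrow> bool" where
  "transport_solution T u \<theta>0 \<theta> \<longleftrightarrow> advection_diffusion_solution T 0 u \<theta>0 \<theta>"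

end

theory Submission
  imports Defs
begin

text \<open>
  Let \<open>\<theta>\<close> solve the transport equation and \<open>\<theta>\<kappa>\<close> the equation with diffusivity \<open>\<kappa>\<close>, both starting from
  \<open>\<theta>0\<close>, and let \<open>Q = \<parallel>\<theta>0\<parallel>\<^sup>2\<close>. Advection by a divergence-free field is skew-symmetric, so it drops out of
  the evolution of the pairing of the two solutions:
  \<open>\<langle>\<theta>(t), \<theta>\<kappa>(t)\<rangle> = Q - \<kappa> \<integral>\<^sub>0\<^sup>t \<langle>\<nabla>\<theta>, \<nabla>\<theta>\<kappa>\<rangle>\<close> (lemma \<open>pairing_of_solutions\<close>).
  Suppose that \<open>\<kappa> \<integral> \<parallel>\<nabla>\<theta>\<kappa>\<parallel>\<^sup>2 < Q / (64 C\<^sup>2)\<close>. Since the gradient of \<open>\<theta>\<close> is not square-integrable in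
  time, there is a time \<open>t < T\<close> at which \<open>\<kappa> \<integral>\<^sub>0\<^sup>t \<parallel>\<nabla>\<theta>\<parallel>\<^sup>2\<close> is exactly \<open>Q / 16\<close> (lemma
  \<open>dissipation_reaches\<close>). Up to this time both dissipations are so small that the pairing stays above
  \<open>Q / 2\<close> (lemma \<open>pairing_lower_bound\<close>). On the other hand the pairing is at most
  \<open>\<parallel>\<theta>\<parallel>\<close> in the negative norm times \<open>\<parallel>\<nabla>\<theta>\<kappa>\<parallel>\<close>, hence by the mixing hypothesis at most
  \<open>C Q \<parallel>\<nabla>\<theta>\<kappa>\<parallel> / \<parallel>\<nabla>\<theta>\<parallel>\<close>. So \<open>\<parallel>\<nabla>\<theta>\<parallel> \<le> 2 C \<parallel>\<nabla>\<theta>\<kappa>\<parallel>\<close> at almost every time up to \<open>t\<close> (lemma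
  \<open>gradient_comparison\<close>), and integration gives
  \<open>Q / 16 = \<kappa> \<integral>\<^sub>0\<^sup>t \<parallel>\<nabla>\<theta>\<parallel>\<^sup>2 \<le> 4 C\<^sup>2 \<kappa> \<integral>\<^sub>0\<^sup>t \<parallel>\<nabla>\<theta>\<kappa>\<parallel>\<^sup>2 < Q / 16\<close>, which is absurd.

  The analytic work lies in the evolution of the pairing for weak solutions, which cannot be tested
  against each other directly, because the test functions are constant in time. Everything is reduced
  to Fourier coefficients. The coefficient of a solution at a fixed frequency is an absolutely
  continuous function of time, so the product rule (lemma \<open>product_rule_integrated\<close>) applies to
  the finitely many terms of the pairing of one solution with a Fourier truncation of the other one.
  The truncations then converge in \<open>H\<^sup>1\<close> at almost every time, and the energy bounds allow to pass to
  the limit under the time integral. This rests on the completeness of the trigonometric system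
  (lemma \<open>trig_system_complete\<close>) and on the theorem of Riesz and Fischer, which also
  characterizes \<open>H\<^sup>1\<close> by Fourier coefficients and thereby shows that the homogeneous norm of a solution
  is a measurable function of time (lemma \<open>Hdot1_norm_sq_eq_SUP\<close>).
\<close>

section \<open>Square-integrable functions on the torus\<close>

definition ip :: "(real ^ 'n \<Rightarrow> real) \<Rightarrow> (real ^ 'n \<Rightarrow> real) \<Rightarrow> real" where
  "ip f g = (LINT x|torus. f x * g x)"

lemma space_torus: "space torus = cbox 0 (\<chi> i. 2 * pi)"
  by (simp add: torus_def space_restrict_space)

lemma finite_measure_torus: "finite_measure torus"
  unfolding torus_def by (rule finite_measure_lebesgue_on) simp

lemma measurable_torus: "f \<in> borel_measurable lebesgue \<Longrightarrow> f \<in> borel_measurable torus"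
  unfolding torus_def by (rule measurable_restrict_space1)

lemma integral_torus_lborel:
  fixes f :: "real ^ 'n \<Rightarrow> real"
  assumes "f \<in> borel_measurable borel"
  shows "(LINT x|torus. f x) = (LINT x|lborel. indicator (cbox 0 (\<chi> i. 2 * pi)) x * f x)"
  unfolding torus_def using assms
  by (subst integral_restrict_space) (auto intro!: integral_completion)

lemma integrable_torus_bounded:
  fixes f :: "real ^ 'n \<Rightarrow> real"
  assumes "f \<in> borel_measurable torus" "\<And>x. \<bar>f x\<bar> \<le> B"
  shows "integrable torus f"
proof -
  interpret finite_measure torus by (rule finite_measure_torus)
  show ?thesis using assms by (intro integrable_const_bound[of _ B]) auto
qed

lemma integrable_torus_mult_bounded:
  fixes f b :: "real ^ 'n \<Rightarrow> real"
  assumes f: "integrable torus f" and b: "b \<in> borel_measurable torus" "AE x in torus. \<bar>b x\<bar> \<le> B"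
  shows "integrable torus (\<lambda>x. b x * f x)"
proof (rule Bochner_Integration.integrable_bound[where f="\<lambda>x. B * \<bar>f x\<bar>"])
  show "integrable torus (\<lambda>x. B * \<bar>f x\<bar>)" using f by auto
  show "(\<lambda>x. b x * f x) \<in> borel_measurable torus" using assms by auto
  show "AE x in torus. norm (b x * f x) \<le> norm (B * \<bar>f x\<bar>)"
    using b(2)
  proof eventually_elim
    case (elim x)
    then have "0 \<le> B" by linarith
    with elim show ?case by (simp add: abs_mult mult_right_mono)
  qed
qed

lemma L2_torusD:
  assumes "f \<in> L2_torus"
  shows "periodic f" "f \<in> borel_measurable lebesgue" "f \<in> borel_measurable torus"
    "integrable torus (\<lambda>x. (f x)\<^sup>2)"
  using assms by (auto simp: L2_torus_def measurable_torus)

lemma integrable_L2_mult: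
  assumes "f \<in> L2_torus" "g \<in> L2_torus"
  shows "integrable torus (\<lambda>x. f x * g x)"
proof (rule Bochner_Integration.integrable_bound[where f="\<lambda>x. (f x)\<^sup>2 + (g x)\<^sup>2"])
  show "integrable torus (\<lambda>x. (f x)\<^sup>2 + (g x)\<^sup>2)" using assms[THEN L2_torusD(4)] by simp
  show "(\<lambda>x. f x * g x) \<in> borel_measurable torus" using assms[THEN L2_torusD(3)] by simp
  have "\<bar>a * b\<bar> \<le> a\<^sup>2 + b\<^sup>2" for a b :: real
  proof -
    have "2 * (\<bar>a\<bar> * \<bar>b\<bar>) \<le> a\<^sup>2 + b\<^sup>2"
      using zero_le_power2[of "\<bar>a\<bar> - \<bar>b\<bar>"] by (simp add: power2_eq_square algebra_simps)
    moreover have "0 \<le> \<bar>a\<bar> * \<bar>b\<bar>" by simp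
    ultimately show ?thesis unfolding abs_mult by linarith
  qed
  then show "AE x in torus. norm (f x * g x) \<le> norm ((f x)\<^sup>2 + (g x)\<^sup>2)"
    by simp
qed

lemma L2_torus_bounded:
  assumes "periodic f" "f \<in> borel_measurable lebesgue" "\<And>x. \<bar>f x\<bar> \<le> B"
  shows "f \<in> L2_torus"
proof -
  have "(f x)\<^sup>2 \<le> B\<^sup>2" for x using assms(3)[of x] by (metis abs_ge_zero power2_abs power_mono)
  then have "integrable torus (\<lambda>x. (f x)\<^sup>2)"
    using assms(2)[THEN measurable_torus] by (intro integrable_torus_bounded[of _ "B\<^sup>2"]) auto
  with assms show ?thesis by (simp add: L2_torus_def)
qed

lemma L2_torus_const: "(\<lambda>x. c) \<in> L2_torus"
  by (rule L2_torus_bounded[of _ "\<bar>c\<bar>"]) (auto simp: periodic_def)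

lemma L2_torus_add:
  assumes "f \<in> L2_torus" "g \<in> L2_torus"
  shows "(\<lambda>x. f x + g x) \<in> L2_torus"
proof -
  have "integrable torus (\<lambda>x. (f x)\<^sup>2 + (g x)\<^sup>2 + 2 * (f x * g x))"
    using assms[THEN L2_torusD(4)] integrable_L2_mult[OF assms] by simp
  then have "integrable torus (\<lambda>x. (f x + g x)\<^sup>2)" by (simp add: power2_sum mult.assoc)
  with assms[THEN L2_torusD(1)] assms[THEN L2_torusD(2)] show ?thesis
    by (auto simp: L2_torus_def periodic_def)
qed

lemma L2_torus_scale: "f \<in> L2_torus \<Longrightarrow> (\<lambda>x. c * f x) \<in> L2_torus"
  by (auto simp: L2_torus_def periodic_def power_mult_distrib)

lemma L2_torus_diff:
  assumes "f \<in> L2_torus" "g \<in> L2_torus"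
  shows "(\<lambda>x. f x - g x) \<in> L2_torus"
  using L2_torus_add[OF assms(1) L2_torus_scale[OF assms(2), of "-1"]] by simp

lemma L2_torus_L1: "f \<in> L2_torus \<Longrightarrow> f \<in> L1_torus"
  using integrable_L2_mult[of f "\<lambda>_. 1"] L2_torus_const[of 1]
  by (simp add: L1_torus_def L2_torusD)

lemma ip_commute: "ip f g = ip g f"
  by (simp add: ip_def mult.commute)

lemma ip_add_left:
  assumes "f \<in> L2_torus" "g \<in> L2_torus" "h \<in> L2_torus"
  shows "ip (\<lambda>x. f x + g x) h = ip f h + ip g h"
  unfolding ip_def using assms by (simp add: ring_distribs integrable_L2_mult)

lemma ip_diff_left:
  assumes "f \<in> L2_torus" "g \<in> L2_torus" "h \<in> L2_torus"
  shows "ip (\<lambda>x. f x - g x) h = ip f h - ip g h"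
  unfolding ip_def using assms by (simp add: ring_distribs integrable_L2_mult)

lemma ip_scale_left: "ip (\<lambda>x. c * f x) h = c * ip f h"
  unfolding ip_def by (simp add: mult.assoc)

lemma ip_sum_left:
  assumes "\<And>k. k \<in> K \<Longrightarrow> f k \<in> L2_torus" "h \<in> L2_torus"
  shows "ip (\<lambda>x. \<Sum>k\<in>K. f k x) h = (\<Sum>k\<in>K. ip (f k) h)"
  unfolding ip_def sum_distrib_right using assms
  by (intro Bochner_Integration.integral_sum integrable_L2_mult)

lemma ip_add_right:
  assumes "f \<in> L2_torus" "g \<in> L2_torus" "h \<in> L2_torus"
  shows "ip h (\<lambda>x. f x + g x) = ip h f + ip h g"
  using ip_add_left[OF assms] by (simp add: ip_commute)

lemma ip_diff_right:
  assumes "f \<in> L2_torus" "g \<in> L2_torus" "h \<in> L2_torus"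
  shows "ip h (\<lambda>x. f x - g x) = ip h f - ip h g"
  using ip_diff_left[OF assms] by (simp add: ip_commute)

lemma ip_scale_right: "ip h (\<lambda>x. c * f x) = c * ip h f"
  using ip_scale_left by (simp add: ip_commute)

lemma ip_sum_right:
  assumes "\<And>k. k \<in> K \<Longrightarrow> f k \<in> L2_torus" "h \<in> L2_torus"
  shows "ip h (\<lambda>x. \<Sum>k\<in>K. f k x) = (\<Sum>k\<in>K. ip h (f k))"
  using ip_sum_left[OF assms] by (simp add: ip_commute)

lemma ip_cong_AE:
  assumes "AE x in torus. f x = f' x" "AE x in torus. g x = g' x"
    "f \<in> borel_measurable torus" "f' \<in> borel_measurable torus"
    "g \<in> borel_measurable torus" "g' \<in> borel_measurable torus"
  shows "ip f g = ip f' g'"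
  unfolding ip_def using assms by (intro integral_cong_AE) auto

lemma ip_self_nonneg: "0 \<le> ip f f"
  unfolding ip_def by (rule integral_nonneg_AE) simp

lemma L2_norm_sq: "(L2_norm f)\<^sup>2 = ip f f"
  unfolding L2_norm_def ip_def power2_eq_square
  using ip_self_nonneg[of f] by (simp add: ip_def)

lemma L2_norm_nonneg: "0 \<le> L2_norm f"
  using ip_self_nonneg[of f] by (simp add: L2_norm_def ip_def power2_eq_square)

lemma Cauchy_Schwarz_L2:
  assumes "f \<in> L2_torus" "g \<in> L2_torus"
  shows "\<bar>ip f g\<bar> \<le> L2_norm f * L2_norm g"
proof -
  have q: "0 \<le> ip f f - 2 * t * ip f g + t\<^sup>2 * ip g g" for t
  proof -
    have s: "(\<lambda>x. t * g x) \<in> L2_torus" by (rule L2_torus_scale[OF assms(2)])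
    have "0 \<le> ip (\<lambda>x. f x - t * g x) (\<lambda>x. f x - t * g x)" by (rule ip_self_nonneg)
    also have "\<dots> = ip f f - 2 * t * ip f g + t\<^sup>2 * ip g g"
      using assms s
      by (simp add: ip_diff_left ip_diff_right L2_torus_diff ip_scale_left ip_scale_right
          ip_commute[of g f] power2_eq_square algebra_simps)
    finally show ?thesis .
  qed
  have "(ip f g)\<^sup>2 \<le> ip f f * ip g g"
  proof (cases "ip g g = 0")
    case True
    have "ip f g = 0"
    proof (rule ccontr)
      assume ne: "ip f g \<noteq> 0"
      have "0 \<le> ip f f - 2 * ((ip f f + 1) / (2 * ip f g)) * ip f g"
        using q[of "(ip f f + 1) / (2 * ip f g)"] True by simp
      with ne show False by (simp add: field_simps)
    qed
    then show ?thesis using True by simp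
  next
    case False
    then have pos: "0 < ip g g" using ip_self_nonneg[of g] by simp
    have "0 \<le> ip f f - (ip f g)\<^sup>2 / ip g g"
      using q[of "ip f g / ip g g"] pos by (simp add: power2_eq_square field_simps)
    then show ?thesis using pos by (simp add: field_simps)
  qed
  also have "\<dots> = (L2_norm f * L2_norm g)\<^sup>2" by (simp add: power_mult_distrib L2_norm_sq)
  finally show ?thesis
    using L2_norm_nonneg by (metis abs_le_square_iff abs_of_nonneg mult_nonneg_nonneg)
qed

lemma L2_norm_triangle:
  assumes "f \<in> L2_torus" "g \<in> L2_torus"
  shows "L2_norm (\<lambda>x. f x + g x) \<le> L2_norm f + L2_norm g"
proof (rule power2_le_imp_le)
  have "(L2_norm (\<lambda>x. f x + g x))\<^sup>2 = ip f f + 2 * ip f g + ip g g"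
    using assms by (simp add: L2_norm_sq ip_add_left ip_add_right L2_torus_add ip_commute[of g f])
  also have "\<dots> \<le> (L2_norm f)\<^sup>2 + 2 * (L2_norm f * L2_norm g) + (L2_norm g)\<^sup>2"
    using Cauchy_Schwarz_L2[OF assms] by (simp add: L2_norm_sq)
  finally show "(L2_norm (\<lambda>x. f x + g x))\<^sup>2 \<le> (L2_norm f + L2_norm g)\<^sup>2"
    by (simp add: power2_eq_square algebra_simps)
qed (simp add: L2_norm_nonneg)

lemma L2_norm_scale: "L2_norm (\<lambda>x. c * f x) = \<bar>c\<bar> * L2_norm f"
  by (simp add: L2_norm_def power_mult_distrib real_sqrt_mult)

lemma L2_norm_diff_commute: "L2_norm (\<lambda>x. f x - g x) = L2_norm (\<lambda>x. g x - f x)"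
  by (simp add: L2_norm_def power2_commute)

lemma L2_norm_diff_triangle:
  assumes "f \<in> L2_torus" "g \<in> L2_torus"
  shows "\<bar>L2_norm f - L2_norm g\<bar> \<le> L2_norm (\<lambda>x. f x - g x)"
  using L2_norm_triangle[OF L2_torus_diff[OF assms] assms(2)]
    L2_norm_triangle[OF L2_torus_diff[OF assms(2,1)] assms(1)]
    L2_norm_diff_commute[of f g] by simp

lemma tendsto_ip:
  assumes fn: "\<And>n. fn n \<in> L2_torus" and f: "f \<in> L2_torus"
    and gn: "\<And>n. gn n \<in> L2_torus" and g: "g \<in> L2_torus"
    and cf: "((\<lambda>n. L2_norm (\<lambda>x. fn n x - f x)) \<longlongrightarrow> 0) F"
    and cg: "((\<lambda>n. L2_norm (\<lambda>x. gn n x - g x)) \<longlongrightarrow> 0) F"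
  shows "((\<lambda>n. ip (fn n) (gn n)) \<longlongrightarrow> ip f g) F"
proof -
  have "((\<lambda>n. L2_norm (\<lambda>x. fn n x - f x) * L2_norm (\<lambda>x. gn n x - g x)
      + L2_norm (\<lambda>x. fn n x - f x) * L2_norm g + L2_norm f * L2_norm (\<lambda>x. gn n x - g x))
      \<longlongrightarrow> 0 * 0 + 0 * L2_norm g + L2_norm f * 0) F"
    by (intro tendsto_intros cf cg)
  then have lim: "((\<lambda>n. L2_norm (\<lambda>x. fn n x - f x) * L2_norm (\<lambda>x. gn n x - g x)
      + L2_norm (\<lambda>x. fn n x - f x) * L2_norm g + L2_norm f * L2_norm (\<lambda>x. gn n x - g x))
      \<longlongrightarrow> 0) F" by simp
  have "((\<lambda>n. ip (fn n) (gn n) - ip f g) \<longlongrightarrow> 0) F"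
  proof (rule Lim_null_comparison[OF always_eventually lim], intro allI)
    fix n
    have d: "(\<lambda>x. fn n x - f x) \<in> L2_torus" "(\<lambda>x. gn n x - g x) \<in> L2_torus"
      using fn f gn g by (auto intro: L2_torus_diff)
    have "ip (fn n) (gn n) - ip f g = ip (\<lambda>x. fn n x - f x) (\<lambda>x. gn n x - g x)
        + ip (\<lambda>x. fn n x - f x) g + ip f (\<lambda>x. gn n x - g x)"
      using fn[of n] f gn[of n] g d by (simp add: ip_diff_left ip_diff_right)
    then show "norm (ip (fn n) (gn n) - ip f g) \<le> L2_norm (\<lambda>x. fn n x - f x) * L2_norm (\<lambda>x. gn n x - g x)
      + L2_norm (\<lambda>x. fn n x - f x) * L2_norm g + L2_norm f * L2_norm (\<lambda>x. gn n x - g x)"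
      using Cauchy_Schwarz_L2[OF d] Cauchy_Schwarz_L2[OF d(1) g] Cauchy_Schwarz_L2[OF f d(2)] by simp
  qed
  then show ?thesis by (simp add: LIM_zero_iff)
qed

section \<open>Integration by parts on the period cell\<close>

lemma integral_lborel_shift:
  fixes f :: "'a::euclidean_space \<Rightarrow> real"
  assumes "f \<in> borel_measurable borel"
  shows "(LINT x|lborel. f (x + c)) = (LINT x|lborel. f x)"
proof -
  have "(LINT x|lborel. f x) = (LINT x|distr lborel borel ((+) c). f x)"
    by (simp add: lborel_distr_plus)
  also have "\<dots> = (LINT x|lborel. f (c + x))"
    using assms by (subst integral_distr) auto
  finally show ?thesis by (simp add: add.commute)
qed

text \<open>The period cell with its side in direction \<open>i\<close> replaced by \<open>A\<close>: the shape of the pieces into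
  which a cell shifted in direction \<open>i\<close> is cut.\<close>

definition slab :: "'n \<Rightarrow> real set \<Rightarrow> (real ^ 'n) set" where
  "slab i A = {x. (\<forall>j. j \<noteq> i \<longrightarrow> 0 \<le> x $ j \<and> x $ j \<le> 2 * pi) \<and> x $ i \<in> A}"

lemma borel_slab:
  assumes [measurable]: "A \<in> sets borel"
  shows "slab i A \<in> sets borel"
proof -
  have [measurable]: "(\<lambda>x::real^'n. x $ j) \<in> borel_measurable borel" for j
    by (intro borel_measurable_continuous_onI continuous_intros)
  show ?thesis unfolding slab_def by measurable
qed

text \<open>The cell shifted by \<open>h\<close> in one coordinate sticks out on one side by as much as it uncovers on
  the other; periodicity moves this piece back.\<close>

lemma integral_torus_shift:
  fixes g :: "real ^ 'n \<Rightarrow> real"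
  assumes cont: "continuous_on UNIV g" and per: "periodic g" and h: "0 \<le> h" "h \<le> 2 * pi"
  shows "(LINT x|torus. g (x + axis i h)) = (LINT x|torus. g x)"
proof -
  have g[measurable]: "g \<in> borel_measurable borel" by (rule borel_measurable_continuous_onI[OF cont])
  have gs[measurable]: "(\<lambda>x. g (x + c)) \<in> borel_measurable borel" for c by measurable
  note borel_slab[measurable]
  have int: "integrable lborel (\<lambda>x. indicator (slab i A) x * g x)"
    if A: "A \<subseteq> {0..4*pi}" and [measurable]: "A \<in> sets borel" for A
  proof -
    let ?K = "cbox 0 (\<chi> i. 4 * pi) :: (real^'n) set"
    have "integrable lborel (\<lambda>x. indicator ?K x *\<^sub>R g x)"
      by (rule borel_integrable_compact[OF compact_cbox continuous_on_subset[OF cont]]) simp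
    then have "integrable lborel (\<lambda>x. indicator (slab i A) x *\<^sub>R (indicator ?K x *\<^sub>R g x))"
      by (intro integrable_mult_indicator[of _ lborel "\<lambda>x. indicator ?K x *\<^sub>R g x"]) auto
    moreover have "indicator (slab i A) x *\<^sub>R (indicator ?K x *\<^sub>R g x)
        = indicator (slab i A) x * g x" for x
    proof (cases "x \<in> slab i A")
      case True
      have "0 \<le> x $ j \<and> x $ j \<le> 4 * pi" for j
      proof (cases "j = i")
        case True with \<open>x \<in> slab i A\<close> A show ?thesis by (auto simp: slab_def)
      next
        case False
        then have "0 \<le> x $ j \<and> x $ j \<le> 2 * pi" using \<open>x \<in> slab i A\<close> by (auto simp: slab_def)
        then show ?thesis using pi_gt_zero by linarith
      qed
      then have "x \<in> ?K" by (simp add: mem_box_cart)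
      then show ?thesis by simp
    qed simp
    ultimately show ?thesis by (simp only:)
  qed
  have neg: "{x::real^'n. x $ i = 0} \<in> null_sets lborel"
  proof -
    have [measurable]: "(\<lambda>x::real^'n. x $ i) \<in> borel_measurable borel"
      by (intro borel_measurable_continuous_onI continuous_intros)
    have "negligible {x::real^'n. x $ i = 0}" by (rule negligible_standard_hyperplane_cart)
    then have "emeasure lebesgue {x::real^'n. x $ i = 0} = 0"
      by (simp add: negligible_iff_null_sets null_setsD1)
    moreover have "{x::real^'n. x $ i = 0} \<in> sets lborel" by simp
    ultimately show ?thesis by (auto simp: null_sets_def)
  qed
  \<comment> \<open>Without one of its two faces in direction \<open>i\<close> the cell can be cut and moved exactly.\<close>
  have cell: "(LINT x|torus. f x) = (LINT x|lborel. indicator (slab i {0<..2*pi}) x * f x)"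
    if [measurable]: "f \<in> borel_measurable borel" for f :: "real^'n \<Rightarrow> real"
  proof -
    have "(LINT x|torus. f x) = (LINT x|lborel. indicator (cbox 0 (\<chi> i. 2 * pi)) x * f x)"
      by (rule integral_torus_lborel[OF that])
    also have "\<dots> = (LINT x|lborel. indicator (slab i {0<..2*pi}) x * f x)"
    proof (rule integral_cong_AE)
      show "AE x in lborel. indicator (cbox 0 (\<chi> i. 2 * pi)) x * f x
          = indicator (slab i {0<..2*pi}) x * f x"
        using AE_not_in[OF neg]
      proof eventually_elim
        case (elim x)
        have "x \<in> cbox 0 (\<chi> i. 2 * pi) \<longleftrightarrow> x \<in> slab i {0<..2*pi}"
          using elim by (auto simp: mem_box_cart slab_def order.strict_iff_order)
        then show ?case by (simp add: indicator_def)
      qed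
    qed simp_all
    finally show ?thesis .
  qed
  have shift: "indicat_real (slab i A) x = indicator (slab i ((+) c ` A)) (x + axis i c)" for A c x
    by (auto simp: slab_def indicator_def axis_def image_iff)
  have "(LINT x|torus. g (x + axis i h))
      = (LINT x|lborel. indicator (slab i {0<..2*pi}) x * g (x + axis i h))"
    by (rule cell) simp
  also have "\<dots> = (LINT x|lborel. indicator (slab i {h<..2*pi+h}) (x + axis i h) * g (x + axis i h))"
    by (subst shift[of _ _ h]) (simp add: add.commute[of _ h] del: image_add_greaterThanAtMost add: image_add_greaterThanAtMost[of h])
  also have "\<dots> = (LINT x|lborel. indicator (slab i {h<..2*pi+h}) x * g x)"
    by (rule integral_lborel_shift[of "\<lambda>x. indicator (slab i {h<..2*pi+h}) x * g x"]) simp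
  also have "\<dots> = (LINT x|lborel. indicator (slab i {h<..2*pi}) x * g x
       + indicator (slab i {2*pi<..2*pi+h}) x * g x)"
    using h by (intro Bochner_Integration.integral_cong) (auto simp: slab_def indicator_def)
  also have "\<dots> = (LINT x|lborel. indicator (slab i {h<..2*pi}) x * g x)
       + (LINT x|lborel. indicator (slab i {2*pi<..2*pi+h}) x * g x)"
    using h by (intro Bochner_Integration.integral_add int) auto
  also have "(LINT x|lborel. indicator (slab i {2*pi<..2*pi+h}) x * g x)
     = (LINT x|lborel. indicator (slab i {2*pi<..2*pi+h}) (x + axis i (2*pi)) * g (x + axis i (2*pi)))"
    by (rule integral_lborel_shift[symmetric]) simp
  also have "\<dots> = (LINT x|lborel. indicator (slab i {0<..h}) x * g x)"
    using shift[of "{0<..h}" _ "2*pi"] per by (simp add: periodic_def)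
  also have "(LINT x|lborel. indicator (slab i {h<..2*pi}) x * g x)
       + (LINT x|lborel. indicator (slab i {0<..h}) x * g x)
     = (LINT x|lborel. indicator (slab i {h<..2*pi}) x * g x + indicator (slab i {0<..h}) x * g x)"
    using h by (intro Bochner_Integration.integral_add[symmetric] int) auto
  also have "\<dots> = (LINT x|lborel. indicator (slab i {0<..2*pi}) x * g x)"
    using h by (intro Bochner_Integration.integral_cong) (auto simp: slab_def indicator_def)
  also have "\<dots> = (LINT x|torus. g x)" by (rule cell[symmetric]) simp
  finally show ?thesis .
qed

lemma partial_deriv_eq: "(f has_derivative D) (at x) \<Longrightarrow> partial_deriv i f x = D (axis i 1)"
  unfolding partial_deriv_def using frechet_derivative_at by metis

lemma partial_deriv_mult:
  assumes "f differentiable (at x)" "g differentiable (at x)"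
  shows "partial_deriv i (\<lambda>x. f x * g x) x = partial_deriv i f x * g x + f x * partial_deriv i g x"
proof -
  have "((\<lambda>x. f x * g x) has_derivative
      (\<lambda>h. f x * frechet_derivative g (at x) h + frechet_derivative f (at x) h * g x)) (at x)"
    using assms by (intro has_derivative_mult) (simp_all add: frechet_derivative_works)
  from partial_deriv_eq[OF this] show ?thesis by (simp add: partial_deriv_def)
qed

lemma partial_deriv_line:
  fixes f :: "real ^ 'n \<Rightarrow> real"
  assumes "\<And>x. f differentiable (at x)"
  shows "((\<lambda>h. f (x + axis i h)) has_field_derivative partial_deriv i f (x + axis i h)) (at h)"
proof -
  define e :: "real ^ 'n" where "e = axis i 1"
  have ax: "axis i h = h *\<^sub>R e" for h
    by (auto simp: e_def axis_def vec_eq_iff)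
  have lin: "linear (frechet_derivative f (at (x + axis i h)))"
    using assms by (meson has_derivative_linear frechet_derivative_works)
  have "((\<lambda>h. f (x + h *\<^sub>R e)) has_derivative
      (\<lambda>t. frechet_derivative f (at (x + h *\<^sub>R e)) (t *\<^sub>R e))) (at h)"
  proof (rule has_derivative_compose[where f="\<lambda>h. x + h *\<^sub>R e"])
    show "((\<lambda>h. x + h *\<^sub>R e) has_derivative (\<lambda>t. t *\<^sub>R e)) (at h)"
      by (auto intro!: derivative_eq_intros)
    show "(f has_derivative frechet_derivative f (at (x + h *\<^sub>R e))) (at (x + h *\<^sub>R e))"
      using assms frechet_derivative_works by blast
  qed
  moreover have "(\<lambda>t. frechet_derivative f (at (x + h *\<^sub>R e)) (t *\<^sub>R e))
      = (*) (partial_deriv i f (x + h *\<^sub>R e))"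
    using lin unfolding partial_deriv_def e_def[symmetric] ax[of h]
    by (auto simp: linear_cmul mult.commute fun_eq_iff)
  ultimately show ?thesis unfolding has_field_derivative_def by (simp only: ax)
qed

text \<open>The integral of the shifted function does not depend on the shift; the derivative of this
  constant is the integral of the partial derivative.\<close>

lemma integral_partial_deriv_zero:
  fixes f :: "real ^ 'n \<Rightarrow> real"
  assumes diff: "\<And>x. f differentiable (at x)" and per: "periodic f"
    and cont: "continuous_on UNIV (partial_deriv i f)"
  shows "(LINT x|torus. partial_deriv i f x) = 0"
proof -
  have contf: "continuous_on UNIV f"
    using diff by (simp add: continuous_at_imp_continuous_on differentiable_imp_continuous_within)
  have [measurable]: "f \<in> borel_measurable borel" "partial_deriv i f \<in> borel_measurable borel"
    using contf cont by (auto intro: borel_measurable_continuous_onI)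
  have bm: "F \<in> borel_measurable torus" if "F \<in> borel_measurable borel" for F :: "real^'n \<Rightarrow> real"
    using that by (intro measurable_torus measurable_completion) simp
  \<comment> \<open>Shifts of the cell by at most 1 stay in this box.\<close>
  let ?K = "cbox 0 (\<chi> i. 2 * pi + 1) :: (real^'n) set"
  have "bounded (partial_deriv i f ` ?K)"
    by (intro compact_imp_bounded compact_continuous_image continuous_on_subset[OF cont]) auto
  then obtain B where B: "\<And>x. x \<in> ?K \<Longrightarrow> \<bar>partial_deriv i f x\<bar> \<le> B"
    unfolding bounded_iff by auto
  define h where "h n = 1 / real (Suc n)" for n
  have h: "0 < h n" "h n \<le> 1" "h n \<le> 2 * pi" for n
  proof -
    show "0 < h n" by (simp add: h_def)
    show "h n \<le> 1" by (simp add: h_def divide_simps)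
    then show "h n \<le> 2 * pi" using pi_ge_two by linarith
  qed
  have h0: "h \<longlonglongrightarrow> 0" unfolding h_def using LIMSEQ_inverse_real_of_nat by (simp add: inverse_eq_divide)
  define q where "q n x = (f (x + axis i (h n)) - f x) / h n" for n x
  interpret finite_measure "torus :: (real^'n) measure" by (rule finite_measure_torus)
  have intq: "(LINT x|torus. q n x) = 0" for n
  proof -
    have int: "integrable torus F" if "continuous_on UNIV F" for F :: "real^'n \<Rightarrow> real"
      unfolding torus_def by (rule continuous_imp_integrable[OF continuous_on_subset[OF that]]) simp
    have "integrable torus f" by (rule int[OF contf])
    moreover have "integrable torus (\<lambda>x. f (x + axis i (h n)))"
      by (intro int continuous_on_compose2[OF contf]) (auto intro!: continuous_intros)
    ultimately show ?thesis
      using integral_torus_shift[OF contf per, of "h n" i] h[of n]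
      by (simp add: q_def)
  qed
  have "(\<lambda>n. LINT x|torus. q n x) \<longlonglongrightarrow> (LINT x|torus. partial_deriv i f x)"
  proof (rule integral_dominated_convergence[where w="\<lambda>_. B"])
    show "partial_deriv i f \<in> borel_measurable torus" by (rule bm) simp
    show "q n \<in> borel_measurable torus" for n unfolding q_def by (rule bm) simp
    show "integrable torus (\<lambda>_::real^'n. B)" by simp
    show "AE x in torus. (\<lambda>n. q n x) \<longlonglongrightarrow> partial_deriv i f x"
    proof (intro AE_I2)
      fix x
      have "((\<lambda>s. (f (x + axis i (0 + s)) - f (x + axis i 0)) / s) \<longlongrightarrow> partial_deriv i f (x + axis i 0)) (at 0)"
        using partial_deriv_line[OF diff, where h=0] by (simp add: DERIV_def)
      moreover have "axis i (0::real) = 0" by (simp add: axis_def vec_eq_iff)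
      ultimately have "((\<lambda>s. (f (x + axis i s) - f x) / s) \<longlongrightarrow> partial_deriv i f x) (at 0)" by simp
      moreover have "filterlim h (at 0) sequentially"
        unfolding filterlim_at using h0 h(1) by (auto intro!: always_eventually simp: less_imp_neq[symmetric])
      ultimately show "(\<lambda>n. q n x) \<longlonglongrightarrow> partial_deriv i f x"
        unfolding q_def by (rule filterlim_compose)
    qed
    show "AE x in torus. norm (q n x) \<le> B" for n
    proof (rule AE_I2)
      fix x :: "real^'n" assume x: "x \<in> space torus"
      have "\<exists>z. 0 < z \<and> z < h n \<and> f (x + axis i (h n)) - f (x + axis i 0) = (h n - 0) * partial_deriv i f (x + axis i z)"
        using h by (intro MVT2 partial_deriv_line diff)
      then obtain z where z: "0 < z" "z < h n"
        "f (x + axis i (h n)) - f (x + axis i 0) = h n * partial_deriv i f (x + axis i z)" by auto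
      have "axis i (0::real) = (0 :: real^'n)" by (simp add: axis_def vec_eq_iff)
      with z h[of n] have "q n x = partial_deriv i f (x + axis i z)" by (simp add: q_def)
      moreover have "x + axis i z \<in> ?K"
      proof -
        have "0 \<le> x $ j \<and> x $ j \<le> 2 * pi" for j using x by (simp add: space_torus mem_box_cart)
        moreover have "0 \<le> axis i z $ j \<and> axis i z $ j \<le> 1" for j
          using z h(2)[of n] by (simp add: axis_def)
        ultimately show ?thesis by (auto simp: mem_box_cart intro: add_nonneg_nonneg add_mono)
      qed
      ultimately show "norm (q n x) \<le> B" using B by simp
    qed
  qed
  moreover have "(\<lambda>n. LINT x|torus. q n x) = (\<lambda>n. 0)" by (simp add: intq)
  ultimately show ?thesis by (simp add: LIMSEQ_const_iff)
qed

section \<open>Trigonometric polynomials\<close>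

text \<open>Real vectors with integer coordinates, so that the inner product with a point is that of the
  ambient space.\<close>

definition freqs :: "(real ^ 'n) set" where
  "freqs = {k. \<forall>i. k $ i \<in> \<int>}"

definition cos_wave :: "real ^ 'n \<Rightarrow> real ^ 'n \<Rightarrow> real" where
  "cos_wave k x = cos (k \<bullet> x)"

definition sin_wave :: "real ^ 'n \<Rightarrow> real ^ 'n \<Rightarrow> real" where
  "sin_wave k x = sin (k \<bullet> x)"

lemma freqs_intros:
  "0 \<in> freqs" "k \<in> freqs \<Longrightarrow> l \<in> freqs \<Longrightarrow> k + l \<in> freqs"
  "k \<in> freqs \<Longrightarrow> l \<in> freqs \<Longrightarrow> k - l \<in> freqs" "k \<in> freqs \<Longrightarrow> - k \<in> freqs"
  "axis i 1 \<in> freqs"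
  by (auto simp: freqs_def axis_def)

text \<open>Generated as a linear span, so that whatever is linear needs to be known for the waves only; that
  products stay in the span follows from the addition formulas.\<close>

inductive trig_poly :: "(real ^ 'n \<Rightarrow> real) \<Rightarrow> bool" where
  cos: "k \<in> freqs \<Longrightarrow> trig_poly (cos_wave k)"
| sin: "k \<in> freqs \<Longrightarrow> trig_poly (sin_wave k)"
| add: "trig_poly f \<Longrightarrow> trig_poly g \<Longrightarrow> trig_poly (\<lambda>x. f x + g x)"
| scale: "trig_poly f \<Longrightarrow> trig_poly (\<lambda>x. c * f x)"

lemma trig_poly_const: "trig_poly (\<lambda>x. c)"
proof -
  have "trig_poly (\<lambda>x. c * cos_wave 0 x)" by (intro trig_poly.intros freqs_intros)
  then show ?thesis by (simp add: cos_wave_def)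
qed

lemma trig_poly_sum:
  assumes "\<And>k. k \<in> K \<Longrightarrow> trig_poly (f k)"
  shows "trig_poly (\<lambda>x. \<Sum>k\<in>K. f k x)"
  using assms
  by (induction K rule: infinite_finite_induct) (auto intro: trig_poly_const trig_poly.add)

lemma trig_poly_mult_wave:
  assumes "trig_poly g" "k \<in> freqs"
  shows "trig_poly (\<lambda>x. cos_wave k x * g x) \<and> trig_poly (\<lambda>x. sin_wave k x * g x)"
  using assms(1)
proof induction
  case (cos l)
  have eq: "(\<lambda>x. cos_wave k x * cos_wave l x)
        = (\<lambda>x. (1/2) * cos_wave (k - l) x + (1/2) * cos_wave (k + l) x)"
    "(\<lambda>x. sin_wave k x * cos_wave l x)
        = (\<lambda>x. (1/2) * sin_wave (k + l) x + (1/2) * sin_wave (k - l) x)"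
    by (auto simp: cos_wave_def sin_wave_def inner_add_left inner_diff_left cos_add
        cos_diff sin_add sin_diff field_simps)
  show ?case unfolding eq using assms(2) cos by (intro conjI trig_poly.intros freqs_intros)
next
  case (sin l)
  have eq: "(\<lambda>x. cos_wave k x * sin_wave l x)
        = (\<lambda>x. (1/2) * sin_wave (k + l) x + (-1/2) * sin_wave (k - l) x)"
    "(\<lambda>x. sin_wave k x * sin_wave l x)
        = (\<lambda>x. (1/2) * cos_wave (k - l) x + (-1/2) * cos_wave (k + l) x)"
    by (auto simp: cos_wave_def sin_wave_def inner_add_left inner_diff_left cos_add
        cos_diff sin_add sin_diff field_simps)
  show ?case unfolding eq using assms(2) sin by (intro conjI trig_poly.intros freqs_intros)
next
  case (add f g)
  then show ?case by (auto simp: ring_distribs intro: trig_poly.add)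
next
  case (scale f c)
  then have "trig_poly (\<lambda>x. c * (cos_wave k x * f x))" "trig_poly (\<lambda>x. c * (sin_wave k x * f x))"
    by (auto intro: trig_poly.scale)
  then show ?case by (simp add: mult.left_commute)
qed

lemma trig_poly_mult:
  assumes "trig_poly f" "trig_poly g"
  shows "trig_poly (\<lambda>x. f x * g x)"
  using assms(1)
proof induction
  case (scale f c)
  then have "trig_poly (\<lambda>x. c * (f x * g x))" by (auto intro: trig_poly.scale)
  then show ?case by (simp add: mult.assoc)
qed (use assms(2) in \<open>auto simp: ring_distribs trig_poly_mult_wave intro: trig_poly.add\<close>)

lemma trig_poly_prod:
  assumes "\<And>k. k \<in> K \<Longrightarrow> trig_poly (f k)"
  shows "trig_poly (\<lambda>x. \<Prod>k\<in>K. f k x)"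
  using assms
  by (induction K rule: infinite_finite_induct) (auto intro: trig_poly_const trig_poly_mult)

lemma trig_poly_polynomial:
  assumes "real_polynomial_function q" "trig_poly f"
  shows "trig_poly (\<lambda>x. q (f x))"
  using assms(1)
proof induction
  case (linear q)
  then obtain c where "q = (\<lambda>x. x * c)" by (auto simp: real_bounded_linear)
  then show ?case using trig_poly.scale[OF assms(2), of c] by (simp add: mult.commute)
qed (auto intro: trig_poly_const trig_poly.add trig_poly_mult)

lemma wave_shift:
  assumes "k \<in> freqs"
  shows "cos (k \<bullet> (x + axis i (2 * pi))) = cos (k \<bullet> x)"
    "sin (k \<bullet> (x + axis i (2 * pi))) = sin (k \<bullet> x)"
proof -
  obtain m :: int where m: "k $ i = of_int m" using assms by (auto simp: freqs_def elim: Ints_cases)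
  have eq: "k \<bullet> (x + axis i (2 * pi)) = k \<bullet> x + 2 * pi * of_int m"
    by (simp add: inner_add_right inner_axis m mult.commute)
  show "cos (k \<bullet> (x + axis i (2 * pi))) = cos (k \<bullet> x)"
    "sin (k \<bullet> (x + axis i (2 * pi))) = sin (k \<bullet> x)"
    unfolding eq by (simp_all add: cos_add sin_add)
qed

lemma trig_poly_periodic: "trig_poly f \<Longrightarrow> periodic f"
  by (induction rule: trig_poly.induct) (auto simp: periodic_def cos_wave_def sin_wave_def wave_shift)

lemma trig_poly_bounded: "trig_poly f \<Longrightarrow> \<exists>B. \<forall>x. \<bar>f x\<bar> \<le> B"
proof (induction rule: trig_poly.induct)
  case (cos k)
  then show ?case by (auto simp: cos_wave_def intro: abs_cos_le_one)
next
  case (sin k)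
  then show ?case by (auto simp: sin_wave_def intro: abs_sin_le_one)
next
  case (add f g)
  then obtain B C where "\<forall>x. \<bar>f x\<bar> \<le> B" "\<forall>x. \<bar>g x\<bar> \<le> C" by auto
  then have "\<forall>x. \<bar>f x + g x\<bar> \<le> B + C" by (meson abs_triangle_ineq add_mono order_trans)
  then show ?case by blast
next
  case (scale f c)
  then obtain B where "\<forall>x. \<bar>f x\<bar> \<le> B" by auto
  then have "\<forall>x. \<bar>c * f x\<bar> \<le> \<bar>c\<bar> * B" by (simp add: abs_mult mult_left_mono)
  then show ?case by blast
qed

lemma has_derivative_waves:
  "(cos_wave k has_derivative (\<lambda>h. - sin_wave k x * (k \<bullet> h))) (at x)"
  "(sin_wave k has_derivative (\<lambda>h. cos_wave k x * (k \<bullet> h))) (at x)"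
  unfolding cos_wave_def[abs_def] sin_wave_def[abs_def]
  by (auto intro!: derivative_eq_intros)

lemma partial_deriv_waves:
  "partial_deriv i (cos_wave k) = (\<lambda>x. - (k $ i) * sin_wave k x)"
  "partial_deriv i (sin_wave k) = (\<lambda>x. k $ i * cos_wave k x)"
  using partial_deriv_eq[OF has_derivative_waves(1)] partial_deriv_eq[OF has_derivative_waves(2)]
  by (auto simp: inner_axis mult.commute fun_eq_iff)

lemma partial_deriv_add:
  fixes f g :: "real ^ 'n \<Rightarrow> real"
  assumes "f differentiable (at x)" "g differentiable (at x)"
  shows "partial_deriv i (\<lambda>x. f x + g x) x = partial_deriv i f x + partial_deriv i g x"
proof -
  have "((\<lambda>x. f x + g x) has_derivative
      (\<lambda>h. frechet_derivative f (at x) h + frechet_derivative g (at x) h)) (at x)"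
    using assms by (intro has_derivative_add) (simp_all add: frechet_derivative_works)
  from partial_deriv_eq[OF this] show ?thesis by (simp add: partial_deriv_def)
qed

lemma partial_deriv_scale:
  assumes "f differentiable (at x)"
  shows "partial_deriv i (\<lambda>x. c * f x) x = c * partial_deriv i f x"
proof -
  have "((\<lambda>x. c * f x) has_derivative (\<lambda>h. c * frechet_derivative f (at x) h)) (at x)"
    using assms by (intro has_derivative_mult_right) (simp_all add: frechet_derivative_works)
  from partial_deriv_eq[OF this] show ?thesis by (simp add: partial_deriv_def)
qed

lemma trig_poly_differentiable: "trig_poly f \<Longrightarrow> f differentiable (at x)"
proof (induction rule: trig_poly.induct)
  case (cos k)
  then show ?case using has_derivative_waves(1) differentiableI by blast
next
  case (sin k)
  then show ?case using has_derivative_waves(2) differentiableI by blast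
qed (auto intro: differentiable_add differentiable_mult)

lemma trig_poly_partial_deriv: "trig_poly f \<Longrightarrow> trig_poly (partial_deriv i f)"
proof (induction rule: trig_poly.induct)
  case (add f g)
  have "partial_deriv i (\<lambda>x. f x + g x) = (\<lambda>x. partial_deriv i f x + partial_deriv i g x)"
    using add by (auto intro!: partial_deriv_add trig_poly_differentiable)
  with add show ?case by (auto intro: trig_poly.add)
next
  case (scale f c)
  have "partial_deriv i (\<lambda>x. c * f x) = (\<lambda>x. c * partial_deriv i f x)"
    using scale by (auto intro!: partial_deriv_scale trig_poly_differentiable)
  with scale show ?case by (auto intro: trig_poly.scale)
qed (simp_all only: partial_deriv_waves trig_poly.scale trig_poly.intros(1,2))

lemma trig_poly_smooth: "trig_poly f \<Longrightarrow> smooth f"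
proof -
  assume f: "trig_poly f"
  have "trig_poly (foldr partial_deriv is f)" for "is"
    by (induction "is") (auto intro: f trig_poly_partial_deriv)
  then show ?thesis by (auto simp: smooth_def intro: trig_poly_differentiable)
qed

lemma smooth_differentiable: "smooth f \<Longrightarrow> f differentiable (at x)"
  unfolding smooth_def by (metis foldr_Nil id_apply)

lemma smooth_continuous: "smooth f \<Longrightarrow> continuous_on UNIV f"
  by (intro continuous_at_imp_continuous_on ballI differentiable_imp_continuous_within
      smooth_differentiable)

lemma smooth_partial_deriv: "smooth f \<Longrightarrow> smooth (partial_deriv i f)"
  unfolding smooth_def
proof (intro allI)
  fix "is" x
  assume "\<forall>is x. foldr partial_deriv is f differentiable (at x)"
  then have "foldr partial_deriv (is @ [i]) f differentiable (at x)" by blast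
  then show "foldr partial_deriv is (partial_deriv i f) differentiable (at x)" by simp
qed

lemma trig_poly_continuous: "trig_poly f \<Longrightarrow> continuous_on UNIV f"
  by (intro smooth_continuous trig_poly_smooth)

lemma continuous_measurable:
  fixes f :: "real ^ 'n \<Rightarrow> real"
  shows "continuous_on UNIV f \<Longrightarrow> f \<in> borel_measurable lebesgue"
  by (intro measurable_completion) (simp add: borel_measurable_continuous_onI)

lemma continuous_periodic_bounded_on_cell:
  fixes f :: "real ^ 'n \<Rightarrow> real"
  assumes "continuous_on UNIV f"
  shows "\<exists>B. AE x in torus. \<bar>f x\<bar> \<le> B"
proof -
  have "bounded (f ` cbox 0 (\<chi> i. 2 * pi))"
    by (intro compact_imp_bounded compact_continuous_image continuous_on_subset[OF assms]) auto
  then obtain B where "\<And>x. x \<in> cbox 0 (\<chi> i. 2 * pi) \<Longrightarrow> \<bar>f x\<bar> \<le> B"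
    unfolding bounded_iff by auto
  then have "AE x in torus. \<bar>f x\<bar> \<le> B" by (intro AE_I2) (simp add: space_torus)
  then show ?thesis by blast
qed

lemma L2_torus_trig_poly:
  assumes "trig_poly f" shows "f \<in> L2_torus"
proof -
  obtain B where "\<And>x. \<bar>f x\<bar> \<le> B" using trig_poly_bounded[OF assms] by auto
  then show ?thesis
    by (intro L2_torus_bounded trig_poly_periodic continuous_measurable trig_poly_continuous assms)
qed

lemma integrable_mult_continuous:
  fixes f g :: "real ^ 'n \<Rightarrow> real"
  assumes "integrable torus f" "continuous_on UNIV g"
  shows "integrable torus (\<lambda>x. f x * g x)"
proof -
  obtain B where "AE x in torus. \<bar>g x\<bar> \<le> B"
    using continuous_periodic_bounded_on_cell[OF assms(2)] by blast
  from integrable_torus_mult_bounded[OF assms(1) _ this] assms(2) show ?thesis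
    by (simp add: mult.commute continuous_measurable measurable_torus)
qed

lemma L1_torusD:
  assumes "f \<in> L1_torus"
  shows "periodic f" "f \<in> borel_measurable lebesgue" "f \<in> borel_measurable torus" "integrable torus f"
  using assms by (auto simp: L1_torus_def measurable_torus)

text \<open>The product rule turns the difference of the two sides into the integral of a partial derivative
  of a periodic function.\<close>

lemma integral_by_parts_torus:
  assumes "trig_poly f" "smooth \<phi>" "periodic \<phi>"
  shows "(LINT x|torus. f x * partial_deriv i \<phi> x) = - (LINT x|torus. partial_deriv i f x * \<phi> x)"
proof -
  have d: "f differentiable (at x)" "\<phi> differentiable (at x)" for x
    using assms by (auto intro: trig_poly_differentiable smooth_differentiable)
  have c: "continuous_on UNIV f" "continuous_on UNIV \<phi>" "continuous_on UNIV (partial_deriv i \<phi>)"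
     "continuous_on UNIV (partial_deriv i f)"
    using trig_poly_continuous[OF assms(1)] smooth_continuous[OF assms(2)]
      smooth_continuous[OF smooth_partial_deriv[OF assms(2)]]
      trig_poly_continuous[OF trig_poly_partial_deriv[OF assms(1)]] by simp_all
  have eq: "partial_deriv i (\<lambda>x. f x * \<phi> x) = (\<lambda>x. partial_deriv i f x * \<phi> x + f x * partial_deriv i \<phi> x)"
    using d by (auto simp: partial_deriv_mult)
  have "(LINT x|torus. partial_deriv i (\<lambda>x. f x * \<phi> x) x) = 0"
  proof (rule integral_partial_deriv_zero)
    show "continuous_on UNIV (partial_deriv i (\<lambda>x. f x * \<phi> x))"
      unfolding eq by (intro continuous_intros c)
    show "periodic (\<lambda>x. f x * \<phi> x)"
      using assms trig_poly_periodic[OF assms(1)] by (simp add: periodic_def)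
  qed (use d in \<open>auto intro: differentiable_mult\<close>)
  moreover have "integrable torus (\<lambda>x. partial_deriv i f x * \<phi> x)" "integrable torus (\<lambda>x. f x * partial_deriv i \<phi> x)"
    using L1_torusD(4)[OF L2_torus_L1[OF L2_torus_trig_poly]] assms trig_poly_partial_deriv[OF assms(1)] c
    by (auto intro!: integrable_mult_continuous)
  ultimately show ?thesis unfolding eq by simp
qed

lemma has_weak_deriv_trig_poly:
  assumes "trig_poly f" shows "has_weak_deriv i f (partial_deriv i f)"
  unfolding has_weak_deriv_def
  using assms by (auto intro!: L2_torus_L1 L2_torus_trig_poly integral_by_parts_torus trig_poly_partial_deriv)

text \<open>The volume of the period cell depends on the dimension alone, hence the type as its argument.\<close>

definition vol :: "'n::finite itself \<Rightarrow> real" where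
  "vol _ = measure lborel (cbox 0 (\<chi> i. 2 * pi) :: (real ^ 'n) set)"

lemma vol_pos: "0 < vol TYPE('n::finite)"
proof -
  have "measure lborel (cbox 0 (\<chi> i. 2 * pi) :: (real ^ 'n) set) > 0"
    unfolding content_pos_lt_eq by (auto simp: Basis_vec_def inner_axis)
  then show ?thesis by (simp add: vol_def)
qed

text \<open>A wave of frequency \<open>k \<noteq> 0\<close> is a multiple of the derivative of the conjugate wave in a direction in
  which \<open>k\<close> does not vanish.\<close>

lemma integral_waves:
  assumes "(k :: real ^ 'n) \<in> freqs"
  shows "(LINT x|torus. cos_wave k x) = (if k = 0 then vol TYPE('n) else 0)"
    "(LINT x|torus. sin_wave k x) = 0"
proof -
  have "(LINT x|torus. cos_wave k x) = vol TYPE('n) \<and> (LINT x|torus. sin_wave k x) = 0" if "k = 0"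
    using that by (simp add: cos_wave_def[abs_def] sin_wave_def[abs_def] vol_def torus_def
        measure_restrict_space space_restrict_space)
  moreover have "(LINT x|torus. cos_wave k x) = 0 \<and> (LINT x|torus. sin_wave k x) = 0" if k: "k \<noteq> 0"
  proof -
    obtain i where i: "k $ i \<noteq> 0" using k by (auto simp: vec_eq_iff)
    have "(LINT x|torus. partial_deriv i f x) = 0" if "trig_poly f" for f
      using that by (intro integral_partial_deriv_zero trig_poly_differentiable trig_poly_periodic
          trig_poly_continuous trig_poly_partial_deriv)
    from this[OF trig_poly.cos[OF assms]] this[OF trig_poly.sin[OF assms]] i
    show ?thesis by (simp add: partial_deriv_waves)
  qed
  ultimately show "(LINT x|torus. cos_wave k x) = (if k = 0 then vol TYPE('n) else 0)"
    "(LINT x|torus. sin_wave k x) = 0" by auto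
qed

lemma ip_waves:
  assumes "(k :: real ^ 'n) \<in> freqs" "l \<in> freqs"
  shows "ip (cos_wave k) (cos_wave l) = vol TYPE('n) / 2 * (of_bool (k = l) + of_bool (k = - l))"
    "ip (sin_wave k) (sin_wave l) = vol TYPE('n) / 2 * (of_bool (k = l) - of_bool (k = - l))"
    "ip (sin_wave k) (cos_wave l) = 0"
    "ip (cos_wave k) (sin_wave l) = 0"
proof -
  have int: "integrable torus (cos_wave m)" "integrable torus (sin_wave m)" if "m \<in> freqs" for m :: "real^'n"
    using that by (auto intro!: L1_torusD(4) L2_torus_L1 L2_torus_trig_poly trig_poly.intros)
  have f: "k - l \<in> freqs" "k + l \<in> freqs" using assms by (auto intro: freqs_intros)
  have z: "k - l = 0 \<longleftrightarrow> k = l" "k + l = 0 \<longleftrightarrow> k = - l" by (auto simp: eq_neg_iff_add_eq_0)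
  have eq: "(\<lambda>x. cos_wave k x * cos_wave l x) = (\<lambda>x. (1/2) * (cos_wave (k - l) x + cos_wave (k + l) x))"
    "(\<lambda>x. sin_wave k x * sin_wave l x) = (\<lambda>x. (1/2) * (cos_wave (k - l) x - cos_wave (k + l) x))"
    "(\<lambda>x. sin_wave k x * cos_wave l x) = (\<lambda>x. (1/2) * (sin_wave (k + l) x + sin_wave (k - l) x))"
    "(\<lambda>x. cos_wave k x * sin_wave l x) = (\<lambda>x. (1/2) * (sin_wave (k + l) x - sin_wave (k - l) x))"
    by (auto simp: cos_wave_def sin_wave_def inner_add_left inner_diff_left cos_add
        cos_diff sin_add sin_diff field_simps)
  have w: "(LINT x|torus. cos_wave (k - l) x) = vol TYPE('n) * of_bool (k = l)"
    "(LINT x|torus. cos_wave (k + l) x) = vol TYPE('n) * of_bool (k = - l)"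
    "(LINT x|torus. sin_wave (k - l) x) = 0" "(LINT x|torus. sin_wave (k + l) x) = 0"
    using integral_waves[OF f(1)] integral_waves[OF f(2)] z by simp_all
  have i: "integrable torus (cos_wave (k - l))" "integrable torus (cos_wave (k + l))"
    "integrable torus (sin_wave (k - l))" "integrable torus (sin_wave (k + l))"
    using f int by blast+
  show "ip (cos_wave k) (cos_wave l) = vol TYPE('n) / 2 * (of_bool (k = l) + of_bool (k = - l))"
    "ip (sin_wave k) (sin_wave l) = vol TYPE('n) / 2 * (of_bool (k = l) - of_bool (k = - l))"
    "ip (sin_wave k) (cos_wave l) = 0"
    "ip (cos_wave k) (sin_wave l) = 0"
    unfolding ip_def eq integral_mult_right_zero
      Bochner_Integration.integral_add[OF i(1,2)] Bochner_Integration.integral_diff[OF i(1,2)]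
      Bochner_Integration.integral_add[OF i(4,3)] Bochner_Integration.integral_diff[OF i(4,3)] w
    by (simp_all add: field_simps)
qed

section \<open>Completeness of the trigonometric system\<close>

text \<open>The step function is the pointwise limit of the continuous ramps \<open>max 0 (min 1 (m * s))\<close>, and these
  are approximated uniformly by the theorem of Weierstrass.\<close>

lemma polynomial_step_approx:
  obtains p :: "nat \<Rightarrow> real \<Rightarrow> real" where
    "\<And>m. real_polynomial_function (p m)"
    "\<And>m s. \<bar>s\<bar> \<le> 2 \<Longrightarrow> \<bar>p m s\<bar> \<le> 2"
    "\<And>s. \<bar>s\<bar> \<le> 2 \<Longrightarrow> (\<lambda>m. p m s) \<longlonglongrightarrow> (if s > 0 then 1 else 0)"
proof -
  define r :: "nat \<Rightarrow> real \<Rightarrow> real" where "r m s = max 0 (min 1 (real m * s))" for m s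
  have "\<exists>g. real_polynomial_function g \<and> (\<forall>s\<in>{-2..2}. \<bar>r m s - g s\<bar> < 1 / real (Suc m))" for m
  proof -
    have "continuous_on {-2..2} (r m)" unfolding r_def by (intro continuous_intros)
    from Stone_Weierstrass_real_polynomial_function[OF _ this, of "1 / real (Suc m)"]
    obtain g where "real_polynomial_function g" "\<And>x. x \<in> {-2..2} \<Longrightarrow> \<bar>r m x - g x\<bar> < 1 / real (Suc m)"
      by auto
    then show ?thesis by blast
  qed
  then obtain p where "\<forall>m. real_polynomial_function (p m) \<and> (\<forall>s\<in>{-2..2}. \<bar>r m s - p m s\<bar> < 1 / real (Suc m))"
    by metis
  then have p: "\<And>m. real_polynomial_function (p m)"
    "\<And>m s. \<bar>s\<bar> \<le> 2 \<Longrightarrow> \<bar>r m s - p m s\<bar> < 1 / real (Suc m)"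
    by (auto simp: abs_le_iff)
  show ?thesis
  proof
    show "real_polynomial_function (p m)" for m by (rule p)
    show "\<bar>p m s\<bar> \<le> 2" if "\<bar>s\<bar> \<le> 2" for m s
    proof -
      have "1 / real (Suc m) \<le> 1" by simp
      moreover have "0 \<le> r m s" "r m s \<le> 1" by (auto simp: r_def)
      ultimately show ?thesis using p(2)[OF that, of m] by linarith
    qed
    show "(\<lambda>m. p m s) \<longlonglongrightarrow> (if s > 0 then 1 else 0)" if s: "\<bar>s\<bar> \<le> 2" for s
    proof -
      have "eventually (\<lambda>m. r m s = (if s > 0 then 1 else 0)) sequentially"
      proof (cases "s > 0")
        case True
        obtain N where N: "1 / s < real N" using reals_Archimedean2 by blast
        have "r m s = 1" if "m \<ge> N" for m
        proof -
          have "1 / s < real m" using N that by linarith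
          then have "1 < real m * s" using True by (simp add: field_simps)
          then show ?thesis by (simp add: r_def)
        qed
        then show ?thesis using True by (auto simp: eventually_sequentially)
      next
        case False
        then have "real m * s \<le> 0" for m by (simp add: mult_nonneg_nonpos)
        then have "r m s = 0" for m unfolding r_def by (simp add: max_absorb1 min_le_iff_disj)
        then show ?thesis using False by simp
      qed
      then have r: "(\<lambda>m. r m s) \<longlonglongrightarrow> (if s > 0 then 1 else 0)" by (rule tendsto_eventually)
      have "(\<lambda>m. r m s - p m s) \<longlonglongrightarrow> 0"
      proof (rule Lim_null_comparison[OF always_eventually])
        show "\<forall>m. norm (r m s - p m s) \<le> 1 / real (Suc m)" using p(2)[OF s] by (auto intro: less_imp_le)
        show "(\<lambda>m. 1 / real (Suc m)) \<longlonglongrightarrow> 0"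
          using LIMSEQ_inverse_real_of_nat by (simp add: inverse_eq_divide)
      qed
      from tendsto_diff[OF r this] show ?thesis by simp
    qed
  qed
qed

text \<open>The cosine of the distance to the midpoint of an arc exceeds its value at the end points exactly
  inside the arc. The distance may exceed \<open>pi\<close>, where the cosine increases again, but only up to its
  value at the end points.\<close>

lemma arc_indicator:
  assumes ab: "0 \<le> a" "a < b" "b \<le> 2 * pi" and x: "0 \<le> x" "x \<le> 2 * pi"
  shows "cos (x - (a + b) / 2) - cos ((b - a) / 2) > 0 \<longleftrightarrow> a < x \<and> x < b"
proof -
  define d h where "d = \<bar>x - (a + b) / 2\<bar>" and "h = (b - a) / 2"
  have h: "0 < h" "h \<le> pi" using ab by (auto simp: h_def)
  have d: "0 \<le> d" "d \<le> 2 * pi - h" using ab x by (auto simp: h_def d_def abs_le_iff field_simps)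
  have cd: "cos (x - (a + b) / 2) = cos d" by (simp add: d_def cos_abs_real)
  have "cos h < cos d \<longleftrightarrow> d < h"
  proof (cases "d \<le> pi")
    case True
    then show ?thesis using h d by (intro cos_mono_less_eq) auto
  next
    case False
    have "cos d = cos (2 * pi - d)" by (simp add: cos_diff)
    also have "\<dots> \<le> cos h" using False h d by (intro cos_monotone_0_pi_le) auto
    finally show ?thesis using False h by auto
  qed
  also have "d < h \<longleftrightarrow> a < x \<and> x < b" by (auto simp: d_def h_def abs_less_iff field_simps)
  finally show ?thesis by (simp add: cd h_def)
qed

lemma trig_poly_coordinate_arc: "trig_poly (\<lambda>x::real^'n. cos (x $ i - m) - c)"
proof -
  have eq: "(\<lambda>x::real^'n. cos (x $ i - m) - c)
      = (\<lambda>x. (cos m * cos_wave (axis i 1) x + sin m * sin_wave (axis i 1) x) + (-c))"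
    by (auto simp: cos_wave_def sin_wave_def cos_diff inner_axis' mult.commute)
  show ?thesis unfolding eq by (intro trig_poly.intros freqs_intros trig_poly_const)
qed

lemma AE_torus_box: "AE x in torus. x \<in> box 0 (\<chi> i. 2 * pi)"
proof -
  let ?N = "cbox 0 (\<chi> i. 2 * pi) - box 0 (\<chi> i. 2 * pi) :: (real ^ 'n) set"
  have "?N \<in> null_sets lebesgue" using negligible_frontier_interval negligible_iff_null_sets by blast
  then have "?N \<in> null_sets torus"
    unfolding torus_def by (subst null_sets_restrict_space) auto
  from AE_not_in[OF this] AE_space show ?thesis
    by eventually_elim (auto simp: space_torus)
qed

text \<open>Inside the cell, the box is the set where all the degree-one trigonometric polynomials
  \<open>cos (x\<^sub>i - m\<^sub>i) - cos h\<^sub>i\<close> are positive, so polynomial approximations of the step function applied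
  to them are trigonometric polynomials that converge boundedly to its indicator.\<close>

lemma integral_box_zero:
  fixes f :: "real ^ 'n \<Rightarrow> real"
  assumes f: "integrable torus f"
    and orth: "\<And>p. trig_poly p \<Longrightarrow> (LINT x|torus. f x * p x) = 0"
  shows "(LINT x|torus. indicator (box a b) x * f x) = 0"
proof -
  \<comment> \<open>The part of the box inside the cell; an empty one is treated separately.\<close>
  define a' b' where "a' i = max 0 (a $ i)" and "b' i = min (2 * pi) (b $ i)" for i
  show ?thesis
  proof (cases "\<forall>i. a' i < b' i")
    case False
    then obtain i where i: "b' i \<le> a' i" by (auto simp: not_less)
    have "AE x in torus. indicator (box a b) x * f x = 0"
      using AE_torus_box
    proof eventually_elim
      case (elim x)
      then have "0 < x $ i" "x $ i < 2 * pi" by (auto simp: mem_box_cart)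
      with i have "\<not> (a $ i < x $ i \<and> x $ i < b $ i)" by (auto simp: a'_def b'_def)
      then have "x \<notin> box a b" by (auto simp: mem_box_cart)
      then show ?case by simp
    qed
    then show ?thesis by (rule integral_eq_zero_AE)
  next
    case True
    obtain p :: "nat \<Rightarrow> real \<Rightarrow> real" where p: "\<And>m. real_polynomial_function (p m)"
      "\<And>m s. \<bar>s\<bar> \<le> 2 \<Longrightarrow> \<bar>p m s\<bar> \<le> 2"
      "\<And>s. \<bar>s\<bar> \<le> 2 \<Longrightarrow> (\<lambda>m. p m s) \<longlonglongrightarrow> (if s > 0 then 1 else 0)"
      by (rule polynomial_step_approx) (rule that)
    define s where "s i x = cos (x $ i - (a' i + b' i) / 2) - cos ((b' i - a' i) / 2)" for i and x :: "real^'n"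
    have s2: "\<bar>s i x\<bar> \<le> 2" for i x
      using abs_cos_le_one[of "x $ i - (a' i + b' i) / 2"] abs_cos_le_one[of "(b' i - a' i) / 2"]
      unfolding s_def by linarith
    define q where "q m x = (\<Prod>i\<in>UNIV. p m (s i x))" for m x
    have tq: "trig_poly (q m)" for m
      unfolding q_def s_def
      by (rule trig_poly_prod, rule trig_poly_polynomial[OF p(1) trig_poly_coordinate_arc])
    have "(\<lambda>m. LINT x|torus. f x * q m x) \<longlonglongrightarrow> (LINT x|torus. indicator (box a b) x * f x)"
    proof (rule integral_dominated_convergence[where w="\<lambda>x. 2 ^ CARD('n) * \<bar>f x\<bar>"])
      show "integrable torus (\<lambda>x. 2 ^ CARD('n) * \<bar>f x\<bar>)" using f by simp
      have fm: "f \<in> borel_measurable torus" using f by simp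
      show "(\<lambda>x. f x * q m x) \<in> borel_measurable torus" for m
        using fm measurable_torus[OF continuous_measurable[OF trig_poly_continuous[OF tq]]] by simp
      have "(indicator (box a b) :: real^'n \<Rightarrow> real) \<in> borel_measurable lebesgue"
        by (intro measurable_completion) simp
      from measurable_torus[OF this] show "(\<lambda>x. indicator (box a b) x * f x) \<in> borel_measurable torus"
        using fm by simp
      show "AE x in torus. norm (f x * q m x) \<le> 2 ^ CARD('n) * \<bar>f x\<bar>" for m
      proof (rule AE_I2)
        fix x
        have "\<bar>q m x\<bar> \<le> (\<Prod>i\<in>(UNIV::'n set). 2)"
          unfolding q_def abs_prod by (rule prod_mono) (simp add: p(2)[OF s2])
        then show "norm (f x * q m x) \<le> 2 ^ CARD('n) * \<bar>f x\<bar>"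
          by (simp add: abs_mult mult.commute[of "\<bar>f x\<bar>"] mult_right_mono)
      qed
      show "AE x in torus. (\<lambda>m. f x * q m x) \<longlonglongrightarrow> indicator (box a b) x * f x"
        using AE_torus_box
      proof eventually_elim
        case (elim x)
        then have x: "0 < x $ i" "x $ i < 2 * pi" for i by (auto simp: mem_box_cart)
        have s: "s i x > 0 \<longleftrightarrow> a $ i < x $ i \<and> x $ i < b $ i" for i
          unfolding s_def using True x[of i]
          by (subst arc_indicator) (auto simp: a'_def b'_def)
        have "(\<lambda>m. q m x) \<longlonglongrightarrow> (\<Prod>i\<in>UNIV. if s i x > 0 then 1 else 0)"
          unfolding q_def by (rule tendsto_prod, rule p(3)[OF s2])
        also have "(\<Prod>i\<in>UNIV. if s i x > 0 then 1 else 0) = indicat_real (box a b) x"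
          unfolding s by (auto simp: indicator_def mem_box_cart intro!: prod.neutral)
        finally show ?case by (simp add: mult.commute[of "f x"] tendsto_mult_right)
      qed
    qed
    then show ?thesis using orth[OF tq] by (simp add: LIMSEQ_const_iff)
  qed
qed

text \<open>Orthogonality to the waves is orthogonality to all trigonometric polynomials, hence to the
  indicators of boxes. It extends to Borel sets, because these form the smallest Dynkin system
  containing the boxes, and to Lebesgue sets, which differ from Borel sets by null sets.\<close>

lemma trig_system_complete:
  fixes f :: "real ^ 'n \<Rightarrow> real"
  assumes f: "integrable torus f"
    and "\<And>k. k \<in> freqs \<Longrightarrow> (LINT x|torus. f x * cos_wave k x) = 0"
    and "\<And>k. k \<in> freqs \<Longrightarrow> (LINT x|torus. f x * sin_wave k x) = 0"
  shows "AE x in torus. f x = 0"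
proof -
  let ?Q = "cbox 0 (\<chi> i. 2 * pi) :: (real ^ 'n) set"
  have orth: "(LINT x|torus. f x * p x) = 0" if "trig_poly p" for p
    using that
  proof induction
    case (add p q)
    then show ?case
      using integrable_mult_continuous[OF f trig_poly_continuous] by (simp add: ring_distribs)
  next
    case (scale p c)
    then show ?case by (simp add: mult.left_commute)
  qed (use assms in auto)
  have tor: "B \<inter> ?Q \<in> sets torus" if "B \<in> sets borel" for B
  proof -
    have "B \<in> sets lebesgue" using that by auto
    then show ?thesis unfolding torus_def by (auto simp: sets_restrict_space)
  qed
  have si: "set_integrable torus B f" if "B \<in> sets torus" for B
    using integrable_mult_indicator[OF that f] by (simp add: set_integrable_def)
  have eqQ: "(LINT x:B \<inter> ?Q|torus. f x) = (LINT x|torus. indicator B x * f x)" for B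
    unfolding set_lebesgue_integral_def
    by (intro Bochner_Integration.integral_cong) (auto simp: space_torus indicator_def)
  have borel: "(LINT x:B \<inter> ?Q|torus. f x) = 0" if "B \<in> sets borel" for B
  proof -
    let ?G = "range (\<lambda>(a, b). box a b :: (real ^ 'n) set)"
    have "sets borel = sigma_sets UNIV ?G" by (subst borel_eq_box) simp
    with that have B: "B \<in> sigma_sets UNIV ?G" by simp
    have "Int_stable ?G" by (auto simp: Int_stable_def box_Int_box)
    moreover have "?G \<subseteq> Pow UNIV" by simp
    ultimately show ?thesis using B
    proof (induction rule: sigma_sets_induct_disjoint)
      case (basic A)
      then show ?case unfolding eqQ using integral_box_zero[OF f orth] by auto
    next
      case (compl A)
      then have "A \<in> sets borel" using \<open>sets borel = sigma_sets UNIV ?G\<close> by auto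
      then have A: "A \<inter> ?Q \<in> sets torus" "(UNIV - A) \<inter> ?Q \<in> sets torus" by (auto intro!: tor)
      have "(LINT x:(A \<inter> ?Q) \<union> ((UNIV - A) \<inter> ?Q)|torus. f x)
          = (LINT x:A \<inter> ?Q|torus. f x) + (LINT x:(UNIV - A) \<inter> ?Q|torus. f x)"
        by (intro set_integral_Un si A) auto
      moreover have "(A \<inter> ?Q) \<union> ((UNIV - A) \<inter> ?Q) = UNIV \<inter> ?Q" by auto
      moreover have "(LINT x:UNIV \<inter> ?Q|torus. f x) = 0"
        unfolding eqQ using orth[OF trig_poly_const[of 1]] by simp
      ultimately show ?case using compl by simp
    next
      case (union A)
      then have A: "A i \<in> sets borel" for i using \<open>sets borel = sigma_sets UNIV ?G\<close> by auto
      have "(LINT x:(\<Union>i. A i \<inter> ?Q)|torus. f x) = (\<Sum>i. LINT x:A i \<inter> ?Q|torus. f x)"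
        using union(1) A
        by (intro lebesgue_integral_countable_add tor si sets.countable_UN)
          (auto simp: disjoint_family_on_def intro!: tor)
      moreover have "(\<Union>i. A i \<inter> ?Q) = (\<Union>i. A i) \<inter> ?Q" by auto
      ultimately show ?case using union by simp
    qed (simp add: set_lebesgue_integral_def)
  qed
  interpret finite_measure "torus :: (real ^ 'n) measure" by (rule finite_measure_torus)
  show ?thesis
  proof (rule density_zero[OF f])
    fix A :: "(real ^ 'n) set" assume "A \<in> sets torus"
    then have A: "A \<in> sets lebesgue" "A \<subseteq> ?Q"
      unfolding torus_def by (auto simp: sets_restrict_space)
    then obtain S N N' where S: "A = S \<union> N" "N \<subseteq> N'" "N' \<in> null_sets lborel" "S \<in> sets lborel"
      by (auto elim: sets_completionE)
    have "N' \<in> null_sets lebesgue" using S(3) by (rule null_sets_completionI)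
    then have "N' \<inter> ?Q \<in> null_sets torus"
      unfolding torus_def by (subst null_sets_restrict_space) (auto intro: null_set_Int2)
    then have "AE x in torus. x \<notin> N' \<inter> ?Q" by (rule AE_not_in)
    then have "AE x in torus. indicator A x *\<^sub>R f x = indicator (S \<inter> ?Q) x *\<^sub>R f x"
      using AE_space by eventually_elim (use S A in \<open>auto simp: space_torus indicator_def\<close>)
    then have "(LINT x:A|torus. f x) = (LINT x:S \<inter> ?Q|torus. f x)"
      unfolding set_lebesgue_integral_def using \<open>A \<in> sets torus\<close> tor[of S] S(4) f
      by (intro integral_cong_AE) auto
    also have "\<dots> = 0" using S(4) by (intro borel) simp
    finally show "(LINT x:A|torus. f x) = 0" .
  qed
qed

section \<open>Weak derivatives\<close>

lemma has_weak_derivD: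
  assumes "has_weak_deriv i f g"
  shows "f \<in> L1_torus" "g \<in> L1_torus"
    "smooth \<phi> \<Longrightarrow> periodic \<phi> \<Longrightarrow>
       (LINT x|torus. f x * partial_deriv i \<phi> x) = - (LINT x|torus. g x * \<phi> x)"
  using assms by (auto simp: has_weak_deriv_def)

text \<open>The waves are test functions, so the difference of two weak derivatives is orthogonal to them.\<close>

lemma weak_deriv_unique:
  assumes "has_weak_deriv i f g" "has_weak_deriv i f h"
  shows "AE x in torus. g x = h x"
proof -
  have int: "integrable torus g" "integrable torus h"
    using assms by (auto dest: has_weak_derivD L1_torusD(4))
  have orth: "(LINT x|torus. (g x - h x) * p x) = 0" if "trig_poly p" for p
    using has_weak_derivD(3)[OF assms(1) trig_poly_smooth trig_poly_periodic, OF that that]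
      has_weak_derivD(3)[OF assms(2) trig_poly_smooth trig_poly_periodic, OF that that]
      integrable_mult_continuous[OF int(1) trig_poly_continuous[OF that]]
      integrable_mult_continuous[OF int(2) trig_poly_continuous[OF that]]
    by (simp add: left_diff_distrib)
  have "AE x in torus. g x - h x = 0"
    using int by (intro trig_system_complete orth trig_poly.intros) auto
  then show ?thesis by eventually_elim simp
qed

lemma has_weak_deriv_weak_deriv: "has_weak_deriv i f g \<Longrightarrow> has_weak_deriv i f (weak_deriv i f)"
  unfolding weak_deriv_def by (rule someI[of "has_weak_deriv i f"])

lemma weak_deriv_AE_eq: "has_weak_deriv i f g \<Longrightarrow> AE x in torus. weak_deriv i f x = g x"
  using weak_deriv_unique has_weak_deriv_weak_deriv by blast

lemma H1_torusD:
  assumes "f \<in> H1_torus"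
  shows "f \<in> L2_torus" "has_weak_deriv i f (weak_deriv i f)" "weak_deriv i f \<in> L2_torus"
  using assms has_weak_deriv_weak_deriv[of i f]
  by (auto simp: H1_torus_def weakly_differentiable_def)

lemma L2_torus_cong_AE:
  assumes "f \<in> L2_torus" "AE x in torus. g x = f x" "periodic g" "g \<in> borel_measurable lebesgue"
  shows "g \<in> L2_torus"
proof -
  have "integrable torus (\<lambda>x. (g x)\<^sup>2) \<longleftrightarrow> integrable torus (\<lambda>x. (f x)\<^sup>2)"
    using assms measurable_torus[OF assms(4)] L2_torusD(3)[OF assms(1)]
    by (intro integrable_cong_AE) (auto elim!: eventually_mono)
  then show ?thesis using assms by (simp add: L2_torus_def)
qed

lemma H1_torusI:
  assumes "f \<in> L2_torus" "\<And>i. has_weak_deriv i f (g i)" "\<And>i. g i \<in> L2_torus"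
  shows "f \<in> H1_torus"
proof -
  have "weak_deriv i f \<in> L2_torus" for i
  proof -
    have "weak_deriv i f \<in> L1_torus"
      using has_weak_derivD(2)[OF has_weak_deriv_weak_deriv[OF assms(2)]] .
    then show ?thesis
      using L2_torus_cong_AE[OF assms(3)[of i] weak_deriv_AE_eq[OF assms(2)]] by (simp add: L1_torusD)
  qed
  then show ?thesis using assms by (auto simp: H1_torus_def weakly_differentiable_def)
qed

lemma H1_torus_trig_poly: "trig_poly f \<Longrightarrow> f \<in> H1_torus"
  by (rule H1_torusI[OF _ has_weak_deriv_trig_poly])
    (auto intro: L2_torus_trig_poly trig_poly_partial_deriv)

lemma has_weak_deriv_scale:
  assumes "has_weak_deriv i f f'"
  shows "has_weak_deriv i (\<lambda>x. c * f x) (\<lambda>x. c * f' x)"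
  using assms by (auto simp: has_weak_deriv_def L1_torus_def periodic_def mult.assoc)

section \<open>Riesz-Fischer and Fourier projections\<close>

lemma L2_norm_le_if_nn_integral_le:
  assumes [measurable]: "h \<in> borel_measurable torus" and e: "0 \<le> e"
    and le: "(\<integral>\<^sup>+x. ennreal ((h x)\<^sup>2) \<partial>torus) \<le> ennreal (e\<^sup>2)"
  shows "integrable torus (\<lambda>x. (h x)\<^sup>2)" "L2_norm h \<le> e"
proof -
  show int: "integrable torus (\<lambda>x. (h x)\<^sup>2)"
    by (rule integrableI_bounded) (use le in \<open>auto intro: order.strict_trans1\<close>)
  have "ennreal (LINT x|torus. (h x)\<^sup>2) \<le> ennreal (e\<^sup>2)"
    using nn_integral_eq_integral[OF int] le by simp
  then show "L2_norm h \<le> e"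
    unfolding L2_norm_def using e by (intro real_le_lsqrt) (auto simp: integral_nonneg_AE)
qed

text \<open>A subsequence with geometrically decreasing increments converges almost everywhere, and Fatou's
  lemma bounds the distance to its limit. Taking the limit with \<open>lim\<close> at every point, convergent
  or not, makes the result periodic at every point.\<close>

lemma L2_torus_complete:
  fixes f :: "nat \<Rightarrow> real ^ 'n \<Rightarrow> real"
  assumes f: "\<And>n. f n \<in> L2_torus"
    and Cauchy: "\<And>e. e > 0 \<Longrightarrow> \<exists>N. \<forall>m\<ge>N. \<forall>n\<ge>N. L2_norm (\<lambda>x. f m x - f n x) < e"
  obtains g where "g \<in> L2_torus" "(\<lambda>n. L2_norm (\<lambda>x. f n x - g x)) \<longlonglongrightarrow> 0"
proof -
  have "\<exists>N. \<forall>m\<ge>N. \<forall>n\<ge>N. L2_norm (\<lambda>x. f m x - f n x) < (1/2) ^ k" for k :: nat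
    by (rule Cauchy) simp
  then obtain N where N: "\<And>k m n. m \<ge> N k \<Longrightarrow> n \<ge> N k \<Longrightarrow> L2_norm (\<lambda>x. f m x - f n x) < (1/2) ^ k"
    by metis
  \<comment> \<open>Summing makes \<open>r k\<close> exceed both \<open>k\<close> and all of \<open>N 0\<close>, ..., \<open>N k\<close>.\<close>
  define r where "r k = k + (\<Sum>j\<le>k. N j)" for k
  have r: "r k \<ge> k" "r k \<ge> N k" "r (Suc k) \<ge> N k" for k
  proof -
    have "N k \<le> (\<Sum>j\<le>k. N j)" by (rule member_le_sum) auto
    then show "r k \<ge> k" "r k \<ge> N k" "r (Suc k) \<ge> N k" by (auto simp: r_def)
  qed
  have fm[measurable]: "f n \<in> borel_measurable torus" for n by (rule L2_torusD(3)[OF f])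
  define d where "d k x = \<bar>f (r (Suc k)) x - f (r k) x\<bar>" for k x
  have dm[measurable]: "d k \<in> borel_measurable torus" for k unfolding d_def by measurable
  have dL2: "d k \<in> L2_torus" for k
    using L2_torus_diff[OF f f, of "r (Suc k)" "r k"]
    by (auto simp: d_def[abs_def] L2_torus_def periodic_def)
  define c where "c = L2_norm ((\<lambda>x. 1) :: real ^ 'n \<Rightarrow> real)"
  have c: "0 \<le> c" unfolding c_def by (rule L2_norm_nonneg)
  have int_d: "(\<integral>\<^sup>+x. ennreal (d k x) \<partial>torus) \<le> ennreal ((1/2) ^ k * c)" for k
  proof -
    have "integrable torus (\<lambda>x. d k x * 1)" by (rule integrable_L2_mult[OF dL2 L2_torus_const])
    then have "(\<integral>\<^sup>+x. ennreal (d k x) \<partial>torus) = ennreal (LINT x|torus. d k x)"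
      by (intro nn_integral_eq_integral) (auto simp: d_def)
    also have "(LINT x|torus. d k x) = ip (d k) (\<lambda>x. 1)" by (simp add: ip_def)
    also have "\<dots> \<le> L2_norm (d k) * c"
      unfolding c_def using Cauchy_Schwarz_L2[OF dL2 L2_torus_const[of 1], of k] by simp
    also have "L2_norm (d k) = L2_norm (\<lambda>x. f (r (Suc k)) x - f (r k) x)"
      by (simp add: L2_norm_def d_def)
    also have "\<dots> * c \<le> (1/2) ^ k * c"
      using N[OF r(3,2)] c by (intro mult_right_mono) (auto intro: less_imp_le)
    finally show ?thesis by (simp add: ennreal_leI)
  qed
  have "(\<integral>\<^sup>+x. (\<Sum>k. ennreal (d k x)) \<partial>torus) = (\<Sum>k. \<integral>\<^sup>+x. ennreal (d k x) \<partial>torus)"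
    by (rule nn_integral_suminf) measurable
  also have "\<dots> \<le> (\<Sum>k. ennreal ((1/2) ^ k * c))"
    by (intro suminf_le int_d) auto
  also have "\<dots> = ennreal (\<Sum>k. (1/2) ^ k * c)"
    using c by (intro suminf_ennreal2 summable_mult2 summable_geometric) auto
  also have "\<dots> < \<infinity>" by simp
  finally have "AE x in torus. (\<Sum>k. ennreal (d k x)) \<noteq> \<infinity>"
    by (intro nn_integral_PInf_AE) auto
  then have conv: "AE x in torus. (\<lambda>k. f (r k) x) \<longlonglongrightarrow> lim (\<lambda>k. f (r k) x)"
  proof eventually_elim
    case (elim x)
    then have "summable (\<lambda>k. d k x)" by (intro summable_suminf_not_top) (auto simp: d_def)
    then have "summable (\<lambda>k. f (r (Suc k)) x - f (r k) x)"
      unfolding d_def by (rule summable_rabs_cancel)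
    then have "convergent (\<lambda>n. \<Sum>k<n. f (r (Suc k)) x - f (r k) x)"
      by (simp add: summable_iff_convergent)
    then have "convergent (\<lambda>n. (f (r n) x - f (r 0) x) + f (r 0) x)"
      unfolding sum_lessThan_telescope[where f="\<lambda>k. f (r k) x"]
      by (intro convergent_add convergent_const)
    then show ?case by (simp add: convergent_LIMSEQ_iff)
  qed
  define g where "g x = lim (\<lambda>k. f (r k) x)" for x
  have gm: "g \<in> borel_measurable lebesgue"
    unfolding g_def using L2_torusD(2)[OF f] by (intro borel_measurable_lim_metric) auto
  note [measurable] = measurable_torus[OF gm]
  have gp: "periodic g" using L2_torusD(1)[OF f] by (simp add: periodic_def g_def)
  have tail: "integrable torus (\<lambda>x. (f n x - g x)\<^sup>2) \<and> L2_norm (\<lambda>x. f n x - g x) \<le> e"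
    if e: "e > 0" and M: "\<forall>m\<ge>M. \<forall>n\<ge>M. L2_norm (\<lambda>x. f m x - f n x) < e" and n: "n \<ge> M" for e M n
  proof -
    have "(\<integral>\<^sup>+x. ennreal ((f n x - g x)\<^sup>2) \<partial>torus)
        = (\<integral>\<^sup>+x. liminf (\<lambda>k. ennreal ((f n x - f (r k) x)\<^sup>2)) \<partial>torus)"
    proof (rule nn_integral_cong_AE)
      show "AE x in torus. ennreal ((f n x - g x)\<^sup>2) = liminf (\<lambda>k. ennreal ((f n x - f (r k) x)\<^sup>2))"
        using conv
      proof eventually_elim
        case (elim x)
        have "(\<lambda>k. ennreal ((f n x - f (r k) x)\<^sup>2)) \<longlonglongrightarrow> ennreal ((f n x - g x)\<^sup>2)"
          using elim unfolding g_def by (intro tendsto_ennrealI tendsto_intros)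
        from lim_imp_Liminf[OF _ this] show ?case by simp
      qed
    qed
    also have "\<dots> \<le> liminf (\<lambda>k. \<integral>\<^sup>+x. ennreal ((f n x - f (r k) x)\<^sup>2) \<partial>torus)"
      by (rule nn_integral_liminf) measurable
    also have "\<dots> \<le> liminf (\<lambda>k. ennreal (e\<^sup>2))"
    proof (rule Liminf_mono)
      show "\<forall>\<^sub>F k in sequentially. (\<integral>\<^sup>+x. ennreal ((f n x - f (r k) x)\<^sup>2) \<partial>torus) \<le> ennreal (e\<^sup>2)"
        using eventually_ge_at_top[of M]
      proof eventually_elim
        case (elim k)
        have "L2_norm (\<lambda>x. f n x - f (r k) x) \<le> e"
          using M n elim r(1)[of k] by (auto intro: less_imp_le)
        then have "(L2_norm (\<lambda>x. f n x - f (r k) x))\<^sup>2 \<le> e\<^sup>2" using L2_norm_nonneg by (intro power_mono)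
        moreover have "(\<integral>\<^sup>+x. ennreal ((f n x - f (r k) x)\<^sup>2) \<partial>torus)
            = ennreal ((L2_norm (\<lambda>x. f n x - f (r k) x))\<^sup>2)"
          unfolding L2_norm_sq ip_def
          using L2_torusD(4)[OF L2_torus_diff[OF f f]]
          by (subst nn_integral_eq_integral) (auto simp: power2_eq_square)
        ultimately show ?case by (simp add: ennreal_leI)
      qed
    qed
    also have "\<dots> = ennreal (e\<^sup>2)" by (simp add: Liminf_const)
    finally show ?thesis using e L2_norm_le_if_nn_integral_le[of "\<lambda>x. f n x - g x" e] by simp
  qed
  have g: "g \<in> L2_torus"
  proof -
    obtain M where M: "\<forall>m\<ge>M. \<forall>n\<ge>M. L2_norm (\<lambda>x. f m x - f n x) < 1" using Cauchy[of 1] by auto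
    have "integrable torus (\<lambda>x. (f M x - g x)\<^sup>2)" using tail[OF _ M] by simp
    then have "(\<lambda>x. f M x - g x) \<in> L2_torus"
      using L2_torusD(1,2)[OF f[of M]] gp gm by (auto simp: L2_torus_def periodic_def)
    from L2_torus_diff[OF f this, of M] show ?thesis by simp
  qed
  have "(\<lambda>n. L2_norm (\<lambda>x. f n x - g x)) \<longlonglongrightarrow> 0"
  proof (rule LIMSEQ_I)
    fix e :: real assume e: "0 < e"
    then obtain M where "\<forall>m\<ge>M. \<forall>n\<ge>M. L2_norm (\<lambda>x. f m x - f n x) < e / 2" using Cauchy[of "e/2"] by auto
    from tail[OF _ this] e have "\<forall>n\<ge>M. L2_norm (\<lambda>x. f n x - g x) \<le> e / 2" by auto
    then have "norm (L2_norm (\<lambda>x. f n x - g x) - 0) < e" if "n \<ge> M" for n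
      using e that L2_norm_nonneg[of "\<lambda>x. f n x - g x"] by force
    then show "\<exists>M. \<forall>n\<ge>M. norm (L2_norm (\<lambda>x. f n x - g x) - 0) < e" by blast
  qed
  with g show ?thesis by (rule that)
qed

definition freqs_upto :: "nat \<Rightarrow> (real ^ 'n) set" where
  "freqs_upto N = {k \<in> freqs. \<forall>i. \<bar>k $ i\<bar> \<le> real N}"

lemma finite_freqs_upto: "finite (freqs_upto N :: (real ^ 'n) set)"
proof -
  have "freqs_upto N \<subseteq> (\<lambda>m. \<chi> i. real_of_int (m i)) ` ((UNIV :: 'n set) \<rightarrow>\<^sub>E {- int N..int N})"
  proof
    fix k :: "real ^ 'n" assume k: "k \<in> freqs_upto N"
    have eq: "real_of_int \<lfloor>k $ i\<rfloor> = k $ i" for i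
      using k by (auto simp: freqs_upto_def freqs_def elim: Ints_cases)
    have "\<bar>real_of_int \<lfloor>k $ i\<rfloor>\<bar> \<le> real N" for i
      unfolding eq using k by (simp add: freqs_upto_def)
    then have "\<lfloor>k $ i\<rfloor> \<in> {- int N..int N}" for i
      by (metis abs_le_iff atLeastAtMost_iff minus_le_iff of_int_abs of_int_le_iff of_int_of_nat_eq)
    then have "(\<lambda>i. \<lfloor>k $ i\<rfloor>) \<in> UNIV \<rightarrow>\<^sub>E {- int N..int N}" by auto
    moreover have "k = (\<chi> i. real_of_int \<lfloor>k $ i\<rfloor>)" by (simp add: vec_eq_iff eq)
    ultimately show "k \<in> (\<lambda>m. \<chi> i. real_of_int (m i)) ` ((UNIV :: 'n set) \<rightarrow>\<^sub>E {- int N..int N})"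
      by (intro image_eqI)
  qed
  then show ?thesis by (rule finite_subset) (intro finite_imageI finite_PiE; simp)
qed

lemma freqs_upto_freqs: "k \<in> freqs_upto N \<Longrightarrow> k \<in> freqs"
  by (simp add: freqs_upto_def)

lemma freqs_upto_mono: "N \<le> M \<Longrightarrow> freqs_upto N \<subseteq> freqs_upto M"
  by (auto simp: freqs_upto_def intro: order_trans)

lemma freqs_upto_uminus: "- k \<in> freqs_upto N \<longleftrightarrow> k \<in> freqs_upto N"
  using freqs_intros(4)[of k] freqs_intros(4)[of "-k"] by (auto simp: freqs_upto_def)

lemma eventually_freqs_upto:
  assumes "k \<in> freqs" shows "\<forall>\<^sub>F N in sequentially. k \<in> freqs_upto N"
proof -
  obtain N where "norm k \<le> real N" using real_arch_simple by blast
  then have "\<bar>k $ i\<bar> \<le> real M" if "M \<ge> N" for M i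
    using that component_le_norm_cart[of k i] by linarith
  then have "k \<in> freqs_upto M" if "M \<ge> N" for M
    using assms that by (auto simp: freqs_upto_def)
  then show ?thesis by (auto simp: eventually_sequentially)
qed

text \<open>The coefficients \<open>a\<close>, \<open>b\<close> stand for integrals against the waves, which are not normalized; this is
  compensated by the factor in front.\<close>

definition trig_sum ::
    "nat \<Rightarrow> (real ^ 'n \<Rightarrow> real) \<Rightarrow> (real ^ 'n \<Rightarrow> real) \<Rightarrow> real ^ 'n \<Rightarrow> real" where
  "trig_sum N a b x = (1 / vol TYPE('n)) * (\<Sum>k\<in>freqs_upto N. a k * cos_wave k x + b k * sin_wave k x)"

definition energy_upto ::
    "nat \<Rightarrow> (real ^ 'n \<Rightarrow> real) \<Rightarrow> (real ^ 'n \<Rightarrow> real) \<Rightarrow> real" where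
  "energy_upto N a b = (1 / vol TYPE('n)) * (\<Sum>k\<in>freqs_upto N. (a k)\<^sup>2 + (b k)\<^sup>2)"

lemma trig_poly_trig_sum: "trig_poly (trig_sum N a b)"
  unfolding trig_sum_def[abs_def]
  by (intro trig_poly.scale trig_poly_sum trig_poly.add trig_poly.cos trig_poly.sin freqs_upto_freqs)

lemma L2_waves: "k \<in> freqs \<Longrightarrow> cos_wave k \<in> L2_torus" "k \<in> freqs \<Longrightarrow> sin_wave k \<in> L2_torus"
  by (auto intro: L2_torus_trig_poly trig_poly.intros)

lemma ip_trig_sum_right:
  fixes f :: "real ^ 'n \<Rightarrow> real"
  assumes "f \<in> L2_torus"
  shows "ip f (trig_sum N a b)
    = (1 / vol TYPE('n)) * (\<Sum>k\<in>freqs_upto N. a k * ip f (cos_wave k) + b k * ip f (sin_wave k))"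
proof -
  have w: "(\<lambda>x. a k * cos_wave k x) \<in> L2_torus" "(\<lambda>x. b k * sin_wave k x) \<in> L2_torus"
    if "k \<in> freqs_upto N" for k
    using that by (auto intro: L2_torus_scale L2_waves freqs_upto_freqs)
  show ?thesis
    unfolding trig_sum_def[abs_def] ip_scale_right using assms w
    by (subst ip_sum_right) (auto simp: ip_add_right ip_scale_right L2_torus_add)
qed

text \<open>Each pair \<open>k, - k\<close> of frequencies is counted twice in \<open>trig_sum\<close>; for coefficients with the
  parity of Fourier coefficients this makes up for the factor \<open>1 / 2\<close> in the orthogonality
  relations, also at the frequency 0.\<close>

lemma ip_trig_sum_wave:
  fixes l :: "real ^ 'n"
  assumes even: "\<And>k. k \<in> freqs \<Longrightarrow> a (- k) = a k" and odd: "\<And>k. k \<in> freqs \<Longrightarrow> b (- k) = - b k"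
    and l: "l \<in> freqs"
  shows "ip (trig_sum N a b) (cos_wave l) = (if l \<in> freqs_upto N then a l else 0)"
    "ip (trig_sum N a b) (sin_wave l) = (if l \<in> freqs_upto N then b l else 0)"
proof -
  let ?v = "vol TYPE('n)"
  have v: "?v \<noteq> 0" using vol_pos[where 'n='n] by simp
  have h: "c * (?v / 2 * (of_bool P + of_bool Q)) = (?v / 2) * ((if P then c else 0) + (if Q then c else 0))"
    "c * (?v / 2 * (of_bool P - of_bool Q)) = (?v / 2) * ((if P then c else 0) - (if Q then c else 0))"
    for c P Q by (cases P; cases Q; simp)+
  have w: "ip (cos_wave l) (cos_wave k) = ?v / 2 * (of_bool (k = l) + of_bool (k = - l))"
    "ip (cos_wave l) (sin_wave k) = 0" "ip (sin_wave l) (cos_wave k) = 0"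
    "ip (sin_wave l) (sin_wave k) = ?v / 2 * (of_bool (k = l) - of_bool (k = - l))"
    if "k \<in> freqs_upto N" for k
    using ip_waves[OF freqs_upto_freqs[OF that] l] by (simp_all only: ip_commute[of _ "cos_wave k"] ip_commute[of _ "sin_wave k"])
  have "ip (trig_sum N a b) (cos_wave l)
     = (1 / ?v) * (\<Sum>k\<in>freqs_upto N. a k * (?v / 2 * (of_bool (k = l) + of_bool (k = - l))))"
    unfolding ip_commute[of "trig_sum N a b"] ip_trig_sum_right[OF L2_waves(1)[OF l]]
    by (intro arg_cong[where f="\<lambda>s. (1 / ?v) * s"] sum.cong) (simp_all only: w mult_zero_right add_0_right)
  also have "\<dots> = (1/2) * (\<Sum>k\<in>freqs_upto N. (if k = l then a k else 0) + (if k = - l then a k else 0))"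
    unfolding h sum_distrib_left[symmetric] using v by simp
  also have "\<dots> = (if l \<in> freqs_upto N then a l else 0)"
    using even[OF l] by (simp add: sum.distrib finite_freqs_upto freqs_upto_uminus)
  finally show "ip (trig_sum N a b) (cos_wave l) = (if l \<in> freqs_upto N then a l else 0)" .
  have "ip (trig_sum N a b) (sin_wave l)
     = (1 / ?v) * (\<Sum>k\<in>freqs_upto N. b k * (?v / 2 * (of_bool (k = l) - of_bool (k = - l))))"
    unfolding ip_commute[of "trig_sum N a b"] ip_trig_sum_right[OF L2_waves(2)[OF l]]
    by (intro arg_cong[where f="\<lambda>s. (1 / ?v) * s"] sum.cong) (simp_all only: w mult_zero_right add_0_left)
  also have "\<dots> = (1/2) * (\<Sum>k\<in>freqs_upto N. (if k = l then b k else 0) - (if k = - l then b k else 0))"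
    unfolding h sum_distrib_left[symmetric] using v by simp
  also have "\<dots> = (if l \<in> freqs_upto N then b l else 0)"
    using odd[OF l] by (simp add: sum_subtractf finite_freqs_upto freqs_upto_uminus)
  finally show "ip (trig_sum N a b) (sin_wave l) = (if l \<in> freqs_upto N then b l else 0)" .
qed

lemma energy_upto_mono: "N \<le> M \<Longrightarrow> energy_upto N a b \<le> energy_upto M a b"
  unfolding energy_upto_def using vol_pos
  by (intro mult_left_mono sum_mono2 finite_freqs_upto freqs_upto_mono) (auto intro: less_imp_le)

lemma ip_trig_sum_trig_sum:
  assumes even: "\<And>k. k \<in> freqs \<Longrightarrow> a (- k) = a k" and odd: "\<And>k. k \<in> freqs \<Longrightarrow> b (- k) = - b k"
    and NM: "N \<le> M"
  shows "ip (trig_sum M a b) (trig_sum N a b) = energy_upto N a b"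
proof -
  have "ip (trig_sum M a b) (cos_wave k) = a k" "ip (trig_sum M a b) (sin_wave k) = b k"
    if "k \<in> freqs_upto N" for k
    using that ip_trig_sum_wave[where a=a and b=b, OF even odd] freqs_upto_mono[OF NM]
    by (auto simp: freqs_upto_freqs)
  then show ?thesis
    by (subst ip_trig_sum_right)
      (auto simp: energy_upto_def power2_eq_square intro!: L2_torus_trig_poly trig_poly_trig_sum)
qed

text \<open>Pythagoras: the smaller sum is the orthogonal projection of the larger one.\<close>

lemma L2_norm_trig_sum_diff:
  assumes even: "\<And>k. k \<in> freqs \<Longrightarrow> a (- k) = a k" and odd: "\<And>k. k \<in> freqs \<Longrightarrow> b (- k) = - b k"
    and NM: "N \<le> M"
  shows "(L2_norm (\<lambda>x. trig_sum M a b x - trig_sum N a b x))\<^sup>2 = energy_upto M a b - energy_upto N a b"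
proof -
  have T: "trig_sum K a b \<in> L2_torus" for K by (intro L2_torus_trig_poly trig_poly_trig_sum)
  show ?thesis
    using ip_trig_sum_trig_sum[where a=a and b=b, OF even odd]
    by (simp add: L2_norm_sq ip_diff_left ip_diff_right T L2_torus_diff NM
        ip_commute[of "trig_sum N a b" "trig_sum M a b"])
qed

text \<open>Used twice: with the coefficients of a given function, to expand it, and with formally
  differentiated coefficients, to construct a weak derivative. The parity conditions make \<open>a\<close> and \<open>b\<close>
  consistent at the frequencies \<open>k\<close> and \<open>- k\<close>, whose waves coincide up to sign.\<close>

lemma Riesz_Fischer:
  fixes a b :: "real ^ 'n \<Rightarrow> real"
  assumes even: "\<And>k. k \<in> freqs \<Longrightarrow> a (- k) = a k" and odd: "\<And>k. k \<in> freqs \<Longrightarrow> b (- k) = - b k"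
    and bound: "\<And>N. energy_upto N a b \<le> B"
  obtains g where "g \<in> L2_torus" "(\<lambda>N. L2_norm (\<lambda>x. trig_sum N a b x - g x)) \<longlonglongrightarrow> 0"
    "\<And>k. k \<in> freqs \<Longrightarrow> ip g (cos_wave k) = a k" "\<And>k. k \<in> freqs \<Longrightarrow> ip g (sin_wave k) = b k"
    "(\<lambda>N. energy_upto N a b) \<longlonglongrightarrow> (L2_norm g)\<^sup>2"
proof -
  have T: "trig_sum K a b \<in> L2_torus" for K by (intro L2_torus_trig_poly trig_poly_trig_sum)
  have "incseq (\<lambda>N. energy_upto N a b)" by (intro incseq_SucI energy_upto_mono) simp
  from incseq_convergent[OF this] bound have "convergent (\<lambda>N. energy_upto N a b)"
    by (metis convergentI)
  then have Cauchy: "Cauchy (\<lambda>N. energy_upto N a b)" by (rule convergent_Cauchy)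
  have "\<exists>K. \<forall>m\<ge>K. \<forall>n\<ge>K. L2_norm (\<lambda>x. trig_sum m a b x - trig_sum n a b x) < e" if e: "e > 0" for e
  proof -
    obtain K where K: "\<And>m n. m \<ge> K \<Longrightarrow> n \<ge> K \<Longrightarrow> \<bar>energy_upto m a b - energy_upto n a b\<bar> < e\<^sup>2"
      using Cauchy e unfolding Cauchy_def dist_real_def by (metis zero_less_power)
    have lt: "L2_norm (\<lambda>x. trig_sum m a b x - trig_sum n a b x) < e" if "K \<le> n" "n \<le> m" for m n
    proof (rule power2_less_imp_less)
      show "(L2_norm (\<lambda>x. trig_sum m a b x - trig_sum n a b x))\<^sup>2 < e\<^sup>2"
        using K[of m n] that L2_norm_trig_sum_diff[where a=a and b=b, OF even odd that(2)] by simp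
    qed (use e in simp)
    have "L2_norm (\<lambda>x. trig_sum m a b x - trig_sum n a b x) < e" if "K \<le> n" "K \<le> m" for m n
      using lt[of n m] lt[of m n] that linear[of n m] L2_norm_diff_commute[of "trig_sum m a b" "trig_sum n a b"]
      by auto
    then show ?thesis by blast
  qed
  from L2_torus_complete[OF T this] obtain g where g: "g \<in> L2_torus"
    and lim: "(\<lambda>N. L2_norm (\<lambda>x. trig_sum N a b x - g x)) \<longlonglongrightarrow> 0" by blast
  have const: "((\<lambda>N. L2_norm (\<lambda>x. h x - h x)) \<longlonglongrightarrow> 0)" for h :: "real ^ 'n \<Rightarrow> real"
    by (simp add: L2_norm_def)
  show ?thesis
  proof
    show "g \<in> L2_torus" by fact
    show "(\<lambda>N. L2_norm (\<lambda>x. trig_sum N a b x - g x)) \<longlonglongrightarrow> 0" by fact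
    show "ip g (cos_wave k) = a k" if k: "k \<in> freqs" for k
    proof (rule LIMSEQ_unique)
      show "(\<lambda>N. ip (trig_sum N a b) (cos_wave k)) \<longlonglongrightarrow> ip g (cos_wave k)"
        by (intro tendsto_ip T g lim L2_waves k const)
      show "(\<lambda>N. ip (trig_sum N a b) (cos_wave k)) \<longlonglongrightarrow> a k"
        by (rule tendsto_eventually, rule eventually_mono[OF eventually_freqs_upto[OF k]])
          (simp add: ip_trig_sum_wave[where a=a and b=b, OF even odd k])
    qed
    show "ip g (sin_wave k) = b k" if k: "k \<in> freqs" for k
    proof (rule LIMSEQ_unique)
      show "(\<lambda>N. ip (trig_sum N a b) (sin_wave k)) \<longlonglongrightarrow> ip g (sin_wave k)"
        by (intro tendsto_ip T g lim L2_waves k const)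
      show "(\<lambda>N. ip (trig_sum N a b) (sin_wave k)) \<longlonglongrightarrow> b k"
        by (rule tendsto_eventually, rule eventually_mono[OF eventually_freqs_upto[OF k]])
          (simp add: ip_trig_sum_wave[where a=a and b=b, OF even odd k])
    qed
    have "(\<lambda>N. ip (trig_sum N a b) (trig_sum N a b)) \<longlonglongrightarrow> ip g g"
      by (intro tendsto_ip T g lim)
    then show "(\<lambda>N. energy_upto N a b) \<longlonglongrightarrow> (L2_norm g)\<^sup>2"
      using ip_trig_sum_trig_sum[where a=a and b=b, OF even odd] by (simp add: L2_norm_sq)
  qed
qed

definition coeff_cos :: "(real ^ 'n \<Rightarrow> real) \<Rightarrow> real ^ 'n \<Rightarrow> real" where
  "coeff_cos f k = ip f (cos_wave k)"

definition coeff_sin :: "(real ^ 'n \<Rightarrow> real) \<Rightarrow> real ^ 'n \<Rightarrow> real" where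
  "coeff_sin f k = ip f (sin_wave k)"

definition proj :: "nat \<Rightarrow> (real ^ 'n \<Rightarrow> real) \<Rightarrow> real ^ 'n \<Rightarrow> real" where
  "proj N f = trig_sum N (coeff_cos f) (coeff_sin f)"

lemma coeff_parity: "coeff_cos f (- k) = coeff_cos f k" "coeff_sin f (- k) = - coeff_sin f k"
proof -
  have "cos_wave (- k) = cos_wave k" "sin_wave (- k) = (\<lambda>x. - 1 * sin_wave k x)"
    by (auto simp: cos_wave_def sin_wave_def)
  then show "coeff_cos f (- k) = coeff_cos f k" "coeff_sin f (- k) = - coeff_sin f k"
    unfolding coeff_cos_def coeff_sin_def by (simp_all only: ip_scale_right)
qed

lemma trig_poly_proj: "trig_poly (proj N f)"
  unfolding proj_def by (rule trig_poly_trig_sum)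

lemma L2_torus_proj: "proj N f \<in> L2_torus"
  by (rule L2_torus_trig_poly[OF trig_poly_proj])

lemma ip_proj:
  fixes f g :: "real ^ 'n \<Rightarrow> real"
  assumes "g \<in> L2_torus"
  shows "ip g (proj N f) = (1 / vol TYPE('n)) *
    (\<Sum>k\<in>freqs_upto N. coeff_cos f k * coeff_cos g k + coeff_sin f k * coeff_sin g k)"
  unfolding proj_def ip_trig_sum_right[OF assms] by (simp add: coeff_cos_def coeff_sin_def)

text \<open>The energy is the squared norm of the projection, and the projection is orthogonal to the rest.\<close>

lemma Bessel:
  assumes "f \<in> L2_torus"
  shows "energy_upto N (coeff_cos f) (coeff_sin f) \<le> (L2_norm f)\<^sup>2"
proof -
  have 1: "ip f (proj N f) = energy_upto N (coeff_cos f) (coeff_sin f)"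
    unfolding ip_proj[OF assms] energy_upto_def by (simp add: power2_eq_square)
  have 2: "ip (proj N f) (proj N f) = energy_upto N (coeff_cos f) (coeff_sin f)"
    unfolding proj_def by (rule ip_trig_sum_trig_sum) (auto simp: coeff_parity)
  have "0 \<le> ip (\<lambda>x. f x - proj N f x) (\<lambda>x. f x - proj N f x)" by (rule ip_self_nonneg)
  also have "\<dots> = (L2_norm f)\<^sup>2 - energy_upto N (coeff_cos f) (coeff_sin f)"
    by (simp add: ip_diff_left ip_diff_right L2_torus_diff assms L2_torus_proj 1 2
        ip_commute[of "proj N f" f] L2_norm_sq)
  finally show ?thesis by simp
qed

lemma coeff_eq_imp_AE_eq:
  assumes "f \<in> L2_torus" "g \<in> L2_torus"
    and "\<And>k. k \<in> freqs \<Longrightarrow> coeff_cos f k = coeff_cos g k"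
    and "\<And>k. k \<in> freqs \<Longrightarrow> coeff_sin f k = coeff_sin g k"
  shows "AE x in torus. f x = g x"
proof -
  have d: "(\<lambda>x. f x - g x) \<in> L2_torus" by (rule L2_torus_diff[OF assms(1,2)])
  have "AE x in torus. f x - g x = 0"
  proof (rule trig_system_complete[OF L1_torusD(4)[OF L2_torus_L1[OF d]]])
    show "(LINT x|torus. (f x - g x) * cos_wave k x) = 0" if "k \<in> freqs" for k
      using ip_diff_left[OF assms(1,2) L2_waves(1)[OF that]] assms(3)[OF that]
      by (simp add: ip_def coeff_cos_def)
    show "(LINT x|torus. (f x - g x) * sin_wave k x) = 0" if "k \<in> freqs" for k
      using ip_diff_left[OF assms(1,2) L2_waves(2)[OF that]] assms(4)[OF that]
      by (simp add: ip_def coeff_sin_def)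
  qed
  then show ?thesis by eventually_elim simp
qed

lemma L2_norm_cong_AE:
  assumes "AE x in torus. f x = g x" "f \<in> borel_measurable torus" "g \<in> borel_measurable torus"
  shows "L2_norm f = L2_norm g"
  unfolding L2_norm_def using assms
  by (intro arg_cong[where f=sqrt] integral_cong_AE) (auto elim!: eventually_mono)

text \<open>Bessel's inequality provides a limit of the projections. It has the same Fourier coefficients as
  \<open>f\<close>, so it is \<open>f\<close> by completeness.\<close>

lemma
  assumes f: "f \<in> L2_torus"
  shows proj_tendsto: "(\<lambda>N. L2_norm (\<lambda>x. proj N f x - f x)) \<longlonglongrightarrow> 0"
    and Parseval: "(\<lambda>N. energy_upto N (coeff_cos f) (coeff_sin f)) \<longlonglongrightarrow> (L2_norm f)\<^sup>2"
proof -
  obtain g where g: "g \<in> L2_torus"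
    and lim: "(\<lambda>N. L2_norm (\<lambda>x. trig_sum N (coeff_cos f) (coeff_sin f) x - g x)) \<longlonglongrightarrow> 0"
    and co: "\<And>k. k \<in> freqs \<Longrightarrow> ip g (cos_wave k) = coeff_cos f k"
      "\<And>k. k \<in> freqs \<Longrightarrow> ip g (sin_wave k) = coeff_sin f k"
    and en: "(\<lambda>N. energy_upto N (coeff_cos f) (coeff_sin f)) \<longlonglongrightarrow> (L2_norm g)\<^sup>2"
    using Riesz_Fischer[OF _ _ Bessel[OF f]] by (auto simp: coeff_parity)
  have ae: "AE x in torus. g x = f x"
    using co by (intro coeff_eq_imp_AE_eq g f) (auto simp: coeff_cos_def coeff_sin_def)
  have m: "g \<in> borel_measurable torus" "f \<in> borel_measurable torus" "proj N f \<in> borel_measurable torus" for N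
    using L2_torusD(3) f g L2_torus_proj by auto
  have "L2_norm (\<lambda>x. proj N f x - g x) = L2_norm (\<lambda>x. proj N f x - f x)" for N
    using ae m by (intro L2_norm_cong_AE) (auto elim!: eventually_mono)
  with lim show "(\<lambda>N. L2_norm (\<lambda>x. proj N f x - f x)) \<longlonglongrightarrow> 0" by (simp add: proj_def)
  have "L2_norm g = L2_norm f" using ae m by (intro L2_norm_cong_AE) auto
  with en show "(\<lambda>N. energy_upto N (coeff_cos f) (coeff_sin f)) \<longlonglongrightarrow> (L2_norm f)\<^sup>2" by simp
qed

section \<open>The space \<open>H\<^sup>1\<close> in terms of Fourier coefficients\<close>

text \<open>The defining identity of weak derivatives, tested with the waves.\<close>

lemma coeff_weak_deriv:
  assumes "has_weak_deriv i f g" "k \<in> freqs"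
  shows "coeff_cos g k = k $ i * coeff_sin f k" "coeff_sin g k = - (k $ i) * coeff_cos f k"
proof -
  have "(LINT x|torus. f x * partial_deriv i (cos_wave k) x) = - (LINT x|torus. g x * cos_wave k x)"
    "(LINT x|torus. f x * partial_deriv i (sin_wave k) x) = - (LINT x|torus. g x * sin_wave k x)"
    using assms(2)
    by (auto intro!: has_weak_derivD(3)[OF assms(1)] trig_poly_smooth trig_poly_periodic
        trig_poly.cos trig_poly.sin)
  then show "coeff_cos g k = k $ i * coeff_sin f k" "coeff_sin g k = - (k $ i) * coeff_cos f k"
    by (simp_all add: partial_deriv_waves coeff_cos_def coeff_sin_def ip_def mult.left_commute[of "f _"])
qed

lemma partial_deriv_proj:
  "partial_deriv i (proj N f)
    = trig_sum N (\<lambda>k. k $ i * coeff_sin f k) (\<lambda>k. - (k $ i) * coeff_cos f k)"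
proof
  fix x
  have "(proj N f has_derivative (\<lambda>h. (1 / vol TYPE('a)) * (\<Sum>k\<in>freqs_upto N.
      coeff_cos f k * (- sin_wave k x * (k \<bullet> h)) + coeff_sin f k * (cos_wave k x * (k \<bullet> h))))) (at x)"
    unfolding proj_def trig_sum_def[abs_def]
    by (intro has_derivative_mult_right has_derivative_sum has_derivative_add has_derivative_waves)
  from partial_deriv_eq[OF this]
  show "partial_deriv i (proj N f) x
      = trig_sum N (\<lambda>k. k $ i * coeff_sin f k) (\<lambda>k. - (k $ i) * coeff_cos f k) x"
    by (simp add: trig_sum_def inner_axis algebra_simps)
qed

text \<open>Fourier projections commute with differentiation. Hence they approximate a function of \<open>H\<^sup>1\<close>
  together with its derivatives.\<close>

lemma partial_deriv_proj_eq:
  assumes "has_weak_deriv i f g"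
  shows "partial_deriv i (proj N f) = proj N g"
  unfolding partial_deriv_proj unfolding proj_def trig_sum_def[abs_def]
  using coeff_weak_deriv[OF assms] by (intro ext) (auto simp: freqs_upto_freqs)

definition grad_sq :: "(real ^ 'n \<Rightarrow> real) \<Rightarrow> real" where
  "grad_sq f = (\<Sum>i\<in>UNIV. (L2_norm (weak_deriv i f))\<^sup>2)"

definition grad_energy_upto :: "nat \<Rightarrow> (real ^ 'n \<Rightarrow> real) \<Rightarrow> real" where
  "grad_energy_upto N f =
    (\<Sum>i\<in>UNIV. energy_upto N (\<lambda>k. k $ i * coeff_sin f k) (\<lambda>k. - (k $ i) * coeff_cos f k))"

lemma energy_upto_nonneg: "0 \<le> energy_upto N a b"
  unfolding energy_upto_def using vol_pos by (intro mult_nonneg_nonneg sum_nonneg) (auto intro: less_imp_le)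

lemma grad_sq_nonneg: "0 \<le> grad_sq f"
  unfolding grad_sq_def by (intro sum_nonneg) auto

lemma grad_energy_tendsto:
  assumes "f \<in> H1_torus"
  shows "(\<lambda>N. grad_energy_upto N f) \<longlonglongrightarrow> grad_sq f"
  unfolding grad_energy_upto_def grad_sq_def
proof (intro tendsto_sum)
  fix i
  note d = H1_torusD(2,3)[OF assms, of i]
  have "energy_upto N (\<lambda>k. k $ i * coeff_sin f k) (\<lambda>k. - (k $ i) * coeff_cos f k)
      = energy_upto N (coeff_cos (weak_deriv i f)) (coeff_sin (weak_deriv i f))" for N
    unfolding energy_upto_def using coeff_weak_deriv[OF d(1)] by (simp add: freqs_upto_freqs)
  then show "(\<lambda>N. energy_upto N (\<lambda>k. k $ i * coeff_sin f k) (\<lambda>k. - (k $ i) * coeff_cos f k))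
      \<longlonglongrightarrow> (L2_norm (weak_deriv i f))\<^sup>2"
    using Parseval[OF d(2)] by simp
qed

lemma L2_norm_zero: "L2_norm (\<lambda>x. 0) = 0"
  by (simp add: L2_norm_def)

lemma L2_torus_smooth:
  assumes "smooth \<phi>" "periodic \<phi>" shows "\<phi> \<in> L2_torus"
proof -
  have "integrable torus (\<lambda>x. 1 * (\<phi> x)\<^sup>2)"
    using L1_torusD(4)[OF L2_torus_L1[OF L2_torus_const[of 1]]]
    by (intro integrable_mult_continuous continuous_intros smooth_continuous assms)
  then show ?thesis
    using assms by (simp add: L2_torus_def continuous_measurable smooth_continuous)
qed

lemma periodic_partial_deriv:
  fixes f :: "real ^ 'n \<Rightarrow> real"
  assumes "\<And>x. f differentiable (at x)" "periodic f"
  shows "periodic (partial_deriv i f)"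
  unfolding periodic_def
proof (intro allI)
  fix x :: "real ^ 'n" and j
  let ?c = "axis j (2 * pi) :: real ^ 'n"
  have "(f has_derivative frechet_derivative f (at (x + ?c))) (at (x + ?c))"
    using assms(1) frechet_derivative_works by blast
  then have "((\<lambda>y. f (y + ?c)) has_derivative frechet_derivative f (at (x + ?c))) (at x)"
    by (rule has_derivative_compose[where f="\<lambda>y. y + ?c", rotated])
      (auto intro!: derivative_eq_intros)
  moreover have "(\<lambda>y. f (y + ?c)) = f" using assms(2) by (auto simp: periodic_def)
  ultimately show "partial_deriv i f (x + ?c) = partial_deriv i f x"
    using partial_deriv_eq[of f _ x i] by (simp add: partial_deriv_def)
qed

text \<open>The bound allows to apply the Riesz-Fischer theorem to the coefficients that a derivative would
  have. The resulting function is a weak derivative, as integration by parts holds for the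
  projections and passes to the limit.\<close>

lemma H1_torus_if_grad_energy_bounded:
  assumes f: "f \<in> L2_torus" and bound: "\<And>N. grad_energy_upto N f \<le> B"
  shows "f \<in> H1_torus"
proof -
  have "\<exists>g. has_weak_deriv i f g \<and> g \<in> L2_torus" for i
  proof -
    let ?a = "\<lambda>k. k $ i * coeff_sin f k" and ?b = "\<lambda>k. - (k $ i) * coeff_cos f k"
    have "energy_upto N ?a ?b \<le> grad_energy_upto N f" for N
      unfolding grad_energy_upto_def
      by (rule member_le_sum[where f="\<lambda>i. energy_upto N (\<lambda>k. k $ i * coeff_sin f k) (\<lambda>k. - (k $ i) * coeff_cos f k)"])
        (auto simp: energy_upto_nonneg)
    then have "energy_upto N ?a ?b \<le> B" for N using bound order_trans by blast
    then obtain g where g: "g \<in> L2_torus" and lim: "(\<lambda>N. L2_norm (\<lambda>x. trig_sum N ?a ?b x - g x)) \<longlonglongrightarrow> 0"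
      by (rule Riesz_Fischer[of ?a ?b B, rotated 2]) (auto simp: coeff_parity)
    have "(LINT x|torus. f x * partial_deriv i \<phi> x) = - (LINT x|torus. g x * \<phi> x)"
      if \<phi>: "smooth \<phi>" "periodic \<phi>" for \<phi>
    proof -
      have 2: "\<phi> \<in> L2_torus" "partial_deriv i \<phi> \<in> L2_torus"
        using \<phi> by (auto intro!: L2_torus_smooth smooth_partial_deriv periodic_partial_deriv smooth_differentiable)
      have 1: "(\<lambda>N. ip (proj N f) (partial_deriv i \<phi>)) \<longlonglongrightarrow> ip f (partial_deriv i \<phi>)"
        by (intro tendsto_ip L2_torus_proj f 2 proj_tendsto) (simp add: L2_norm_zero)
      have "ip (proj N f) (partial_deriv i \<phi>) = - ip (partial_deriv i (proj N f)) \<phi>" for N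
        using integral_by_parts_torus[OF trig_poly_proj \<phi>] by (simp add: ip_def)
      with 1 have 3: "(\<lambda>N. - ip (partial_deriv i (proj N f)) \<phi>) \<longlonglongrightarrow> ip f (partial_deriv i \<phi>)" by simp
      have "(\<lambda>N. - ip (partial_deriv i (proj N f)) \<phi>) \<longlonglongrightarrow> - ip g \<phi>"
        unfolding partial_deriv_proj
        by (intro tendsto_minus tendsto_ip[OF L2_torus_trig_poly[OF trig_poly_trig_sum] g 2(1) 2(1) lim])
          (simp add: L2_norm_zero)
      from LIMSEQ_unique[OF 3 this] show ?thesis by (simp add: ip_def)
    qed
    then show ?thesis using f g L2_torus_L1 unfolding has_weak_deriv_def by blast
  qed
  then show ?thesis using H1_torusI[OF f] by metis
qed

lemma Hdot1_norm_H1: "f \<in> H1_torus \<Longrightarrow> Hdot1_norm f = ennreal (sqrt (grad_sq f))"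
  by (simp add: Hdot1_norm_def grad_sq_def)

lemma Hdot1_norm_sq_H1: "f \<in> H1_torus \<Longrightarrow> (Hdot1_norm f)\<^sup>2 = ennreal (grad_sq f)"
  by (simp add: Hdot1_norm_H1 ennreal_power grad_sq_nonneg)

text \<open>Only countably many scalar functions of \<open>f\<close> enter the right-hand side. Along a curve that is
  continuous in \<open>L\<^sup>2\<close> they are continuous in time, so the homogeneous norm is measurable in time.\<close>

lemma Hdot1_norm_sq_eq_SUP:
  assumes f: "f \<in> L2_torus"
  shows "(Hdot1_norm f)\<^sup>2 = (SUP N. ennreal (grad_energy_upto N f))"
proof -
  have mono: "incseq (\<lambda>N. ennreal (grad_energy_upto N f))"
    unfolding grad_energy_upto_def by (intro monoI ennreal_leI sum_mono energy_upto_mono)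
  show ?thesis
  proof (cases "f \<in> H1_torus")
    case True
    have "(\<lambda>N. ennreal (grad_energy_upto N f)) \<longlonglongrightarrow> (SUP N. ennreal (grad_energy_upto N f))"
      by (rule LIMSEQ_SUP[OF mono])
    moreover have "(\<lambda>N. ennreal (grad_energy_upto N f)) \<longlonglongrightarrow> ennreal (grad_sq f)"
      by (intro tendsto_ennrealI grad_energy_tendsto True)
    ultimately show ?thesis using Hdot1_norm_sq_H1[OF True] LIMSEQ_unique by metis
  next
    case False
    have "(SUP N. ennreal (grad_energy_upto N f)) = \<infinity>"
    proof (rule ccontr)
      assume "(SUP N. ennreal (grad_energy_upto N f)) \<noteq> \<infinity>"
      then obtain B where B: "0 \<le> B" "(SUP N. ennreal (grad_energy_upto N f)) = ennreal B"
        by (metis ennreal_cases infinity_ennreal_def)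
      have "ennreal (grad_energy_upto N f) \<le> ennreal B" for N
        unfolding B(2)[symmetric] by (rule SUP_upper) simp
      then have "grad_energy_upto N f \<le> B" for N using B(1) by simp
      with False H1_torus_if_grad_energy_bounded[OF f] show False by blast
    qed
    moreover have "(Hdot1_norm f)\<^sup>2 = \<infinity>"
      using False by (simp add: Hdot1_norm_def power2_eq_square)
    ultimately show ?thesis by (simp only:)
  qed
qed

lemma proj_weak_deriv_tendsto:
  assumes "f \<in> H1_torus"
  shows "(\<lambda>N. L2_norm (\<lambda>x. partial_deriv i (proj N f) x - weak_deriv i f x)) \<longlonglongrightarrow> 0"
  using proj_tendsto[OF H1_torusD(3)[OF assms]] partial_deriv_proj_eq[OF H1_torusD(2)[OF assms]] by simp

lemma L2_norm_proj_le:
  assumes "f \<in> L2_torus" shows "L2_norm (proj N f) \<le> L2_norm f"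
proof (rule power2_le_imp_le)
  have "(L2_norm (proj N f))\<^sup>2 = energy_upto N (coeff_cos f) (coeff_sin f)"
    unfolding proj_def L2_norm_sq by (rule ip_trig_sum_trig_sum) (auto simp: coeff_parity)
  then show "(L2_norm (proj N f))\<^sup>2 \<le> (L2_norm f)\<^sup>2" using Bessel[OF assms] by simp
qed (rule L2_norm_nonneg)

section \<open>Advection by a divergence-free Lipschitz field\<close>

lemma L2_torus_bounded_mult:
  fixes w f :: "real ^ 'n \<Rightarrow> real"
  assumes w: "periodic w" "w \<in> borel_measurable lebesgue" "AE x in torus. \<bar>w x\<bar> \<le> M"
    and M: "0 \<le> M" and f: "f \<in> L2_torus"
  shows "(\<lambda>x. w x * f x) \<in> L2_torus" "L2_norm (\<lambda>x. w x * f x) \<le> M * L2_norm f"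
proof -
  have wm[measurable]: "w \<in> borel_measurable torus" "f \<in> borel_measurable torus"
    using measurable_torus[OF w(2)] L2_torusD(3)[OF f] by auto
  have le: "AE x in torus. (w x * f x)\<^sup>2 \<le> M\<^sup>2 * (f x)\<^sup>2"
    using w(3)
  proof eventually_elim
    case (elim x)
    then have "(w x)\<^sup>2 \<le> M\<^sup>2" using M by (metis abs_ge_zero power2_abs power_mono)
    then show ?case by (simp add: power_mult_distrib mult_right_mono)
  qed
  have int: "integrable torus (\<lambda>x. M\<^sup>2 * (f x)\<^sup>2)" using L2_torusD(4)[OF f] by simp
  have int2: "integrable torus (\<lambda>x. (w x * f x)\<^sup>2)"
    by (rule Bochner_Integration.integrable_bound[OF int]) (use le in \<open>auto elim!: eventually_mono\<close>)
  then show "(\<lambda>x. w x * f x) \<in> L2_torus"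
    using w L2_torusD(1,2)[OF f] by (simp add: L2_torus_def periodic_def)
  have "(LINT x|torus. (w x * f x)\<^sup>2) \<le> (LINT x|torus. M\<^sup>2 * (f x)\<^sup>2)"
    by (rule integral_mono_AE[OF int2 int le])
  then have "sqrt (LINT x|torus. (w x * f x)\<^sup>2) \<le> sqrt (M\<^sup>2 * (LINT x|torus. (f x)\<^sup>2))" by simp
  then show "L2_norm (\<lambda>x. w x * f x) \<le> M * L2_norm f"
    using M by (simp add: L2_norm_def real_sqrt_mult)
qed

lemma tendsto_bounded_mult:
  fixes w f :: "real ^ 'n \<Rightarrow> real" and fn :: "nat \<Rightarrow> real ^ 'n \<Rightarrow> real"
  assumes w: "periodic w" "w \<in> borel_measurable lebesgue" "AE x in torus. \<bar>w x\<bar> \<le> M" "0 \<le> M"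
    and f: "f \<in> L2_torus" "\<And>n. fn n \<in> L2_torus"
    and lim: "(\<lambda>n. L2_norm (\<lambda>x. fn n x - f x)) \<longlonglongrightarrow> 0"
  shows "(\<lambda>n. L2_norm (\<lambda>x. w x * fn n x - w x * f x)) \<longlonglongrightarrow> 0"
proof (rule Lim_null_comparison[OF always_eventually])
  show "\<forall>n. norm (L2_norm (\<lambda>x. w x * fn n x - w x * f x)) \<le> M * L2_norm (\<lambda>x. fn n x - f x)"
    using L2_torus_bounded_mult(2)[OF w L2_torus_diff[OF f(2,1)]]
    by (simp add: right_diff_distrib L2_norm_nonneg)
  show "(\<lambda>n. M * L2_norm (\<lambda>x. fn n x - f x)) \<longlonglongrightarrow> 0"
    using tendsto_mult_left[OF lim, of M] by simp
qed

definition advection :: "(real ^ 'n \<Rightarrow> real ^ 'n) \<Rightarrow> (real ^ 'n \<Rightarrow> real) \<Rightarrow> (real ^ 'n \<Rightarrow> real) \<Rightarrow> real" where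
  "advection w f g = (\<Sum>i\<in>UNIV. ip (\<lambda>x. w x $ i * weak_deriv i f x) g)"

definition grad_ip :: "(real ^ 'n \<Rightarrow> real) \<Rightarrow> (real ^ 'n \<Rightarrow> real) \<Rightarrow> real" where
  "grad_ip f g = (\<Sum>i\<in>UNIV. ip (weak_deriv i f) (weak_deriv i g))"

context
  fixes M :: real and w :: "real ^ 'n \<Rightarrow> real ^ 'n"
  assumes w: "\<And>i. W1inf_le M (\<lambda>x. w x $ i)"
begin

lemma velocity_bound_nonneg: "0 \<le> M"
proof (rule ccontr)
  assume "\<not> 0 \<le> M"
  then have neg: "\<not> \<bar>r\<bar> \<le> M" for r by linarith
  have "AE x in (torus :: (real^'n) measure). \<bar>w x $ undefined\<bar> \<le> M"
    using w[of undefined] by (simp add: W1inf_le_def)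
  then have "AE x in (torus :: (real^'n) measure). False" using neg by simp
  then have "(LINT x|(torus :: (real^'n) measure). 1) = (0::real)"
    by (intro integral_eq_zero_AE) (auto elim!: eventually_mono)
  moreover have "(LINT x|(torus :: (real^'n) measure). 1) = vol TYPE('n)"
    using integral_waves(1)[OF freqs_intros(1)] by (simp add: cos_wave_def[abs_def])
  ultimately show False using vol_pos[where 'n='n] by simp
qed

lemma velocity:
  "periodic (\<lambda>x. w x $ i)" "(\<lambda>x. w x $ i) \<in> borel_measurable lebesgue"
  "AE x in torus. \<bar>w x $ i\<bar> \<le> M" "0 \<le> M"
  "has_weak_deriv i (\<lambda>x. w x $ i) (weak_deriv i (\<lambda>x. w x $ i))"
  using w[of i] velocity_bound_nonneg
  by (auto simp: W1inf_le_def weakly_differentiable_def intro: has_weak_deriv_weak_deriv)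

lemma weak_form_eq:
  assumes f: "f \<in> H1_torus" and v: "v \<in> H1_torus"
  shows "weak_form \<kappa> w f v = advection w f v + \<kappa> * grad_ip f v"
proof -
  have int: "integrable torus (\<lambda>x. w x $ i * weak_deriv i f x * v x)"
    "integrable torus (\<lambda>x. weak_deriv i f x * weak_deriv i v x)" for i
    by (rule integrable_L2_mult[OF L2_torus_bounded_mult(1)[OF velocity(1-4) H1_torusD(3)[OF f]] H1_torusD(1)[OF v]],
        rule integrable_L2_mult[OF H1_torusD(3)[OF f] H1_torusD(3)[OF v]])
  show ?thesis
    unfolding weak_form_def advection_def grad_ip_def ip_def
    by (simp add: sum_distrib_right int)
qed

lemma advection_le:
  assumes f: "f \<in> H1_torus" and g: "g \<in> L2_torus"
  shows "\<bar>advection w f g\<bar> \<le> M * (grad_sq f + real CARD('n) * (L2_norm g)\<^sup>2)"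
proof -
  have "\<bar>ip (\<lambda>x. w x $ i * weak_deriv i f x) g\<bar> \<le> M * ((L2_norm (weak_deriv i f))\<^sup>2 + (L2_norm g)\<^sup>2)" for i
  proof -
    note d = H1_torusD(3)[OF f, of i]
    have "\<bar>ip (\<lambda>x. w x $ i * weak_deriv i f x) g\<bar> \<le> L2_norm (\<lambda>x. w x $ i * weak_deriv i f x) * L2_norm g"
      by (intro Cauchy_Schwarz_L2 g L2_torus_bounded_mult(1)[OF velocity(1-4)] d)
    also have "\<dots> \<le> (M * L2_norm (weak_deriv i f)) * L2_norm g"
      by (intro mult_right_mono L2_norm_nonneg L2_torus_bounded_mult(2)[OF velocity(1-4)] d)
    also have "\<dots> = M * (L2_norm (weak_deriv i f) * L2_norm g)" by simp
    also have "\<dots> \<le> M * ((L2_norm (weak_deriv i f))\<^sup>2 + (L2_norm g)\<^sup>2)"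
      using sum_squares_bound[of "L2_norm (weak_deriv i f)" "L2_norm g"] L2_norm_nonneg[of "weak_deriv i f"]
        L2_norm_nonneg[of g] velocity(4)
      by (intro mult_left_mono) (auto simp: mult.assoc intro: order_trans[rotated])
    finally show ?thesis .
  qed
  then have "\<bar>advection w f g\<bar> \<le> (\<Sum>i\<in>UNIV. M * ((L2_norm (weak_deriv i f))\<^sup>2 + (L2_norm g)\<^sup>2))"
    unfolding advection_def by (intro order_trans[OF sum_abs] sum_mono)
  then show ?thesis
    by (simp add: grad_sq_def sum.distrib sum_distrib_left[symmetric])
qed

lemma tendsto_advection:
  assumes f: "f \<in> H1_torus" and g: "g \<in> L2_torus"
  shows "(\<lambda>N. advection w f (proj N g)) \<longlonglongrightarrow> advection w f g"
  unfolding advection_def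
proof (rule tendsto_sum)
  fix i
  show "(\<lambda>N. ip (\<lambda>x. w x $ i * weak_deriv i f x) (proj N g)) \<longlonglongrightarrow> ip (\<lambda>x. w x $ i * weak_deriv i f x) g"
  proof (rule tendsto_ip[OF _ _ L2_torus_proj g _ proj_tendsto[OF g]])
    show "(\<lambda>x. w x $ i * weak_deriv i f x) \<in> L2_torus"
      by (rule L2_torus_bounded_mult(1)[OF velocity(1-4) H1_torusD(3)[OF f]])
    then show "(\<lambda>x. w x $ i * weak_deriv i f x) \<in> L2_torus" .
  qed (simp add: L2_norm_zero)
qed

text \<open>For smooth \<open>f\<close> and \<open>g\<close> the sum is the integral of \<open>w \<cdot> \<nabla>(f g)\<close>, which vanishes when tested against the
  divergence; for general ones the Fourier projections converge in \<open>H\<^sup>1\<close> and the field is bounded.\<close>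

lemma advection_skew:
  assumes div: "AE x in torus. (\<Sum>i\<in>UNIV. weak_deriv i (\<lambda>y. w y $ i) x) = 0"
    and f: "f \<in> H1_torus" and g: "g \<in> H1_torus"
  shows "advection w f g + advection w g f = 0"
proof -
  define S where "S p q = (\<Sum>i\<in>UNIV. ip (\<lambda>x. w x $ i * partial_deriv i p x) q
      + ip (\<lambda>x. w x $ i * partial_deriv i q x) p)" for p q
  have S: "S p q = 0" if p: "trig_poly p" and q: "trig_poly q" for p q
  proof -
    have pq: "trig_poly (\<lambda>x. p x * q x)" by (rule trig_poly_mult[OF p q])
    have "ip (\<lambda>x. w x $ i * partial_deriv i p x) q + ip (\<lambda>x. w x $ i * partial_deriv i q x) p
        = - (LINT x|torus. weak_deriv i (\<lambda>y. w y $ i) x * (p x * q x))" for i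
    proof -
      have "integrable torus (\<lambda>x. w x $ i * partial_deriv i p x * q x)"
        "integrable torus (\<lambda>x. w x $ i * partial_deriv i q x * p x)"
        by (intro integrable_L2_mult L2_torus_bounded_mult(1)[OF velocity(1-4)] L2_torus_trig_poly
            trig_poly_partial_deriv p q)+
      then have "ip (\<lambda>x. w x $ i * partial_deriv i p x) q + ip (\<lambda>x. w x $ i * partial_deriv i q x) p
          = (LINT x|torus. w x $ i * partial_deriv i (\<lambda>x. p x * q x) x)"
        unfolding ip_def
        by (subst Bochner_Integration.integral_add[symmetric])
          (auto simp: partial_deriv_mult trig_poly_differentiable p q algebra_simps)
      also have "\<dots> = - (LINT x|torus. weak_deriv i (\<lambda>y. w y $ i) x * (p x * q x))"
        by (intro has_weak_derivD(3)[OF velocity(5)] trig_poly_smooth trig_poly_periodic pq)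
      finally show ?thesis .
    qed
    then have "S p q = (\<Sum>i\<in>UNIV. - (LINT x|torus. weak_deriv i (\<lambda>y. w y $ i) x * (p x * q x)))"
      by (simp add: S_def)
    also have "\<dots> = - (LINT x|torus. (\<Sum>i\<in>UNIV. weak_deriv i (\<lambda>y. w y $ i) x * (p x * q x)))"
      unfolding sum_negf
      by (subst Bochner_Integration.integral_sum)
        (auto intro: integrable_mult_continuous[OF L1_torusD(4)[OF has_weak_derivD(2)[OF velocity(5)]]
            trig_poly_continuous[OF pq]])
    also have "(LINT x|torus. (\<Sum>i\<in>UNIV. weak_deriv i (\<lambda>y. w y $ i) x * (p x * q x))) = 0"
      unfolding sum_distrib_right[symmetric]
      by (rule integral_eq_zero_AE) (use div in \<open>auto elim!: eventually_mono\<close>)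
    finally show ?thesis by simp
  qed
  have "(\<lambda>N. S (proj N f) (proj N g)) \<longlonglongrightarrow> (\<Sum>i\<in>UNIV. ip (\<lambda>x. w x $ i * weak_deriv i f x) g
      + ip (\<lambda>x. w x $ i * weak_deriv i g x) f)"
  proof -
    have "(\<lambda>N. ip (\<lambda>x. w x $ i * partial_deriv i (proj N p) x) (proj N q))
        \<longlonglongrightarrow> ip (\<lambda>x. w x $ i * weak_deriv i p x) q" if p: "p \<in> H1_torus" and q: "q \<in> H1_torus" for i p q
    proof (rule tendsto_ip[OF _ _ L2_torus_proj H1_torusD(1)[OF q] _ proj_tendsto[OF H1_torusD(1)[OF q]]])
      have P: "partial_deriv i (proj N p) \<in> L2_torus" for N
        by (intro L2_torus_trig_poly trig_poly_partial_deriv trig_poly_proj)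
      show "(\<lambda>x. w x $ i * partial_deriv i (proj N p) x) \<in> L2_torus" for N
        by (rule L2_torus_bounded_mult(1)[OF velocity(1-4) P])
      show "(\<lambda>x. w x $ i * weak_deriv i p x) \<in> L2_torus"
        by (rule L2_torus_bounded_mult(1)[OF velocity(1-4) H1_torusD(3)[OF p]])
      show "(\<lambda>N. L2_norm (\<lambda>x. w x $ i * partial_deriv i (proj N p) x - w x $ i * weak_deriv i p x)) \<longlonglongrightarrow> 0"
        by (rule tendsto_bounded_mult[OF velocity(1-4) H1_torusD(3)[OF p] P proj_weak_deriv_tendsto[OF p]])
    qed
    from this[OF f g] this[OF g f] show ?thesis unfolding S_def by (intro tendsto_sum tendsto_add)
  qed
  then show ?thesis
    using S[OF trig_poly_proj trig_poly_proj]
    by (simp add: LIMSEQ_const_iff advection_def sum.distrib)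
qed

text \<open>Summing the weak formulations for the individual waves with the coefficients of \<open>g\<close> amounts to
  testing with the projection of \<open>g\<close>. This is how a solution gets tested with a function that depends
  on time.\<close>

lemma weak_form_wave_sum:
  assumes f: "f \<in> H1_torus" and g: "g \<in> H1_torus"
  shows "(1 / vol TYPE('n)) * (\<Sum>k\<in>freqs_upto N. coeff_cos g k * weak_form \<kappa> w f (cos_wave k)
        + coeff_sin g k * weak_form \<kappa> w f (sin_wave k))
    = advection w f (proj N g) + \<kappa> * (\<Sum>i\<in>UNIV. ip (weak_deriv i f) (proj N (weak_deriv i g)))"
    (is "?c * _ = _")
proof -
  note df = H1_torusD[OF f] and dg = H1_torusD[OF g]
  have F: "(\<lambda>x. w x $ i * weak_deriv i f x) \<in> L2_torus" for i
    by (intro L2_torus_bounded_mult(1)[OF velocity(1-4)] df)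
  have grad: "grad_ip f (cos_wave k) = (\<Sum>i\<in>UNIV. - (k $ i) * coeff_sin (weak_deriv i f) k)"
    "grad_ip f (sin_wave k) = (\<Sum>i\<in>UNIV. k $ i * coeff_cos (weak_deriv i f) k)"
    if k: "k \<in> freqs" for k
  proof -
    have t: "trig_poly (cos_wave k)" "trig_poly (sin_wave k)" using k by (auto intro: trig_poly.intros)
    have "ip (weak_deriv i f) (weak_deriv i p) = ip (weak_deriv i f) (partial_deriv i p)" if p: "trig_poly p" for i p
      by (rule ip_cong_AE[OF _ weak_deriv_AE_eq[OF has_weak_deriv_trig_poly[OF p]] L2_torusD(3)[OF df(3)]
            L2_torusD(3)[OF df(3)] L2_torusD(3)[OF H1_torusD(3)[OF H1_torus_trig_poly[OF p]]]
            L2_torusD(3)[OF L2_torus_trig_poly[OF trig_poly_partial_deriv[OF p]]]]) simp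
    from this[OF t(1)] this[OF t(2)]
    show "grad_ip f (cos_wave k) = (\<Sum>i\<in>UNIV. - (k $ i) * coeff_sin (weak_deriv i f) k)"
      "grad_ip f (sin_wave k) = (\<Sum>i\<in>UNIV. k $ i * coeff_cos (weak_deriv i f) k)"
      unfolding grad_ip_def partial_deriv_waves coeff_sin_def coeff_cos_def ip_scale_right by simp_all
  qed
  have "?c * (\<Sum>k\<in>freqs_upto N. coeff_cos g k * weak_form \<kappa> w f (cos_wave k)
        + coeff_sin g k * weak_form \<kappa> w f (sin_wave k))
    = ?c * (\<Sum>k\<in>freqs_upto N. \<Sum>i\<in>UNIV.
          coeff_cos g k * coeff_cos (\<lambda>x. w x $ i * weak_deriv i f x) k
        + coeff_sin g k * coeff_sin (\<lambda>x. w x $ i * weak_deriv i f x) k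
        + \<kappa> * (coeff_cos (weak_deriv i g) k * coeff_cos (weak_deriv i f) k
          + coeff_sin (weak_deriv i g) k * coeff_sin (weak_deriv i f) k))"
  proof (intro arg_cong[where f="\<lambda>s. ?c * s"] sum.cong refl)
    fix k :: "real ^ 'n" assume "k \<in> freqs_upto N"
    then have k: "k \<in> freqs" by (rule freqs_upto_freqs)
    have t: "cos_wave k \<in> H1_torus" "sin_wave k \<in> H1_torus"
      using k by (auto intro: H1_torus_trig_poly trig_poly.intros)
    show "coeff_cos g k * weak_form \<kappa> w f (cos_wave k) + coeff_sin g k * weak_form \<kappa> w f (sin_wave k)
      = (\<Sum>i\<in>UNIV. coeff_cos g k * coeff_cos (\<lambda>x. w x $ i * weak_deriv i f x) k
        + coeff_sin g k * coeff_sin (\<lambda>x. w x $ i * weak_deriv i f x) k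
        + \<kappa> * (coeff_cos (weak_deriv i g) k * coeff_cos (weak_deriv i f) k
          + coeff_sin (weak_deriv i g) k * coeff_sin (weak_deriv i f) k))"
      unfolding weak_form_eq[OF f t(1)] weak_form_eq[OF f t(2)] grad[OF k]
        coeff_weak_deriv[OF dg(2) k] advection_def coeff_cos_def[symmetric] coeff_sin_def[symmetric]
      by (simp add: sum.distrib sum_distrib_left sum_negf sum_subtractf algebra_simps)
  qed
  also have "\<dots> = (\<Sum>i\<in>UNIV. ip (\<lambda>x. w x $ i * weak_deriv i f x) (proj N g)
      + \<kappa> * ip (weak_deriv i f) (proj N (weak_deriv i g)))"
    unfolding ip_proj[OF F] ip_proj[OF df(3)]
    by (subst sum.swap) (simp add: sum.distrib sum_distrib_left algebra_simps)
  finally show ?thesis by (simp add: advection_def sum.distrib sum_distrib_left)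
qed

end

section \<open>Pairing two solutions\<close>

text \<open>The product of the two integrals is an integral over a square. Fubini's theorem on the two
  triangles cut off by the diagonal gives the two summands; the diagonal is a null set.\<close>

lemma integral_product_by_parts:
  fixes \<alpha> \<beta> :: "real \<Rightarrow> real"
  assumes \<alpha>: "integrable (lebesgue_on {0..t}) \<alpha>" and \<beta>: "integrable (lebesgue_on {0..t}) \<beta>"
  defines "A \<equiv> \<lambda>s. LINT r|lebesgue_on {0..t}. indicator {..s} r * \<alpha> r"
    and "B \<equiv> \<lambda>s. LINT r|lebesgue_on {0..t}. indicator {..s} r * \<beta> r"
  shows "integrable (lebesgue_on {0..t}) (\<lambda>s. \<alpha> s * B s + A s * \<beta> s)"
    "(LINT s|lebesgue_on {0..t}. \<alpha> s * B s + A s * \<beta> s)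
      = (LINT s|lebesgue_on {0..t}. \<alpha> s) * (LINT s|lebesgue_on {0..t}. \<beta> s)"
proof -
  let ?M = "lebesgue_on {0..t}"
  interpret M: finite_measure ?M by (rule finite_measure_lebesgue_on) simp
  interpret pair_sigma_finite ?M ?M ..
  have [measurable]: "\<alpha> \<in> borel_measurable ?M" "\<beta> \<in> borel_measurable ?M" using \<alpha> \<beta> by auto
  have id[measurable]: "(\<lambda>x. x) \<in> borel_measurable ?M"
    by (intro measurable_restrict_space1 measurable_completion) simp
  have F: "integrable (?M \<Otimes>\<^sub>M ?M) (\<lambda>(s, r). \<alpha> s * \<beta> r)"
  proof (rule Fubini_integrable)
    show "integrable ?M (\<lambda>s. LINT r|?M. norm (case (s, r) of (s, r) \<Rightarrow> \<alpha> s * \<beta> r))"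
      using \<alpha> by (simp add: abs_mult)
    show "AE s in ?M. integrable ?M (\<lambda>r. case (s, r) of (s, r) \<Rightarrow> \<alpha> s * \<beta> r)"
      using \<beta> by simp
  qed measurable
  define G where "G s r = indicator {..s} r * (\<alpha> s * \<beta> r)" for s r
  define H where "H s r = indicator {..<r} s * (\<alpha> s * \<beta> r)" for s r
  have GH: "integrable (?M \<Otimes>\<^sub>M ?M) (\<lambda>(s, r). G s r)" "integrable (?M \<Otimes>\<^sub>M ?M) (\<lambda>(s, r). H s r)"
  proof -
    have "(\<lambda>(s, r). G s r) = (\<lambda>p. (if snd p \<le> fst p then 1 else 0) * (case p of (s, r) \<Rightarrow> \<alpha> s * \<beta> r))"
      by (auto simp: G_def indicator_def)
    moreover have "integrable (?M \<Otimes>\<^sub>M ?M) \<dots>"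
      by (rule Bochner_Integration.integrable_bound[OF F]) auto
    ultimately show "integrable (?M \<Otimes>\<^sub>M ?M) (\<lambda>(s, r). G s r)" by simp
    have "(\<lambda>(s, r). H s r) = (\<lambda>p. (if fst p < snd p then 1 else 0) * (case p of (s, r) \<Rightarrow> \<alpha> s * \<beta> r))"
      by (auto simp: H_def indicator_def)
    moreover have "integrable (?M \<Otimes>\<^sub>M ?M) \<dots>"
      by (rule Bochner_Integration.integrable_bound[OF F]) auto
    ultimately show "integrable (?M \<Otimes>\<^sub>M ?M) (\<lambda>(s, r). H s r)" by simp
  qed
  have G: "(LINT r|?M. G s r) = \<alpha> s * B s" for s
  proof -
    have "(LINT r|?M. G s r) = (LINT r|?M. \<alpha> s * (indicator {..s} r * \<beta> r))"
      unfolding G_def by (simp only: ac_simps)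
    then show ?thesis by (simp add: B_def)
  qed
  have H: "(LINT s|?M. H s r) = A r * \<beta> r" for r
  proof -
    have "(LINT s|?M. H s r) = (LINT s|?M. \<beta> r * (indicator {..<r} s * \<alpha> s))"
      unfolding H_def by (simp only: ac_simps)
    also have "\<dots> = \<beta> r * (LINT s|?M. indicator {..<r} s * \<alpha> s)" by simp
    also have "(LINT s|?M. indicator {..<r} s * \<alpha> s) = A r"
      unfolding A_def
    proof (rule integral_cong_AE)
      have "AE s in lebesgue. s \<noteq> r"
        by (rule AE_I'[of "{r}"]) (auto simp: negligible_iff_null_sets[symmetric])
      then have "AE s in ?M. s \<noteq> r" by (auto simp: AE_restrict_space_iff elim!: eventually_mono)
      then show "AE s in ?M. indicator {..<r} s * \<alpha> s = indicator {..r} s * \<alpha> s"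
        by eventually_elim (auto simp: indicator_def)
    qed measurable
    finally show ?thesis by simp
  qed
  have iG: "integrable ?M (\<lambda>s. \<alpha> s * B s)" using integrable_fst[OF GH(1)] by (simp add: G)
  have iH: "integrable ?M (\<lambda>s. A s * \<beta> s)" using integrable_snd[OF GH(2)] by (simp add: H)
  show "integrable ?M (\<lambda>s. \<alpha> s * B s + A s * \<beta> s)" using iG iH by simp
  have "(LINT s|?M. \<alpha> s * B s + A s * \<beta> s) = (LINT s|?M. \<alpha> s * B s) + (LINT s|?M. A s * \<beta> s)"
    using iG iH by simp
  also have "(LINT s|?M. \<alpha> s * B s) = integral\<^sup>L (?M \<Otimes>\<^sub>M ?M) (\<lambda>(s, r). G s r)"
    using integral_fst[OF GH(1)] by (simp add: G)
  also have "(LINT s|?M. A s * \<beta> s) = integral\<^sup>L (?M \<Otimes>\<^sub>M ?M) (\<lambda>(s, r). H s r)"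
    using integral_snd[OF GH(2)] by (simp add: H)
  also have "integral\<^sup>L (?M \<Otimes>\<^sub>M ?M) (\<lambda>(s, r). G s r) + integral\<^sup>L (?M \<Otimes>\<^sub>M ?M) (\<lambda>(s, r). H s r)
      = integral\<^sup>L (?M \<Otimes>\<^sub>M ?M) (\<lambda>p. (case p of (s, r) \<Rightarrow> G s r) + (case p of (s, r) \<Rightarrow> H s r))"
    by (rule Bochner_Integration.integral_add[symmetric, OF GH])
  also have "\<dots> = integral\<^sup>L (?M \<Otimes>\<^sub>M ?M) (\<lambda>(s, r). \<alpha> s * \<beta> r)"
    by (intro Bochner_Integration.integral_cong) (auto simp: G_def H_def indicator_def)
  also have "\<dots> = (LINT s|?M. LINT r|?M. \<alpha> s * \<beta> r)"
    using integral_fst[OF F] by simp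
  also have "\<dots> = (LINT s|?M. \<alpha> s) * (LINT s|?M. \<beta> s)" by simp
  finally show "(LINT s|?M. \<alpha> s * B s + A s * \<beta> s) = (LINT s|?M. \<alpha> s) * (LINT s|?M. \<beta> s)" .
qed

text \<open>The product rule for absolutely continuous functions, in the form in which the weak formulation
  provides them: as integrals.\<close>

lemma product_rule_integrated:
  fixes a b \<alpha> \<beta> :: "real \<Rightarrow> real"
  assumes t: "0 \<le> t"
    and \<alpha>: "integrable (lebesgue_on {0..t}) \<alpha>" and \<beta>: "integrable (lebesgue_on {0..t}) \<beta>"
    and a: "\<And>s. s \<in> {0..t} \<Longrightarrow> a s = a0 - (LINT r:{0..s}|lebesgue. \<alpha> r)"
    and b: "\<And>s. s \<in> {0..t} \<Longrightarrow> b s = b0 - (LINT r:{0..s}|lebesgue. \<beta> r)"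
  shows "integrable (lebesgue_on {0..t}) (\<lambda>s. \<alpha> s * b s + a s * \<beta> s)"
    "a t * b t = a0 * b0 - (LINT s|lebesgue_on {0..t}. \<alpha> s * b s + a s * \<beta> s)"
proof -
  let ?M = "lebesgue_on {0..t}"
  define A B where "A s = (LINT r|?M. indicator {..s} r * \<alpha> r)"
    and "B s = (LINT r|?M. indicator {..s} r * \<beta> r)" for s
  have sub: "(LINT r:{0..s}|lebesgue. f r) = (LINT r|?M. indicator {..s} r * f r)" if "s \<in> {0..t}"
    for s and f :: "real \<Rightarrow> real"
    unfolding set_lebesgue_integral_def using that
    by (subst integral_restrict_space) (auto intro!: Bochner_Integration.integral_cong simp: indicator_def)
  have a': "a s = a0 - A s" if "s \<in> {0..t}" for s using a[OF that] sub[OF that] by (simp add: A_def)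
  have b': "b s = b0 - B s" if "s \<in> {0..t}" for s using b[OF that] sub[OF that] by (simp add: B_def)
  note bp = integral_product_by_parts[OF \<alpha> \<beta>, folded A_def B_def]
  have eq: "\<alpha> s * b s + a s * \<beta> s = (\<alpha> s * b0 + a0 * \<beta> s) - (\<alpha> s * B s + A s * \<beta> s)" if "s \<in> space ?M" for s
  proof -
    have "s \<in> {0..t}" using that by (simp add: space_restrict_space)
    then show ?thesis unfolding a'[OF \<open>s \<in> {0..t}\<close>] b'[OF \<open>s \<in> {0..t}\<close>] by (simp add: algebra_simps)
  qed
  have i1: "integrable ?M (\<lambda>s. \<alpha> s * b0 + a0 * \<beta> s)" using \<alpha> \<beta> by simp
  show "integrable ?M (\<lambda>s. \<alpha> s * b s + a s * \<beta> s)"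
    using Bochner_Integration.integrable_diff[OF i1 bp(1)]
    by (subst Bochner_Integration.integrable_cong[OF refl eq])
  have "(LINT s|?M. \<alpha> s * b s + a s * \<beta> s)
      = (LINT s|?M. (\<alpha> s * b0 + a0 * \<beta> s) - (\<alpha> s * B s + A s * \<beta> s))"
    by (rule Bochner_Integration.integral_cong[OF refl eq])
  also have "\<dots> = (LINT s|?M. \<alpha> s) * b0 + a0 * (LINT s|?M. \<beta> s)
      - (LINT s|?M. \<alpha> s) * (LINT s|?M. \<beta> s)"
    using \<alpha> \<beta> by (simp add: Bochner_Integration.integral_diff[OF i1 bp(1)] bp(2))
  finally have I: "(LINT s|?M. \<alpha> s * b s + a s * \<beta> s) = (LINT s|?M. \<alpha> s) * b0 + a0 * (LINT s|?M. \<beta> s)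
      - (LINT s|?M. \<alpha> s) * (LINT s|?M. \<beta> s)" .
  have "A t = (LINT s|?M. \<alpha> s)" "B t = (LINT s|?M. \<beta> s)"
    unfolding A_def B_def
    by (auto intro!: Bochner_Integration.integral_cong simp: indicator_def space_restrict_space)
  then have "a t = a0 - (LINT s|?M. \<alpha> s)" "b t = b0 - (LINT s|?M. \<beta> s)"
    using a'[of t] b'[of t] t by simp_all
  then show "a t * b t = a0 * b0 - (LINT s|?M. \<alpha> s * b s + a s * \<beta> s)"
    unfolding I by (simp only:) (simp add: algebra_simps)
qed

text \<open>A real-valued version of the squared gradient norm. It is 0 where the norm is infinite, which for a
  solution happens at a null set of times only.\<close>

definition dissipation :: "(real \<Rightarrow> real ^ 'n \<Rightarrow> real) \<Rightarrow> real \<Rightarrow> real" where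
  "dissipation \<theta> s = enn2real ((Hdot1_norm (\<theta> s))\<^sup>2)"

lemma dissipation_nonneg: "0 \<le> dissipation \<theta> s"
  by (simp add: dissipation_def)

lemma dissipation_H1: "\<theta> s \<in> H1_torus \<Longrightarrow> dissipation \<theta> s = grad_sq (\<theta> s)"
  by (simp add: dissipation_def Hdot1_norm_sq_H1 grad_sq_nonneg)

context
  fixes T :: real and \<theta> :: "real \<Rightarrow> real ^ 'n \<Rightarrow> real"
  assumes cont: "continuous_in_L2 T \<theta>"
begin

lemma continuous_in_L2_L2: "t \<in> {0..<T} \<Longrightarrow> \<theta> t \<in> L2_torus"
  using cont by (auto simp: continuous_in_L2_def)

lemma continuous_on_ip:
  assumes g: "g \<in> L2_torus"
  shows "continuous_on {0..<T} (\<lambda>t. ip (\<theta> t) g)"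
  unfolding continuous_on_def
proof
  fix t assume t: "t \<in> {0..<T}"
  have lim: "((\<lambda>s. L2_norm (\<lambda>x. \<theta> s x - \<theta> t x) * L2_norm g) \<longlongrightarrow> 0) (at t within {0..<T})"
    using cont t by (auto simp: continuous_in_L2_def intro: tendsto_mult_left_zero)
  have "((\<lambda>s. ip (\<theta> s) g - ip (\<theta> t) g) \<longlongrightarrow> 0) (at t within {0..<T})"
  proof (rule Lim_null_comparison[OF _ lim])
    show "\<forall>\<^sub>F s in at t within {0..<T}. norm (ip (\<theta> s) g - ip (\<theta> t) g)
        \<le> L2_norm (\<lambda>x. \<theta> s x - \<theta> t x) * L2_norm g"
      unfolding eventually_at_filter
    proof (intro always_eventually allI impI)
      fix s assume "s \<in> {0..<T}"
      then show "norm (ip (\<theta> s) g - ip (\<theta> t) g) \<le> L2_norm (\<lambda>x. \<theta> s x - \<theta> t x) * L2_norm g"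
        using continuous_in_L2_L2[of s] continuous_in_L2_L2[OF t] g
          Cauchy_Schwarz_L2[OF L2_torus_diff g, of "\<theta> s" "\<theta> t"]
        by (simp add: ip_diff_left)
    qed
  qed
  then show "((\<lambda>s. ip (\<theta> s) g) \<longlongrightarrow> ip (\<theta> t) g) (at t within {0..<T})" by (rule LIM_zero_cancel)
qed

lemma continuous_on_L2_norm: "continuous_on {0..<T} (\<lambda>t. L2_norm (\<theta> t))"
  unfolding continuous_on_def
proof
  fix t assume t: "t \<in> {0..<T}"
  have lim: "((\<lambda>s. L2_norm (\<lambda>x. \<theta> s x - \<theta> t x)) \<longlongrightarrow> 0) (at t within {0..<T})"
    using cont t by (auto simp: continuous_in_L2_def)
  have "((\<lambda>s. L2_norm (\<theta> s) - L2_norm (\<theta> t)) \<longlongrightarrow> 0) (at t within {0..<T})"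
  proof (rule Lim_null_comparison[OF _ lim])
    show "\<forall>\<^sub>F s in at t within {0..<T}. norm (L2_norm (\<theta> s) - L2_norm (\<theta> t))
        \<le> L2_norm (\<lambda>x. \<theta> s x - \<theta> t x)"
      unfolding eventually_at_filter
      using L2_norm_diff_triangle[OF continuous_in_L2_L2 continuous_in_L2_L2[OF t]]
      by (intro always_eventually) auto
  qed
  then show "((\<lambda>s. L2_norm (\<theta> s)) \<longlongrightarrow> L2_norm (\<theta> t)) (at t within {0..<T})" by (rule LIM_zero_cancel)
qed

lemma measurable_Hdot1_norm_sq:
  assumes \<tau>: "\<tau> \<in> {0..<T}"
  shows "(\<lambda>t. (Hdot1_norm (\<theta> t))\<^sup>2) \<in> borel_measurable (lebesgue_on {0..\<tau>})"
proof -
  have sub: "{0..\<tau>} \<subseteq> {0..<T}" using \<tau> by auto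
  have "continuous_on {0..\<tau>} (\<lambda>t. grad_energy_upto N (\<theta> t))" for N
  proof -
    have "continuous_on {0..\<tau>} (\<lambda>t. coeff_cos (\<theta> t) k)" "continuous_on {0..\<tau>} (\<lambda>t. coeff_sin (\<theta> t) k)"
      if "k \<in> freqs" for k
      unfolding coeff_cos_def coeff_sin_def
      using continuous_on_ip[OF L2_waves(1)[OF that]] continuous_on_ip[OF L2_waves(2)[OF that]]
      by (auto intro: continuous_on_subset[OF _ sub])
    then show ?thesis
      unfolding grad_energy_upto_def energy_upto_def
      by (intro continuous_intros) (auto simp: freqs_upto_freqs)
  qed
  then have "(\<lambda>t. grad_energy_upto N (\<theta> t)) \<in> borel_measurable (lebesgue_on {0..\<tau>})" for N
    by (intro continuous_imp_measurable_on_sets_lebesgue) auto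
  then have "(\<lambda>t. SUP N. ennreal (grad_energy_upto N (\<theta> t))) \<in> borel_measurable (lebesgue_on {0..\<tau>})"
    by (intro borel_measurable_SUP) auto
  then show ?thesis
    by (subst measurable_cong[OF Hdot1_norm_sq_eq_SUP[OF continuous_in_L2_L2]])
      (use sub in \<open>auto simp: space_restrict_space\<close>)
qed

lemma integrable_L2_norm_sq:
  assumes \<tau>: "\<tau> \<in> {0..<T}"
  shows "integrable (lebesgue_on {0..\<tau>}) (\<lambda>t. (L2_norm (\<theta> t))\<^sup>2)"
  using \<tau> by (intro continuous_imp_integrable_real continuous_intros
      continuous_on_subset[OF continuous_on_L2_norm]) auto

end

lemma solutionD:
  assumes "advection_diffusion_solution T \<kappa> u \<theta>0 \<theta>"
  shows "continuous_in_L2 T \<theta>"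
    "\<tau> \<in> {0..<T} \<Longrightarrow> (\<integral>\<^sup>+t\<in>{0..\<tau>}. (Hdot1_norm (\<theta> t))\<^sup>2 \<partial>lebesgue) < \<infinity>"
    "v \<in> H1_torus \<Longrightarrow> t \<in> {0..<T} \<Longrightarrow> set_integrable lebesgue {0..t} (\<lambda>s. weak_form \<kappa> (u s) (\<theta> s) v)"
    "v \<in> H1_torus \<Longrightarrow> t \<in> {0..<T} \<Longrightarrow>
      ip (\<theta> t) v = ip \<theta>0 v - (LINT s:{0..t}|lebesgue. weak_form \<kappa> (u s) (\<theta> s) v)"
  using assms by (auto simp: advection_diffusion_solution_def ip_def algebra_simps)

text \<open>The nonnegative integral in the definition of solutions bounds the norm at almost every time only
  because the norm is measurable in time; otherwise it would be merely a lower integral.\<close>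

lemma solution_dissipation:
  assumes sol: "advection_diffusion_solution T \<kappa> u \<theta>0 \<theta>" and \<tau>: "\<tau> \<in> {0..<T}"
  shows "AE s in lebesgue_on {0..\<tau>}. \<theta> s \<in> H1_torus"
    "integrable (lebesgue_on {0..\<tau>}) (dissipation \<theta>)"
    "(\<integral>\<^sup>+t\<in>{0..\<tau>}. (Hdot1_norm (\<theta> t))\<^sup>2 \<partial>lebesgue)
      = ennreal (LINT s|lebesgue_on {0..\<tau>}. dissipation \<theta> s)"
proof -
  let ?M = "lebesgue_on {0..\<tau>}"
  note m[measurable] = measurable_Hdot1_norm_sq[OF solutionD(1)[OF sol] \<tau>]
  have eq: "(\<integral>\<^sup>+t\<in>{0..\<tau>}. (Hdot1_norm (\<theta> t))\<^sup>2 \<partial>lebesgue) = (\<integral>\<^sup>+t. (Hdot1_norm (\<theta> t))\<^sup>2 \<partial>?M)"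
    by (simp add: nn_integral_restrict_space)
  then have fin: "(\<integral>\<^sup>+t. (Hdot1_norm (\<theta> t))\<^sup>2 \<partial>?M) < \<infinity>" using solutionD(2)[OF sol \<tau>] by simp
  then have ae: "AE s in ?M. (Hdot1_norm (\<theta> s))\<^sup>2 \<noteq> \<infinity>"
    by (intro nn_integral_PInf_AE m) auto
  then show "AE s in ?M. \<theta> s \<in> H1_torus"
    by eventually_elim (auto simp: Hdot1_norm_def power2_eq_square split: if_splits)
  have eq2: "(\<integral>\<^sup>+t. (Hdot1_norm (\<theta> t))\<^sup>2 \<partial>?M) = (\<integral>\<^sup>+t. ennreal (dissipation \<theta> t) \<partial>?M)"
    by (rule nn_integral_cong_AE)
      (use ae in \<open>auto elim!: eventually_mono simp: dissipation_def ennreal_enn2real_if\<close>)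
  have [measurable]: "dissipation \<theta> \<in> borel_measurable ?M"
    unfolding dissipation_def[abs_def] by measurable
  show int: "integrable ?M (dissipation \<theta>)"
    using fin unfolding eq2 by (intro integrableI_nonneg) (auto simp: dissipation_nonneg)
  show "(\<integral>\<^sup>+t\<in>{0..\<tau>}. (Hdot1_norm (\<theta> t))\<^sup>2 \<partial>lebesgue) = ennreal (LINT s|?M. dissipation \<theta> s)"
    unfolding eq eq2 by (rule nn_integral_eq_integral[OF int]) (simp add: dissipation_nonneg)
qed

lemma velocity_AE:
  fixes u :: "real \<Rightarrow> real ^ 'n \<Rightarrow> real ^ 'n"
  assumes u: "u \<in> Linf_loc_W1inf T" and div: "divergence_free T u" and \<tau>: "\<tau> \<in> {0..<T}"
  obtains M where "AE s in lebesgue_on {0..\<tau>}. (\<forall>i. W1inf_le M (\<lambda>x. u s x $ i)) \<and>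
    (AE x in torus. (\<Sum>i\<in>UNIV. weak_deriv i (\<lambda>y. u s y $ i) x) = 0)"
proof -
  obtain M where M: "AE s in lebesgue_on {0..\<tau>}. \<forall>i. W1inf_le M (\<lambda>x. u s x $ i)"
    using u \<tau> unfolding Linf_loc_W1inf_def by blast
  have "AE s in lebesgue_on {0..\<tau>}. AE x in torus. (\<Sum>i\<in>UNIV. weak_deriv i (\<lambda>y. u s y $ i) x) = 0"
    using div \<tau> unfolding divergence_free_def
    by (auto simp: AE_restrict_space_iff elim!: eventually_mono)
  with M show ?thesis by (intro that) (rule AE_conjI)
qed

lemma grad_ip_proj_le:
  assumes f: "f \<in> H1_torus" and g: "g \<in> H1_torus"
  shows "\<bar>\<Sum>i\<in>UNIV. ip (weak_deriv i f) (proj N (weak_deriv i g))\<bar> \<le> grad_sq f + grad_sq g"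
proof -
  have "\<bar>ip (weak_deriv i f) (proj N (weak_deriv i g))\<bar>
      \<le> (L2_norm (weak_deriv i f))\<^sup>2 + (L2_norm (weak_deriv i g))\<^sup>2" for i
  proof -
    have "\<bar>ip (weak_deriv i f) (proj N (weak_deriv i g))\<bar>
        \<le> L2_norm (weak_deriv i f) * L2_norm (proj N (weak_deriv i g))"
      by (rule Cauchy_Schwarz_L2[OF H1_torusD(3)[OF f] L2_torus_proj])
    also have "\<dots> \<le> L2_norm (weak_deriv i f) * L2_norm (weak_deriv i g)"
      by (rule mult_left_mono[OF L2_norm_proj_le[OF H1_torusD(3)[OF g]] L2_norm_nonneg])
    also have "\<dots> \<le> (L2_norm (weak_deriv i f))\<^sup>2 + (L2_norm (weak_deriv i g))\<^sup>2"
      using sum_squares_bound[of "L2_norm (weak_deriv i f)" "L2_norm (weak_deriv i g)"]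
        mult_nonneg_nonneg[OF L2_norm_nonneg[of "weak_deriv i f"] L2_norm_nonneg[of "weak_deriv i g"]]
      by linarith
    finally show ?thesis .
  qed
  then show ?thesis
    unfolding grad_sq_def sum.distrib[symmetric] by (intro order_trans[OF sum_abs] sum_mono)
qed

lemma tendsto_grad_ip_proj:
  assumes f: "f \<in> H1_torus" and g: "g \<in> H1_torus"
  shows "(\<lambda>N. \<Sum>i\<in>UNIV. ip (weak_deriv i f) (proj N (weak_deriv i g))) \<longlonglongrightarrow> grad_ip f g"
  unfolding grad_ip_def
proof (rule tendsto_sum)
  fix i
  show "(\<lambda>N. ip (weak_deriv i f) (proj N (weak_deriv i g))) \<longlonglongrightarrow> ip (weak_deriv i f) (weak_deriv i g)"
    by (rule tendsto_ip[OF H1_torusD(3)[OF f] H1_torusD(3)[OF f] L2_torus_proj H1_torusD(3)[OF g] _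
          proj_tendsto[OF H1_torusD(3)[OF g]]]) (simp add: L2_norm_zero)
qed

lemma tendsto_ip_proj:
  assumes "f \<in> L2_torus" "g \<in> L2_torus"
  shows "(\<lambda>N. ip f (proj N g)) \<longlonglongrightarrow> ip f g"
  by (rule tendsto_ip[OF assms(1) assms(1) L2_torus_proj assms(2) _ proj_tendsto[OF assms(2)]])
    (simp add: L2_norm_zero)

text \<open>For each frequency the product of the coefficients of both solutions obeys the product rule; \<open>R N\<close>
  is the resulting rate of decay of the pairing of \<open>F\<close> with the truncation of \<open>G\<close> at \<open>N\<close>. At almost
  every time \<open>R N\<close> converges, the advection terms cancelling in the limit by skew-symmetry, and it is
  dominated by the energies of the solutions. The conclusion speaks of a function \<open>L\<close> that agrees with
  the limit almost everywhere, since at the exceptional times weak derivatives are arbitrary.\<close>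

lemma pairing_of_solutions:
  fixes u :: "real \<Rightarrow> real ^ 'n \<Rightarrow> real ^ 'n"
  assumes u: "u \<in> Linf_loc_W1inf T" and div: "divergence_free T u" and \<theta>0: "\<theta>0 \<in> L2_torus"
    and F: "advection_diffusion_solution T \<kappa>1 u \<theta>0 F"
    and G: "advection_diffusion_solution T \<kappa>2 u \<theta>0 G"
    and t: "t \<in> {0..<T}"
  obtains L where "integrable (lebesgue_on {0..t}) L"
    "AE s in lebesgue_on {0..t}. F s \<in> H1_torus \<and> G s \<in> H1_torus \<and> L s = (\<kappa>1 + \<kappa>2) * grad_ip (F s) (G s)"
    "ip (F t) (G t) = (L2_norm \<theta>0)\<^sup>2 - (LINT s|lebesgue_on {0..t}. L s)"
proof -
  let ?M = "lebesgue_on {0..t}" and ?c = "1 / vol TYPE('n)"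
  obtain M where M: "AE s in ?M. (\<forall>i. W1inf_le M (\<lambda>x. u s x $ i)) \<and>
    (AE x in torus. (\<Sum>i\<in>UNIV. weak_deriv i (\<lambda>y. u s y $ i) x) = 0)"
    using velocity_AE[OF u div t] by blast
  have good: "AE s in ?M. F s \<in> H1_torus \<and> G s \<in> H1_torus \<and> (\<forall>i. W1inf_le M (\<lambda>x. u s x $ i)) \<and>
    (AE x in torus. (\<Sum>i\<in>UNIV. weak_deriv i (\<lambda>y. u s y $ i) x) = 0)"
    using M solution_dissipation(1)[OF F t] solution_dissipation(1)[OF G t] by eventually_elim simp
  define \<alpha>c \<alpha>s where "\<alpha>c k s = weak_form \<kappa>1 (u s) (F s) (cos_wave k)"
    and "\<alpha>s k s = weak_form \<kappa>1 (u s) (F s) (sin_wave k)" for k s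
  define \<beta>c \<beta>s where "\<beta>c k s = weak_form \<kappa>2 (u s) (G s) (cos_wave k)"
    and "\<beta>s k s = weak_form \<kappa>2 (u s) (G s) (sin_wave k)" for k s
  define rate where "rate k s = (\<alpha>c k s * coeff_cos (G s) k + coeff_cos (F s) k * \<beta>c k s)
      + (\<alpha>s k s * coeff_sin (G s) k + coeff_sin (F s) k * \<beta>s k s)" for k s
  have rate: "integrable ?M (rate k)"
    "coeff_cos (F t) k * coeff_cos (G t) k + coeff_sin (F t) k * coeff_sin (G t) k
      = coeff_cos \<theta>0 k * coeff_cos \<theta>0 k + coeff_sin \<theta>0 k * coeff_sin \<theta>0 k - (LINT s|?M. rate k s)"
    if k: "k \<in> freqs" for k
  proof -
    have w: "cos_wave k \<in> H1_torus" "sin_wave k \<in> H1_torus"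
      using k by (auto intro: H1_torus_trig_poly trig_poly.intros)
    have int: "integrable ?M (\<alpha>c k)" "integrable ?M (\<alpha>s k)" "integrable ?M (\<beta>c k)" "integrable ?M (\<beta>s k)"
      using solutionD(3)[OF F w(1) t] solutionD(3)[OF F w(2) t] solutionD(3)[OF G w(1) t] solutionD(3)[OF G w(2) t]
      by (simp_all add: set_integrable_def integrable_restrict_space \<alpha>c_def[abs_def] \<alpha>s_def[abs_def]
          \<beta>c_def[abs_def] \<beta>s_def[abs_def])
    have ev: "coeff_cos (F s) k = coeff_cos \<theta>0 k - (LINT r:{0..s}|lebesgue. \<alpha>c k r)"
      "coeff_sin (F s) k = coeff_sin \<theta>0 k - (LINT r:{0..s}|lebesgue. \<alpha>s k r)"
      "coeff_cos (G s) k = coeff_cos \<theta>0 k - (LINT r:{0..s}|lebesgue. \<beta>c k r)"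
      "coeff_sin (G s) k = coeff_sin \<theta>0 k - (LINT r:{0..s}|lebesgue. \<beta>s k r)"
      if "s \<in> {0..t}" for s
    proof -
      have s: "s \<in> {0..<T}" using that t by auto
      show "coeff_cos (F s) k = coeff_cos \<theta>0 k - (LINT r:{0..s}|lebesgue. \<alpha>c k r)"
        "coeff_sin (F s) k = coeff_sin \<theta>0 k - (LINT r:{0..s}|lebesgue. \<alpha>s k r)"
        "coeff_cos (G s) k = coeff_cos \<theta>0 k - (LINT r:{0..s}|lebesgue. \<beta>c k r)"
        "coeff_sin (G s) k = coeff_sin \<theta>0 k - (LINT r:{0..s}|lebesgue. \<beta>s k r)"
        unfolding coeff_cos_def coeff_sin_def \<alpha>c_def \<alpha>s_def \<beta>c_def \<beta>s_def
        by (rule solutionD(4)[OF F w(1) s] solutionD(4)[OF F w(2) s]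
            solutionD(4)[OF G w(1) s] solutionD(4)[OF G w(2) s])+
    qed
    have t0: "0 \<le> t" using t by simp
    note p1 = product_rule_integrated[where a="\<lambda>s. coeff_cos (F s) k" and b="\<lambda>s. coeff_cos (G s) k",
        OF t0 int(1,3) ev(1,3)]
    note p2 = product_rule_integrated[where a="\<lambda>s. coeff_sin (F s) k" and b="\<lambda>s. coeff_sin (G s) k",
        OF t0 int(2,4) ev(2,4)]
    show "integrable ?M (rate k)" unfolding rate_def[abs_def] using p1(1) p2(1) by simp
    have "(LINT s|?M. rate k s) = (LINT s|?M. \<alpha>c k s * coeff_cos (G s) k + coeff_cos (F s) k * \<beta>c k s)
        + (LINT s|?M. \<alpha>s k s * coeff_sin (G s) k + coeff_sin (F s) k * \<beta>s k s)"
      unfolding rate_def by (rule Bochner_Integration.integral_add[OF p1(1) p2(1)])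
    then show "coeff_cos (F t) k * coeff_cos (G t) k + coeff_sin (F t) k * coeff_sin (G t) k
      = coeff_cos \<theta>0 k * coeff_cos \<theta>0 k + coeff_sin \<theta>0 k * coeff_sin \<theta>0 k - (LINT s|?M. rate k s)"
      using p1(2) p2(2) by simp
  qed
  define R where "R N s = ?c * (\<Sum>k\<in>freqs_upto N. rate k s)" for N s
  have F2: "F s \<in> L2_torus" and G2: "G s \<in> L2_torus" if "s \<in> {0..t}" for s
    using that t continuous_in_L2_L2[OF solutionD(1)[OF F]] continuous_in_L2_L2[OF solutionD(1)[OF G]] by auto
  have tt: "t \<in> {0..t}" using t by simp
  have intR: "integrable ?M (R N)" for N
    unfolding R_def[abs_def] using rate(1) by (auto simp: freqs_upto_freqs)
  have eqR: "ip (F t) (proj N (G t)) = ip \<theta>0 (proj N \<theta>0) - (LINT s|?M. R N s)" for N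
  proof -
    have "(LINT s|?M. R N s) = ?c * (\<Sum>k\<in>freqs_upto N. LINT s|?M. rate k s)"
      unfolding R_def using rate(1) by (simp add: freqs_upto_freqs)
    moreover have "ip (F t) (proj N (G t)) = ?c * (\<Sum>k\<in>freqs_upto N.
        (coeff_cos \<theta>0 k * coeff_cos \<theta>0 k + coeff_sin \<theta>0 k * coeff_sin \<theta>0 k) - (LINT s|?M. rate k s))"
      unfolding ip_proj[OF F2[OF tt]] using rate(2)
      by (intro arg_cong[where f="\<lambda>x. ?c * x"] sum.cong refl) (simp add: mult.commute freqs_upto_freqs)
    ultimately show ?thesis
      unfolding ip_proj[OF \<theta>0] by (simp add: sum_subtractf right_diff_distrib)
  qed
  have R_good: "R N s = (advection (u s) (F s) (proj N (G s))
        + \<kappa>1 * (\<Sum>i\<in>UNIV. ip (weak_deriv i (F s)) (proj N (weak_deriv i (G s)))))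
      + (advection (u s) (G s) (proj N (F s))
        + \<kappa>2 * (\<Sum>i\<in>UNIV. ip (weak_deriv i (G s)) (proj N (weak_deriv i (F s)))))"
    if FH: "F s \<in> H1_torus" and GH: "G s \<in> H1_torus" and w: "\<And>i. W1inf_le M (\<lambda>x. u s x $ i)" for N s
  proof -
    show ?thesis
      unfolding weak_form_wave_sum[OF w FH GH, symmetric] weak_form_wave_sum[OF w GH FH, symmetric]
        R_def rate_def \<alpha>c_def \<alpha>s_def \<beta>c_def \<beta>s_def distrib_left[symmetric] sum.distrib[symmetric]
      by (intro arg_cong[where f="\<lambda>x. ?c * x"] sum.cong) (auto simp: algebra_simps)
  qed
  define L where "L s = lim (\<lambda>N. R N s)" for s
  have conv: "AE s in ?M. (\<lambda>N. R N s) \<longlonglongrightarrow> (\<kappa>1 + \<kappa>2) * grad_ip (F s) (G s)"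
    using good
  proof eventually_elim
    case (elim s)
    then have FH: "F s \<in> H1_torus" and GH: "G s \<in> H1_torus" and w: "\<And>i. W1inf_le M (\<lambda>x. u s x $ i)"
      and d: "AE x in torus. (\<Sum>i\<in>UNIV. weak_deriv i (\<lambda>y. u s y $ i) x) = 0" by auto
    have "(\<lambda>N. R N s) \<longlonglongrightarrow> (advection (u s) (F s) (G s) + \<kappa>1 * grad_ip (F s) (G s))
        + (advection (u s) (G s) (F s) + \<kappa>2 * grad_ip (G s) (F s))"
      unfolding R_good[OF FH GH w]
      by (intro tendsto_add tendsto_mult tendsto_const tendsto_grad_ip_proj FH GH
          tendsto_advection[OF w FH H1_torusD(1)[OF GH]] tendsto_advection[OF w GH H1_torusD(1)[OF FH]])
    also have "grad_ip (G s) (F s) = grad_ip (F s) (G s)"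
      unfolding grad_ip_def by (intro sum.cong refl ip_commute)
    also have "(advection (u s) (F s) (G s) + \<kappa>1 * grad_ip (F s) (G s))
        + (advection (u s) (G s) (F s) + \<kappa>2 * grad_ip (F s) (G s)) = (\<kappa>1 + \<kappa>2) * grad_ip (F s) (G s)"
      using advection_skew[OF w d FH GH] by (simp add: algebra_simps)
    finally show ?case .
  qed
  have convL: "AE s in ?M. (\<lambda>N. R N s) \<longlonglongrightarrow> L s"
    using conv by eventually_elim (simp add: L_def limI)
  define W where "W s = M * (dissipation F s + real CARD('n) * (L2_norm (G s))\<^sup>2)
      + \<bar>\<kappa>1\<bar> * (dissipation F s + dissipation G s)
      + (M * (dissipation G s + real CARD('n) * (L2_norm (F s))\<^sup>2)
      + \<bar>\<kappa>2\<bar> * (dissipation G s + dissipation F s))" for s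
  have Wint: "integrable ?M W"
    unfolding W_def[abs_def]
    using solution_dissipation(2)[OF F t] solution_dissipation(2)[OF G t]
      integrable_L2_norm_sq[OF solutionD(1)[OF F] t] integrable_L2_norm_sq[OF solutionD(1)[OF G] t]
    by simp
  have dom: "AE s in ?M. norm (R N s) \<le> W s" for N
    using good
  proof eventually_elim
    case (elim s)
    then have FH: "F s \<in> H1_torus" and GH: "G s \<in> H1_torus" and w: "\<And>i. W1inf_le M (\<lambda>x. u s x $ i)" by auto
    have adv: "\<bar>advection (u s) f (proj N g)\<bar> \<le> M * (grad_sq f + real CARD('n) * (L2_norm g)\<^sup>2)"
      if f: "f \<in> H1_torus" and g: "g \<in> H1_torus" for f g
    proof -
      have "(L2_norm (proj N g))\<^sup>2 \<le> (L2_norm g)\<^sup>2"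
        by (intro power_mono L2_norm_proj_le H1_torusD(1) g L2_norm_nonneg)
      then have "M * (grad_sq f + real CARD('n) * (L2_norm (proj N g))\<^sup>2)
          \<le> M * (grad_sq f + real CARD('n) * (L2_norm g)\<^sup>2)"
        using velocity_bound_nonneg[OF w] by (intro mult_left_mono add_left_mono) auto
      with advection_le[OF w f L2_torus_proj] show ?thesis by (rule order_trans)
    qed
    have gr: "\<bar>\<kappa> * (\<Sum>i\<in>UNIV. ip (weak_deriv i f) (proj N (weak_deriv i g)))\<bar> \<le> \<bar>\<kappa>\<bar> * (grad_sq f + grad_sq g)"
      if f: "f \<in> H1_torus" and g: "g \<in> H1_torus" for f g \<kappa>
      unfolding abs_mult by (intro mult_left_mono grad_ip_proj_le f g abs_ge_zero)
    show ?case
      unfolding R_good[OF FH GH w] W_def dissipation_H1[of F, OF FH] dissipation_H1[of G, OF GH] real_norm_def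
      by (intro order_trans[OF abs_triangle_ineq] add_mono adv gr FH GH)
  qed
  have [measurable]: "R N \<in> borel_measurable ?M" for N using intR by auto
  have Lm: "L \<in> borel_measurable ?M" unfolding L_def[abs_def] by (rule borel_measurable_lim_metric) simp
  have intL: "integrable ?M L"
    by (rule integrable_dominated_convergence[OF Lm _ Wint convL dom]) simp
  have limL: "(\<lambda>N. LINT s|?M. R N s) \<longlonglongrightarrow> (LINT s|?M. L s)"
    by (rule integral_dominated_convergence[OF Lm _ Wint convL dom]) simp
  have lim: "(\<lambda>N. ip \<theta>0 (proj N \<theta>0) - (LINT s|?M. R N s)) \<longlonglongrightarrow> ip \<theta>0 \<theta>0 - (LINT s|?M. L s)"
    by (rule tendsto_diff[OF tendsto_ip_proj[OF \<theta>0 \<theta>0] limL])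
  have "ip (F t) (G t) = ip \<theta>0 \<theta>0 - (LINT s|?M. L s)"
    using LIMSEQ_unique[OF tendsto_ip_proj[OF F2[OF tt] G2[OF tt]]] lim unfolding eqR by blast
  moreover have "AE s in ?M. F s \<in> H1_torus \<and> G s \<in> H1_torus \<and> L s = (\<kappa>1 + \<kappa>2) * grad_ip (F s) (G s)"
    using conv convL good by eventually_elim (auto intro: LIMSEQ_unique)
  ultimately show ?thesis using intL by (intro that[of L]) (auto simp: L2_norm_sq)
qed

section \<open>Duality\<close>

lemma weak_deriv_scale_AE:
  assumes "f \<in> H1_torus"
  shows "AE x in torus. weak_deriv i (\<lambda>x. c * f x) x = c * weak_deriv i f x"
  by (rule weak_deriv_AE_eq[OF has_weak_deriv_scale[OF H1_torusD(2)[OF assms]]])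

lemma H1_torus_scale:
  assumes "f \<in> H1_torus" shows "(\<lambda>x. c * f x) \<in> H1_torus"
  by (rule H1_torusI[OF L2_torus_scale[OF H1_torusD(1)[OF assms]]
        has_weak_deriv_scale[OF H1_torusD(2)[OF assms]] L2_torus_scale[OF H1_torusD(3)[OF assms]]])

lemma grad_sq_scale:
  assumes "f \<in> H1_torus" shows "grad_sq (\<lambda>x. c * f x) = c\<^sup>2 * grad_sq f"
proof -
  have "L2_norm (weak_deriv i (\<lambda>x. c * f x)) = \<bar>c\<bar> * L2_norm (weak_deriv i f)" for i
    unfolding L2_norm_scale[symmetric]
    by (rule L2_norm_cong_AE[OF weak_deriv_scale_AE[OF assms] L2_torusD(3)[OF H1_torusD(3)[OF H1_torus_scale[OF assms]]]
          L2_torusD(3)[OF L2_torus_scale[OF H1_torusD(3)[OF assms]]]])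
  then show ?thesis by (simp add: grad_sq_def power_mult_distrib sum_distrib_left)
qed

lemma mean_zero_eq_coeff: "mean_zero f \<longleftrightarrow> coeff_cos f 0 = 0"
  by (simp add: mean_zero_def coeff_cos_def ip_def cos_wave_def)

text \<open>A vanishing gradient leaves only the Fourier coefficient of frequency 0, which is the mean.\<close>

lemma mean_zero_grad_zero:
  assumes g: "g \<in> H1_torus" and mean: "mean_zero g" and grad: "grad_sq g = 0"
  shows "AE x in torus. g x = 0"
proof (rule coeff_eq_imp_AE_eq[OF H1_torusD(1)[OF g] L2_torus_const[of 0]])
  fix k :: "real ^ 'a" assume k: "k \<in> freqs"
  have z: "coeff_cos (\<lambda>x. 0) k = 0" "coeff_sin (\<lambda>x. 0) k = 0"
    by (simp_all add: coeff_cos_def coeff_sin_def ip_def)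
  have "coeff_cos g k = 0 \<and> coeff_sin g k = 0"
  proof (cases "k = 0")
    case True
    then show ?thesis using mean by (simp add: mean_zero_eq_coeff) (simp add: coeff_sin_def sin_wave_def ip_def)
  next
    case False
    then obtain i where i: "k $ i \<noteq> 0" by (auto simp: vec_eq_iff)
    have "(L2_norm (weak_deriv i g))\<^sup>2 = 0"
      using grad unfolding grad_sq_def by (subst (asm) sum_nonneg_eq_0_iff) auto
    then have "ip (weak_deriv i g) h = 0" if "h \<in> L2_torus" for h
      using Cauchy_Schwarz_L2[OF H1_torusD(3)[OF g] that, of i] by simp
    then have "coeff_cos (weak_deriv i g) k = 0" "coeff_sin (weak_deriv i g) k = 0"
      unfolding coeff_cos_def coeff_sin_def using L2_waves k by auto
    then show ?thesis using coeff_weak_deriv[OF H1_torusD(2)[OF g] k, of i] i by simp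
  qed
  then show "coeff_cos g k = coeff_cos (\<lambda>x. 0) k" "coeff_sin g k = coeff_sin (\<lambda>x. 0) k"
    using z by auto
qed

text \<open>If the gradient of \<open>g\<close> does not vanish, then \<open>g\<close> divided by its norm competes in the supremum.\<close>

lemma Hminus1_Hdot1_duality:
  assumes f: "f \<in> L2_torus" and g: "g \<in> H1_torus" and mean: "mean_zero g"
  shows "ennreal (ip f g) \<le> Hminus1_norm f * Hdot1_norm g"
proof (cases "grad_sq g = 0")
  case True
  have "ip f g = ip f (\<lambda>x. 0)"
    by (rule ip_cong_AE[OF _ mean_zero_grad_zero[OF g mean True]])
      (use f g in \<open>auto intro: L2_torusD(3) H1_torusD(1)\<close>)
  then show ?thesis by (simp add: ip_def)
next
  case False
  define y where "y = sqrt (grad_sq g)"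
  have y: "0 < y" using False grad_sq_nonneg[of g] by (simp add: y_def)
  have y2: "y\<^sup>2 = grad_sq g" using grad_sq_nonneg[of g] by (simp add: y_def)
  define h where "h x = (1 / y) * g x" for x
  have h: "h \<in> H1_torus" unfolding h_def[abs_def] by (rule H1_torus_scale[OF g])
  have "grad_sq h = 1"
    unfolding h_def[abs_def] grad_sq_scale[OF g] using False y2 by (simp add: power_divide)
  then have "Hdot1_norm h \<le> 1" using Hdot1_norm_H1[OF h] by simp
  moreover have "mean_zero h" using mean by (simp add: mean_zero_def h_def)
  ultimately have "ennreal (ip f h) \<le> Hminus1_norm f"
    unfolding Hminus1_norm_def ip_def using h by (intro SUP_upper) simp
  then have "ennreal y * ennreal (ip f h) \<le> ennreal y * Hminus1_norm f" by (rule mult_left_mono) simp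
  moreover have "ip f g = y * ip f h"
    unfolding h_def[abs_def] ip_scale_right using y by simp
  ultimately show ?thesis
    using y Hdot1_norm_H1[OF g] by (simp add: ennreal_mult' y_def mult.commute)
qed

section \<open>Mixing limits the decay of the pairing\<close>

text \<open>The constant function, as the wave of frequency 0, is a test function; its gradient vanishes, so the
  weak form reduces to an advection term, which vanishes by skew-symmetry.\<close>

lemma solution_mean_zero:
  fixes u :: "real \<Rightarrow> real ^ 'n \<Rightarrow> real ^ 'n"
  assumes u: "u \<in> Linf_loc_W1inf T" and div: "divergence_free T u" and mean: "mean_zero \<theta>0"
    and sol: "advection_diffusion_solution T \<kappa> u \<theta>0 \<theta>" and t: "t \<in> {0..<T}"
  shows "mean_zero (\<theta> t)"
proof -
  let ?e = "cos_wave 0 :: real ^ 'n \<Rightarrow> real"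
  have tp: "trig_poly ?e" by (intro trig_poly.cos freqs_intros)
  note e = H1_torus_trig_poly[OF tp]
  have de: "AE x in torus. weak_deriv i ?e x = 0" for i
    using weak_deriv_AE_eq[OF has_weak_deriv_trig_poly[OF tp], of i] by (simp add: partial_deriv_waves)
  obtain M where M: "AE s in lebesgue_on {0..t}. (\<forall>i. W1inf_le M (\<lambda>x. u s x $ i)) \<and>
    (AE x in torus. (\<Sum>i\<in>UNIV. weak_deriv i (\<lambda>y. u s y $ i) x) = 0)"
    using velocity_AE[OF u div t] by blast
  have "AE s in lebesgue_on {0..t}. weak_form \<kappa> (u s) (\<theta> s) ?e = 0"
    using M solution_dissipation(1)[OF sol t]
  proof eventually_elim
    case (elim s)
    then have w: "\<And>i. W1inf_le M (\<lambda>x. u s x $ i)"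
      and d: "AE x in torus. (\<Sum>i\<in>UNIV. weak_deriv i (\<lambda>y. u s y $ i) x) = 0"
      and H: "\<theta> s \<in> H1_torus" by auto
    have "advection (u s) ?e (\<theta> s) = 0"
      unfolding advection_def ip_def
    proof (intro sum.neutral ballI integral_eq_zero_AE)
      show "AE x in torus. u s x $ i * weak_deriv i ?e x * \<theta> s x = 0" for i
        using de[of i] by eventually_elim simp
    qed
    moreover have "grad_ip (\<theta> s) ?e = 0"
      unfolding grad_ip_def ip_def
    proof (intro sum.neutral ballI integral_eq_zero_AE)
      show "AE x in torus. weak_deriv i (\<theta> s) x * weak_deriv i ?e x = 0" for i
        using de[of i] by eventually_elim simp
    qed
    ultimately show ?case
      using advection_skew[OF w d H e] weak_form_eq[OF w H e] by simp
  qed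
  then have "(LINT s|lebesgue_on {0..t}. weak_form \<kappa> (u s) (\<theta> s) ?e) = 0" by (rule integral_eq_zero_AE)
  then have "(LINT s:{0..t}|lebesgue. weak_form \<kappa> (u s) (\<theta> s) ?e) = 0"
    unfolding set_lebesgue_integral_def by (subst (asm) integral_restrict_space) auto
  then show ?thesis
    using solutionD(4)[OF sol e t] mean by (simp add: mean_zero_eq_coeff coeff_cos_def)
qed

lemma grad_ip_le:
  assumes "f \<in> H1_torus" "g \<in> H1_torus"
  shows "grad_ip f g \<le> (grad_sq f + grad_sq g) / 2"
proof -
  have "ip (weak_deriv i f) (weak_deriv i g) \<le> ((L2_norm (weak_deriv i f))\<^sup>2 + (L2_norm (weak_deriv i g))\<^sup>2) / 2" for i
    using Cauchy_Schwarz_L2[OF H1_torusD(3)[OF assms(1)] H1_torusD(3)[OF assms(2)], of i i]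
      sum_squares_bound[of "L2_norm (weak_deriv i f)" "L2_norm (weak_deriv i g)"] by simp
  then show ?thesis
    unfolding grad_ip_def grad_sq_def sum.distrib[symmetric] sum_divide_distrib by (rule sum_mono)
qed

definition total_dissipation :: "(real \<Rightarrow> real ^ 'n \<Rightarrow> real) \<Rightarrow> real \<Rightarrow> real" where
  "total_dissipation \<theta> t = (LINT s|lebesgue_on {0..t}. dissipation \<theta> s)"

lemma total_dissipation_mono:
  assumes sol: "advection_diffusion_solution T \<kappa> u \<theta>0 \<theta>" and st: "s \<le> t" and t: "t \<in> {0..<T}"
  shows "total_dissipation \<theta> s \<le> total_dissipation \<theta> t"
proof (cases "0 \<le> s")
  case True
  have "integrable lebesgue (\<lambda>r. indicator {0..t} r *\<^sub>R dissipation \<theta> r)"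
    "integrable lebesgue (\<lambda>r. indicator {0..s} r *\<^sub>R dissipation \<theta> r)"
    using solution_dissipation(2)[OF sol, of t] solution_dissipation(2)[OF sol, of s] True st t
    by (simp_all add: integrable_restrict_space)
  then have "(LINT r|lebesgue. indicator {0..s} r *\<^sub>R dissipation \<theta> r)
      \<le> (LINT r|lebesgue. indicator {0..t} r *\<^sub>R dissipation \<theta> r)"
    using st by (intro integral_mono) (auto simp: indicator_def dissipation_nonneg)
  then show ?thesis
    unfolding total_dissipation_def by (simp add: integral_restrict_space)
next
  case False
  then have "total_dissipation \<theta> s = 0"
    unfolding total_dissipation_def by (subst integral_restrict_space) auto
  then show ?thesis
    unfolding total_dissipation_def by (simp add: integral_nonneg_AE dissipation_nonneg)
qed

lemma pairing_lower_bound: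
  fixes u :: "real \<Rightarrow> real ^ 'n \<Rightarrow> real ^ 'n"
  assumes u: "u \<in> Linf_loc_W1inf T" and div: "divergence_free T u" and \<theta>0: "\<theta>0 \<in> L2_torus"
    and F: "advection_diffusion_solution T 0 u \<theta>0 F"
    and G: "advection_diffusion_solution T \<kappa> u \<theta>0 G" and \<kappa>: "0 \<le> \<kappa>"
    and t: "t \<in> {0..<T}"
  shows "ip (F t) (G t) \<ge> (L2_norm \<theta>0)\<^sup>2 - \<kappa> / 2 * (total_dissipation F t + total_dissipation G t)"
proof -
  let ?M = "lebesgue_on {0..t}"
  obtain L where L: "integrable ?M L"
    "AE s in ?M. F s \<in> H1_torus \<and> G s \<in> H1_torus \<and> L s = (0 + \<kappa>) * grad_ip (F s) (G s)"
    "ip (F t) (G t) = (L2_norm \<theta>0)\<^sup>2 - (LINT s|?M. L s)"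
    using pairing_of_solutions[OF u div \<theta>0 F G t] by blast
  note int = solution_dissipation(2)[OF F t] solution_dissipation(2)[OF G t]
  have "(LINT s|?M. L s) \<le> (LINT s|?M. \<kappa> / 2 * (dissipation F s + dissipation G s))"
  proof (rule integral_mono_AE[OF L(1)])
    show "integrable ?M (\<lambda>s. \<kappa> / 2 * (dissipation F s + dissipation G s))" using int by simp
    show "AE s in ?M. L s \<le> \<kappa> / 2 * (dissipation F s + dissipation G s)"
      using L(2)
    proof eventually_elim
      case (elim s)
      then have "\<kappa> * grad_ip (F s) (G s) \<le> \<kappa> * ((grad_sq (F s) + grad_sq (G s)) / 2)"
        using \<kappa> by (intro mult_left_mono grad_ip_le) auto
      then show ?case using elim by (simp add: dissipation_H1)
    qed
  qed
  also have "\<dots> = \<kappa> / 2 * (total_dissipation F t + total_dissipation G t)"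
    using int by (simp add: total_dissipation_def)
  finally show ?thesis using L(3) by simp
qed

text \<open>The dissipation accumulated up to time \<open>t\<close> is a continuous function of \<open>t < T\<close>. It is unbounded by
  monotone convergence, so it takes all nonnegative values.\<close>

lemma dissipation_reaches:
  assumes sol: "advection_diffusion_solution T \<kappa> u \<theta>0 \<theta>"
    and blowup: "(\<integral>\<^sup>+s\<in>{0..<T}. (Hdot1_norm (\<theta> s))\<^sup>2 \<partial>lebesgue) = \<infinity>"
    and T: "T > 0" and c: "0 \<le> c"
  obtains t where "t \<in> {0..<T}" "total_dissipation \<theta> t = c"
proof -
  \<comment> \<open>Any sequence increasing to \<open>T\<close> from below would do.\<close>
  define \<tau> where "\<tau> n = T * (real n / real (Suc n))" for n
  have \<tau>: "\<tau> n \<in> {0..<T}" for n using T by (auto simp: \<tau>_def field_simps)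
  have mono: "\<tau> m \<le> \<tau> n" if "m \<le> n" for m n
  proof -
    have "real m / real (Suc m) \<le> real n / real (Suc n)" using that by (simp add: field_simps)
    then show ?thesis unfolding \<tau>_def using T by (intro mult_left_mono) auto
  qed
  have ex: "\<exists>n. r \<le> \<tau> n" if "r < T" for r
  proof -
    have "(\<lambda>n. T * (real n / real (Suc n))) \<longlonglongrightarrow> T * 1"
      by (intro tendsto_intros LIMSEQ_n_over_Suc_n)
    then have "\<forall>\<^sub>F n in sequentially. r < \<tau> n"
      unfolding \<tau>_def using that by (intro order_tendstoD(1)) auto
    then obtain n where "r < \<tau> n" by (auto simp: eventually_sequentially)
    then show ?thesis by (auto intro: less_imp_le)
  qed
  define h where "h n s = (Hdot1_norm (\<theta> s))\<^sup>2 * indicator {0..\<tau> n} s" for n s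
  have hm: "h n \<in> borel_measurable lebesgue" for n
    using measurable_Hdot1_norm_sq[OF solutionD(1)[OF sol] \<tau>]
    unfolding h_def[abs_def] by (subst (asm) borel_measurable_restrict_space_iff_ennreal) auto
  have hint: "(\<integral>\<^sup>+s. h n s \<partial>lebesgue) = ennreal (total_dissipation \<theta> (\<tau> n))" for n
    using solution_dissipation(3)[OF sol \<tau>] by (simp add: h_def total_dissipation_def)
  have "(\<integral>\<^sup>+s\<in>{0..<T}. (Hdot1_norm (\<theta> s))\<^sup>2 \<partial>lebesgue) = (\<integral>\<^sup>+s. (SUP n. h n s) \<partial>lebesgue)"
  proof (intro nn_integral_cong)
    fix s
    show "(Hdot1_norm (\<theta> s))\<^sup>2 * indicator {0..<T} s = (SUP n. h n s)"
    proof (cases "s \<in> {0..<T}")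
      case True
      then obtain n where "s \<le> \<tau> n" using ex by auto
      then have "h n s = (Hdot1_norm (\<theta> s))\<^sup>2" using True by (simp add: h_def)
      then have "(SUP n. h n s) = (Hdot1_norm (\<theta> s))\<^sup>2"
        by (intro antisym SUP_least) (auto simp: h_def indicator_def intro: SUP_upper2[of n])
      then show ?thesis using True by simp
    next
      case False
      then have "h n s = 0" for n using \<tau>[of n] by (auto simp: h_def indicator_def)
      then show ?thesis using False by simp
    qed
  qed
  also have "\<dots> = (SUP n. \<integral>\<^sup>+s. h n s \<partial>lebesgue)"
  proof (rule nn_integral_monotone_convergence_SUP[OF _ hm])
    show "incseq h"
    proof (intro monoI le_funI)
      fix m n :: nat and s assume "m \<le> n"
      from mono[OF this] show "h m s \<le> h n s" by (auto simp: h_def indicator_def)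
    qed
  qed
  finally have "(SUP n. ennreal (total_dissipation \<theta> (\<tau> n))) = \<infinity>" using blowup hint by simp
  then have "ennreal c < (SUP n. ennreal (total_dissipation \<theta> (\<tau> n)))"
    by (simp only: infinity_ennreal_def ennreal_less_top)
  then obtain n where "ennreal c < ennreal (total_dissipation \<theta> (\<tau> n))" by (auto simp: less_SUP_iff)
  then have n: "c \<le> total_dissipation \<theta> (\<tau> n)" using c by (simp add: ennreal_less_iff)
  have 0: "total_dissipation \<theta> 0 \<le> c"
  proof -
    have "AE s in lebesgue. s \<noteq> (0::real)"
      by (rule AE_I'[of "{0}"]) (auto simp: negligible_iff_null_sets[symmetric])
    then have "AE s in lebesgue. s \<in> {0..0} \<longrightarrow> dissipation \<theta> s = 0" by eventually_elim auto
    then have "AE s in lebesgue_on {0..0::real}. dissipation \<theta> s = 0"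
      by (subst AE_restrict_space_iff) auto
    then show ?thesis unfolding total_dissipation_def using c by (subst integral_eq_zero_AE) auto
  qed
  have "continuous_on {0..\<tau> n} (total_dissipation \<theta>)"
    unfolding total_dissipation_def[abs_def]
    by (rule indefinite_integral_continuous_real[OF solution_dissipation(2)[OF sol \<tau>]])
  then obtain t where "0 \<le> t" "t \<le> \<tau> n" "total_dissipation \<theta> t = c"
    using IVT'[of "total_dissipation \<theta>" 0 c "\<tau> n"] 0 n \<tau>[of n] by auto
  then show ?thesis using \<tau>[of n] by (intro that[of t]) auto
qed

text \<open>Duality and mixing give \<open>Q / 2 \<le> C * (Q / \<parallel>\<nabla>f\<parallel>) * \<parallel>\<nabla>g\<parallel>\<close>. If \<open>\<nabla>f\<close> vanishes the right-hand side is
  infinite, but then the conclusion is trivial.\<close>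

lemma gradient_comparison:
  assumes f: "f \<in> H1_torus" and g: "g \<in> H1_torus" and mean: "mean_zero g"
    and C: "0 \<le> C" and Q: "0 < Q"
    and mixing: "Hminus1_norm f \<le> ennreal C * (ennreal Q / Hdot1_norm f)"
    and pair: "Q / 2 \<le> ip f g"
  shows "grad_sq f \<le> 4 * C\<^sup>2 * grad_sq g"
proof (cases "grad_sq f = 0")
  case True
  then show ?thesis using grad_sq_nonneg[of g] by simp
next
  case False
  define x y where "x = sqrt (grad_sq f)" and "y = sqrt (grad_sq g)"
  have x: "0 < x" "x\<^sup>2 = grad_sq f" using False grad_sq_nonneg[of f] by (auto simp: x_def)
  have y: "0 \<le> y" "y\<^sup>2 = grad_sq g" using grad_sq_nonneg[of g] by (auto simp: y_def)
  have "ennreal (Q / 2) \<le> ennreal (ip f g)" using pair by (rule ennreal_leI)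
  also have "\<dots> \<le> Hminus1_norm f * Hdot1_norm g"
    by (rule Hminus1_Hdot1_duality[OF H1_torusD(1)[OF f] g mean])
  also have "\<dots> \<le> ennreal C * (ennreal Q / Hdot1_norm f) * Hdot1_norm g"
    by (rule mult_right_mono[OF mixing]) simp
  also have "\<dots> = ennreal (C * (Q / x) * y)"
    using C Q x(1) y(1) Hdot1_norm_H1[OF f] Hdot1_norm_H1[OF g]
    by (simp add: x_def[symmetric] y_def[symmetric] divide_ennreal ennreal_mult[symmetric])
  finally have "Q / 2 \<le> C * (Q / x) * y"
    using C Q x(1) y(1) by (simp add: ennreal_le_iff)
  then have "Q * x \<le> Q * (2 * C * y)" using x(1) by (simp add: field_simps)
  then have "x \<le> 2 * C * y" using Q by simp
  then have "x\<^sup>2 \<le> (2 * C * y)\<^sup>2" using x(1) by (intro power_mono) auto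
  then show ?thesis using x y by (simp add: power_mult_distrib)
qed

theorem proposition1p4:
  fixes T C :: real
    and u :: "real \<Rightarrow> real ^ 'n \<Rightarrow> real ^ 'n"
    and \<theta>0 :: "real ^ 'n \<Rightarrow> real"
    and \<theta> :: "real \<Rightarrow> real ^ 'n \<Rightarrow> real"
  assumes dim: "CARD('n) \<ge> 2"
    and T: "T > 0"
    and u: "u \<in> Linf_loc_W1inf T"
    and div: "divergence_free T u"
    and init: "\<theta>0 \<in> H2_torus" "mean_zero \<theta>0"
    and transport: "transport_solution T u \<theta>0 \<theta>"
    and blowup: "(\<integral>\<^sup>+s\<in>{0..<T}. (Hdot1_norm (\<theta> s))\<^sup>2 \<partial>lebesgue) = \<infinity>"
    and C: "C \<ge> 1"
    and mixing: "\<And>t. t \<in> {0..<T} \<Longrightarrow>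
      Hminus1_norm (\<theta> t) \<le> ennreal C * (ennreal ((L2_norm \<theta>0)\<^sup>2) / Hdot1_norm (\<theta> t))"
  shows "\<forall>\<kappa>>0. \<forall>\<theta>\<kappa>. advection_diffusion_solution T \<kappa> u \<theta>0 \<theta>\<kappa> \<longrightarrow>
    ennreal \<kappa> * (\<integral>\<^sup>+t\<in>{0..<T}. (Hdot1_norm (\<theta>\<kappa> t))\<^sup>2 \<partial>lebesgue)
      \<ge> ennreal (1 / (64 * C\<^sup>2) * (L2_norm \<theta>0)\<^sup>2)"
proof (intro allI impI)
  fix \<kappa> :: real and \<theta>\<kappa> assume \<kappa>: "\<kappa> > 0" and G: "advection_diffusion_solution T \<kappa> u \<theta>0 \<theta>\<kappa>"
  have F: "advection_diffusion_solution T 0 u \<theta>0 \<theta>" using transport by (simp add: transport_solution_def)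
  have \<theta>0: "\<theta>0 \<in> L2_torus" using init(1) by (auto simp: H2_torus_def intro: H1_torusD(1))
  define Q where "Q = (L2_norm \<theta>0)\<^sup>2"
  show "ennreal (1 / (64 * C\<^sup>2) * (L2_norm \<theta>0)\<^sup>2)
      \<le> ennreal \<kappa> * (\<integral>\<^sup>+t\<in>{0..<T}. (Hdot1_norm (\<theta>\<kappa> t))\<^sup>2 \<partial>lebesgue)"
  proof (rule ccontr)
    assume "\<not> ?thesis"
    then have small: "ennreal \<kappa> * (\<integral>\<^sup>+t\<in>{0..<T}. (Hdot1_norm (\<theta>\<kappa> t))\<^sup>2 \<partial>lebesgue)
        < ennreal (1 / (64 * C\<^sup>2) * Q)" by (simp add: Q_def not_le)
    then have "0 < ennreal (1 / (64 * C\<^sup>2) * Q)" by (rule order.strict_trans1[OF zero_le])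
    then have "0 < 1 / (64 * C\<^sup>2) * Q" by (simp only: ennreal_less_zero_iff)
    then have Q: "0 < Q" using C by (simp add: zero_less_mult_iff zero_less_divide_iff)
    \<comment> \<open>The value \<open>Q / 16\<close> is what the gradient comparison yields as a strict upper bound at the end.\<close>
    have "0 \<le> Q / (16 * \<kappa>)" using Q \<kappa> by simp
    then obtain t where t: "t \<in> {0..<T}" and tF: "total_dissipation \<theta> t = Q / (16 * \<kappa>)"
      using dissipation_reaches[OF F blowup T] by blast
    let ?M = "lebesgue_on {0..t}"
    have "ennreal (\<kappa> * total_dissipation \<theta>\<kappa> t)
        = ennreal \<kappa> * (\<integral>\<^sup>+s\<in>{0..t}. (Hdot1_norm (\<theta>\<kappa> s))\<^sup>2 \<partial>lebesgue)"
      using \<kappa> solution_dissipation(3)[OF G t] by (simp add: ennreal_mult' total_dissipation_def)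
    also have "\<dots> \<le> ennreal \<kappa> * (\<integral>\<^sup>+s\<in>{0..<T}. (Hdot1_norm (\<theta>\<kappa> s))\<^sup>2 \<partial>lebesgue)"
      using t by (intro mult_left_mono nn_integral_mono) (auto simp: indicator_def)
    also note small
    finally have "ennreal (\<kappa> * total_dissipation \<theta>\<kappa> t) < ennreal (Q / (64 * C\<^sup>2))" by simp
    moreover have "0 \<le> \<kappa> * total_dissipation \<theta>\<kappa> t"
      unfolding total_dissipation_def using \<kappa>
      by (intro mult_nonneg_nonneg integral_nonneg_AE) (auto simp: dissipation_nonneg)
    ultimately have tG: "\<kappa> * total_dissipation \<theta>\<kappa> t < Q / (64 * C\<^sup>2)"
      by (simp only: ennreal_less_iff)
    have pair: "Q / 2 \<le> ip (\<theta> s) (\<theta>\<kappa> s)" if s: "s \<in> {0..t}" for s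
    proof -
      have s': "s \<in> {0..<T}" using s t by auto
      have "\<kappa> * total_dissipation \<theta> s \<le> \<kappa> * total_dissipation \<theta> t"
        "\<kappa> * total_dissipation \<theta>\<kappa> s \<le> \<kappa> * total_dissipation \<theta>\<kappa> t"
        using s t \<kappa> by (auto intro!: mult_left_mono total_dissipation_mono[OF F] total_dissipation_mono[OF G])
      \<comment> \<open>The two dissipations contribute at most \<open>(Q / 16 + Q / 64) / 2\<close>, well below \<open>Q / 2\<close>.\<close>
      moreover have "Q / (64 * C\<^sup>2) \<le> Q / 64"
        using Q C by (intro divide_left_mono) (auto simp: one_le_power)
      moreover have "\<kappa> * total_dissipation \<theta> t = Q / 16" using tF \<kappa> by simp
      ultimately have "\<kappa> / 2 * (total_dissipation \<theta> s + total_dissipation \<theta>\<kappa> s) \<le> Q / 2"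
        using tG Q by (simp add: distrib_left)
      then show ?thesis
        using pairing_lower_bound[OF u div \<theta>0 F G less_imp_le[OF \<kappa>] s'] by (simp add: Q_def)
    qed
    have "AE s in ?M. dissipation \<theta> s \<le> 4 * C\<^sup>2 * dissipation \<theta>\<kappa> s"
      using solution_dissipation(1)[OF F t] solution_dissipation(1)[OF G t] AE_space
    proof eventually_elim
      case (elim s)
      then have s: "s \<in> {0..t}" by (simp add: space_restrict_space)
      then have s': "s \<in> {0..<T}" using t by auto
      have "grad_sq (\<theta> s) \<le> 4 * C\<^sup>2 * grad_sq (\<theta>\<kappa> s)"
        using C mixing[OF s']
        by (intro gradient_comparison[OF elim(1,2) solution_mean_zero[OF u div init(2) G s'] _ Q _ pair[OF s]])
          (auto simp: Q_def)
      then show ?case using elim by (simp add: dissipation_H1)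
    qed
    then have "total_dissipation \<theta> t \<le> (LINT s|?M. 4 * C\<^sup>2 * dissipation \<theta>\<kappa> s)"
      unfolding total_dissipation_def using solution_dissipation(2)[OF F t] solution_dissipation(2)[OF G t]
      by (intro integral_mono_AE) auto
    also have "\<dots> = 4 * C\<^sup>2 * total_dissipation \<theta>\<kappa> t" by (simp add: total_dissipation_def)
    finally have "\<kappa> * total_dissipation \<theta> t \<le> 4 * C\<^sup>2 * (\<kappa> * total_dissipation \<theta>\<kappa> t)"
      using \<kappa> by (simp add: mult.left_commute)
    also have "\<dots> < 4 * C\<^sup>2 * (Q / (64 * C\<^sup>2))"
      using tG C by (intro mult_strict_left_mono) auto
    also have "\<dots> = Q / 16" using C by (simp add: field_simps)
    finally show False using tF \<kappa> by simp
  qed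
qed

end
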